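(* Let $K$ be an algebraically closed field (of any characteristic) and let $1\le d\le 5$. (a) Any simple $d$-dimensional $B_3$-module over $K$ is uniquely determined, up to isomorphism, by the eigenvalues $\lambda_1,\dots,\lambda_d$ (listed with multiplicity) of the endomorphism $A$ by which $\sigma_1$ acts, together with, for $d=4$, the associated square root $\gamma^2$ of $\det(A)$, and, for $d=5$, the associated fifth root $\gamma$ of $\det(A)$. (For $d\le 3$ the eigenvalues alone suffice.) (b) Let $\lambda_1,\dots,\lambda_d\in K\setminus\{0\}$, not necessarily distinct; if $d=4$ let moreover $\gamma^2\in K$ be a square root of $\lambda_1\lambda_2\lambda_3\lambda_4$, and if $d=5$ let $\gamma\in K$ be a fifth root of $\lambda_1\lambda_2\lambda_3\lambda_4\lambda_5$. There exists a simple $d$-dimensional $B_3$-module over $K$ for which $A$ has eigenvalues $\lambda_1,\dots,\lambda_d$ (with multiplicity) and whose associated root is $\gamma^2$ (if $d=4$), respectively $\gamma$ (if $d=5$), if and only if $Q^{(d)}_{rs}\neq 0$ for all $r\ne s$ with $1\le r,s\le d$.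
   Context: $B_3$ is the braid group with generators $\sigma_1,\sigma_2$ and relation $\sigma_1\sigma_2\sigma_1=\sigma_2\sigma_1\sigma_2$. Modules are finite-dimensional over $K$. On a simple $d$-dimensional module the central element $(\sigma_1\sigma_2)^3$ acts by a scalar $\delta$, and $\delta^d=\det(A)^6$, where $A$ is the endomorphism by which $\sigma_1$ acts. Associated root: for a simple module of dimension $d=4$, the associated square root of $\det(A)$ is $\gamma^2=-\delta/\det(A)$; for a simple module of dimension $d=5$, the associated fifth root of $\det(A)$ is $\gamma=\delta/\det(A)$ (so that $\delta=\gamma^6$). The quantities $Q^{(d)}_{rs}$ ($r\neq s$) are $$Q_{rs}^{(2)}=-\lambda_r^2+\lambda_r\lambda_s-\lambda_s^2,$$ $$Q_{rs}^{(3)}=(\lambda_r^2+\lambda_s\lambda_k)(\lambda_s^2+\lambda_r\lambda_k),\qquad \{r,s,k\}=\{1,2,3\},$$ $$Q_{rs}^{(4)}=-\gamma^{-2}(\lambda_r^2+\gamma^2)(\lambda_s^2+\gamma^2)(\gamma^2+\lambda_r\lambda_k+\lambda_s\lambda_l)(\gamma^2+\lambda_r\lambda_l+\lambda_s\lambda_k),\qquad \{r,s,k,l\}=\{1,2,3,4\},$$ $$Q_{rs}^{(5)}=\gamma^{-8}(\gamma^2+\lambda_r\gamma+\lambda_r^2)(\gamma^2+\lambda_s\gamma+\lambda_s^2)\prod_{k\neq r,s}(\gamma^2+\lambda_r\lambda_k)(\gamma^2+\lambda_s\lambda_k).$$ For $d=1$ the condition on the $Q^{(d)}_{rs}$ is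 vacuous. *)

theory Defs
  imports
    "HOL-Algebra.Coset"
    "HOL-Computational_Algebra.Polynomial"
    "Jordan_Normal_Form.Char_Poly"
    "Jordan_Normal_Form.VS_Connect"
begin

datatype braid_gen = \<sigma>1 | \<sigma>2

text \<open>A letter \<open>(s, True)\<close> stands for the generator \<open>s\<close>, and \<open>(s, False)\<close> for its formal inverse.\<close>

type_synonym braid_word = "(braid_gen \<times> bool) list"

inductive braid_eq :: "braid_word \<Rightarrow> braid_word \<Rightarrow> bool" where
  refl: "braid_eq u u"
| sym: "braid_eq u v \<Longrightarrow> braid_eq v u"
| trans: "braid_eq u v \<Longrightarrow> braid_eq v w \<Longrightarrow> braid_eq u w"
| cong: "braid_eq u v \<Longrightarrow> braid_eq (x @ u @ y) (x @ v @ y)"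
| cancel: "braid_eq [(s, b), (s, \<not> b)] []"
| braid: "braid_eq [(\<sigma>1, True), (\<sigma>2, True), (\<sigma>1, True)] [(\<sigma>2, True), (\<sigma>1, True), (\<sigma>2, True)]"

definition braid_class :: "braid_word \<Rightarrow> braid_word set" where
  "braid_class u = {v. braid_eq u v}"

definition B3 :: "braid_word set monoid" where
  "B3 = \<lparr>carrier = range braid_class,
         mult = (\<lambda>X Y. {w. \<exists>u\<in>X. \<exists>v\<in>Y. braid_eq (u @ v) w}),
         one = braid_class []\<rparr>"

definition gen :: "braid_gen \<Rightarrow> braid_word set" where
  "gen s = braid_class [(s, True)]"

lemma braid_class_eq_iff: "braid_class u = braid_class v \<longleftrightarrow> braid_eq u v"
  unfolding braid_class_def by (blast intro: braid_eq.intros(1-3))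

lemma braid_eq_append:
  assumes "braid_eq u u'" "braid_eq v v'"
  shows "braid_eq (u @ v) (u' @ v')"
  using braid_eq.cong[OF assms(1), of "[]" v] braid_eq.cong[OF assms(2), of u' "[]"]
  by (auto intro: braid_eq.trans)

lemma mult_braid_class: "braid_class u \<otimes>\<^bsub>B3\<^esub> braid_class v = braid_class (u @ v)"
proof -
  have "{w. \<exists>u'\<in>braid_class u. \<exists>v'\<in>braid_class v. braid_eq (u' @ v') w} = braid_class (u @ v)"
    unfolding braid_class_def
    by (auto intro: braid_eq.refl braid_eq_append braid_eq.trans)
  then show ?thesis by (simp add: B3_def)
qed

lemma braid_left_inverse: "\<exists>v. braid_eq (v @ u) []"
proof (induction u)
  case Nil
  then show ?case by (auto intro: braid_eq.refl)
next
  case (Cons a u)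
  then obtain v where v: "braid_eq (v @ u) []" by blast
  obtain s b where a: "a = (s, b)" by (cases a)
  have "braid_eq (v @ [(s, \<not> b), (s, \<not> \<not> b)] @ u) (v @ [] @ u)"
    by (intro braid_eq.cong braid_eq.cancel)
  then have "braid_eq ((v @ [(s, \<not> b)]) @ a # u) []"
    using v a by (auto intro: braid_eq.trans)
  then show ?case by blast
qed

lemma group_B3: "group B3"
proof (rule groupI)
  fix x assume "x \<in> carrier B3"
  then obtain u where x: "x = braid_class u" by (auto simp: B3_def)
  obtain v where "braid_eq (v @ u) []" using braid_left_inverse by blast
  then have "braid_class v \<otimes>\<^bsub>B3\<^esub> x = \<one>\<^bsub>B3\<^esub>"
    by (simp add: x mult_braid_class braid_class_eq_iff, simp add: B3_def braid_class_eq_iff)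
  then show "\<exists>y\<in>carrier B3. y \<otimes>\<^bsub>B3\<^esub> x = \<one>\<^bsub>B3\<^esub>" by (auto simp: B3_def)
next
  fix x y assume "x \<in> carrier B3" "y \<in> carrier B3"
  then obtain u v where "x = braid_class u" "y = braid_class v" by (auto simp: B3_def)
  then have "x \<otimes>\<^bsub>B3\<^esub> y = braid_class (u @ v)" by (simp add: mult_braid_class)
  then show "x \<otimes>\<^bsub>B3\<^esub> y \<in> carrier B3" by (simp add: B3_def)
next
  fix x y z assume "x \<in> carrier B3" "y \<in> carrier B3" "z \<in> carrier B3"
  then obtain u v w where "x = braid_class u" "y = braid_class v" "z = braid_class w"
    by (auto simp: B3_def)
  then show "x \<otimes>\<^bsub>B3\<^esub> y \<otimes>\<^bsub>B3\<^esub> z = x \<otimes>\<^bsub>B3\<^esub> (y \<otimes>\<^bsub>B3\<^esub> z)"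
    by (simp add: mult_braid_class)
next
  fix x assume "x \<in> carrier B3"
  then obtain u where x: "x = braid_class u" by (auto simp: B3_def)
  have "\<one>\<^bsub>B3\<^esub> = braid_class []" by (simp add: B3_def)
  then show "\<one>\<^bsub>B3\<^esub> \<otimes>\<^bsub>B3\<^esub> x = x" by (simp add: x mult_braid_class)
qed (simp add: B3_def)

text \<open>A \<open>d\<close>-dimensional module is taken on the space \<open>K\<^sup>d\<close> of column vectors, that is, as a group
  homomorphism to \<open>GL(d, K)\<close>; choosing a basis, every \<open>d\<close>-dimensional module is isomorphic
  to one of these. Values of a module outside \<open>carrier B3\<close> are irrelevant.\<close>

definition GL :: "nat \<Rightarrow> 'k::field mat monoid" where
  "GL d = units_of (ring_mat TYPE('k) d ())"

definition B3_module :: "nat \<Rightarrow> (braid_word set \<Rightarrow> 'k::field mat) \<Rightarrow> bool" where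
  "B3_module d \<rho> \<longleftrightarrow> \<rho> \<in> hom B3 (GL d)"

definition simple_B3_module :: "nat \<Rightarrow> (braid_word set \<Rightarrow> 'k::field mat) \<Rightarrow> bool" where
  "simple_B3_module d \<rho> \<longleftrightarrow> B3_module d \<rho> \<and> d \<noteq> 0 \<and>
     (\<forall>W. subspace class_ring W (module_vec TYPE('k) d) \<and>
          (\<forall>g\<in>carrier B3. \<forall>w\<in>W. \<rho> g *\<^sub>v w \<in> W)
          \<longrightarrow> W = {0\<^sub>v d} \<or> W = carrier_vec d)"

definition B3_module_iso ::
    "nat \<Rightarrow> (braid_word set \<Rightarrow> 'k::field mat) \<Rightarrow> (braid_word set \<Rightarrow> 'k mat) \<Rightarrow> bool" where
  "B3_module_iso d \<rho> \<rho>' \<longleftrightarrow> (\<exists>P\<in>carrier (GL d). \<forall>g\<in>carrier B3. P * \<rho> g = \<rho>' g * P)"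

definition eigenvalue_mset :: "'k::field mat \<Rightarrow> 'k multiset" where
  "eigenvalue_mset A = proots (char_poly A)"

text \<open>The scalar by which the central element acts; meaningful for simple modules.\<close>

definition central_scalar :: "nat \<Rightarrow> (braid_word set \<Rightarrow> 'k::field mat) \<Rightarrow> 'k" where
  "central_scalar d \<rho> =
     (THE \<delta>. \<rho> ((gen \<sigma>1 \<otimes>\<^bsub>B3\<^esub> gen \<sigma>2) [^]\<^bsub>B3\<^esub> (3::nat)) = \<delta> \<cdot>\<^sub>m 1\<^sub>m d)"

text \<open>For \<open>d = 4\<close> the associated root is the element of \<open>K\<close> that is written \<open>\<gamma>\<^sup>2\<close> in the literature;
  no square root of it is chosen.\<close>

definition assoc_root4 :: "(braid_word set \<Rightarrow> 'k::field mat) \<Rightarrow> 'k" where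
  "assoc_root4 \<rho> = - central_scalar 4 \<rho> / det (\<rho> (gen \<sigma>1))"

definition assoc_root5 :: "(braid_word set \<Rightarrow> 'k::field mat) \<Rightarrow> 'k" where
  "assoc_root5 \<rho> = central_scalar 5 \<rho> / det (\<rho> (gen \<sigma>1))"

text \<open>In \<open>Q3\<close> the product has the single factor given by \<open>{r, s, k} = {1, 2, 3}\<close>. In \<open>Q4\<close> the double
  product has the two factors given by \<open>{r, s, k, l} = {1, 2, 3, 4}\<close>, and \<open>g2\<close> stands for \<open>\<gamma>\<^sup>2\<close>.\<close>

definition Q2 :: "(nat \<Rightarrow> 'k::field) \<Rightarrow> nat \<Rightarrow> nat \<Rightarrow> 'k" where
  "Q2 lam r s = - ((lam r)^2) + lam r * lam s - (lam s)^2"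

definition Q3 :: "(nat \<Rightarrow> 'k::field) \<Rightarrow> nat \<Rightarrow> nat \<Rightarrow> 'k" where
  "Q3 lam r s =
     (\<Prod>k\<in>{1..3} - {r, s}. ((lam r)^2 + lam s * lam k) * ((lam s)^2 + lam r * lam k))"

definition Q4 :: "(nat \<Rightarrow> 'k::field) \<Rightarrow> 'k \<Rightarrow> nat \<Rightarrow> nat \<Rightarrow> 'k" where
  "Q4 lam g2 r s =
     - inverse g2 * ((lam r)^2 + g2) * ((lam s)^2 + g2) *
     (\<Prod>k\<in>{1..4} - {r, s}. \<Prod>l\<in>{1..4} - {r, s, k}. g2 + lam r * lam k + lam s * lam l)"

definition Q5 :: "(nat \<Rightarrow> 'k::field) \<Rightarrow> 'k \<Rightarrow> nat \<Rightarrow> nat \<Rightarrow> 'k" where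
  "Q5 lam \<gamma> r s =
     inverse (\<gamma>^8) * (\<gamma>^2 + lam r * \<gamma> + (lam r)^2) * (\<gamma>^2 + lam s * \<gamma> + (lam s)^2) *
     (\<Prod>k\<in>{1..5} - {r, s}. (\<gamma>^2 + lam r * lam k) * (\<gamma>^2 + lam s * lam k))"

text \<open>The argument \<open>g\<close> is \<open>\<gamma>\<^sup>2\<close> for \<open>d = 4\<close>, is \<open>\<gamma>\<close> for \<open>d = 5\<close>, and is unused otherwise.
  The default value \<open>1\<close> is never reached for two distinct indices in \<open>{1..d}\<close>, \<open>d \<le> 5\<close>.\<close>

definition braid_Q :: "nat \<Rightarrow> (nat \<Rightarrow> 'k::field) \<Rightarrow> 'k \<Rightarrow> nat \<Rightarrow> nat \<Rightarrow> 'k" where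
  "braid_Q d lam g r s =
     (if d = 2 then Q2 lam r s
      else if d = 3 then Q3 lam r s
      else if d = 4 then Q4 lam g r s
      else if d = 5 then Q5 lam g r s
      else 1)"

end

theory Submission
  imports Defs "HOL-Decision_Procs.Commutative_Ring"
begin

text \<open>
  Put \<open>X = \<sigma>\<^sub>1\<sigma>\<^sub>2\<sigma>\<^sub>1\<close> and \<open>Y = \<sigma>\<^sub>1\<sigma>\<^sub>2\<close>. The braid relation says \<open>X\<^sup>2 = Y\<^sup>3\<close>, and this element is
  central, so on a simple module over an algebraically closed field it is a scalar \<open>\<delta>\<close>. Conversely
  \<open>\<sigma>\<^sub>2 = X Y\<^sup>-\<^sup>1\<close> and \<open>\<sigma>\<^sub>1 = Y\<^sup>-\<^sup>1 X\<close>. A simple module is therefore an irreducible pair of matrices with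
  \<open>X\<^sup>2 = Y\<^sup>3 = \<delta>\<close>. Write \<open>B\<close> for \<open>\<sigma>\<^sub>2\<close>, which is conjugate to \<open>\<sigma>\<^sub>1\<close> by \<open>X\<close> and so has the same eigenvalues.

  An eigenvector of \<open>B\<close> for the eigenvalue \<open>\<alpha>\<close> has the form \<open>Y v\<close> with \<open>X v = \<alpha> Y v\<close>. In the sequence
  \<open>v, Y v, Y\<^sup>2 v, X Y\<^sup>2 v, Y X Y\<^sup>2 v\<close> every vector but the last is mapped by \<open>X\<close> and \<open>Y\<close> into the span of
  itself, its predecessors and its successor. A first linear dependence would produce a proper
  invariant subspace, so the first \<open>d \<le> 5\<close> vectors are a basis (\<open>orbit_basis\<close>). In this basis only one
  column of \<open>X\<close> or \<open>Y\<close> or of each is unknown. The product of \<open>B - e\<close> over the eigenvalues \<open>e\<close> other than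
  \<open>\<alpha>\<close> maps everything into the line of \<open>Y v\<close> (\<open>deflation\<close>); together with \<open>X\<^sup>2 = Y\<^sup>3 = \<delta>\<close> and the
  associated root this determines all entries (\<open>nf_shape\<close>). Hence every module is conjugate to one explicit
  pair of matrices, the normal form, which depends only on the eigenvalues and the root
  (\<open>normal_form_exists\<close>). This is uniqueness. The normal form also satisfies the relations
  for arbitrary nonzero eigenvalues, and it remains to decide when it is irreducible.

  The polynomials \<open>Q\<close> enter through one identity in the normal form. Let \<open>C\<close> be the product of \<open>B - e\<close> over
  the eigenvalues other than \<open>\<alpha>\<close>, and \<open>D\<close> the product over the eigenvalues other than \<open>\<mu>\<close>. Then
  \<open>C X D v = \<alpha> Q Y v\<close>, where \<open>Q\<close> is the polynomial for the pair \<open>\<alpha>, \<mu>\<close> (\<open>Q_identity\<close>).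

  If \<open>W\<close> is an invariant subspace without \<open>v\<close>, then \<open>C W = 0\<close>, because \<open>C W\<close> lies in the line of \<open>Y v\<close>.
  If also \<open>W \<noteq> 0\<close>, it contains an eigenvector of \<open>B\<close> for some eigenvalue \<open>\<mu>\<close>. The vector \<open>D v\<close> is a
  multiple of it, so \<open>C X D v = 0\<close> and \<open>Q = 0\<close> (\<open>irreducible_if\<close>).

  Conversely let the pair be irreducible and \<open>Q = 0\<close>. The operator \<open>F = C X D\<close> satisfies \<open>F B = \<mu> F\<close> and
  kills \<open>v\<close> and \<open>Y v\<close>; it then kills the whole basis (\<open>annihilates_orbit\<close>), so \<open>F = 0\<close>. The same argument
  with \<open>C\<close> and an eigenvector for \<open>\<mu>\<close> gives \<open>C = 0\<close> or \<open>D = 0\<close>. But no polynomial of degree \<open>d - 1\<close>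
  that vanishes at an eigenvalue annihilates \<open>B\<close>: eigenspaces are lines, since two eigenvectors for \<open>\<alpha>\<close>
  yield two bases with the same normal form and the change of basis is scalar by Schur's lemma
  (\<open>eigenvector_unique\<close>, \<open>not_annihilated\<close>, \<open>Q_value_nonzero\<close>).

  All this assumes \<open>d \<ge> 2\<close>. In dimension one \<open>\<sigma>\<^sub>1\<close> and \<open>\<sigma>\<^sub>2\<close> act by the same scalar.
\<close>

section \<open>Linear algebra over coordinate spaces\<close>

subsection \<open>Subspaces and invertible matrices\<close>

lemma subspace_module_vec_iff:
  "subspace class_ring W (module_vec TYPE('k::field) d) \<longleftrightarrow>
     W \<subseteq> carrier_vec d \<and> 0\<^sub>v d \<in> W \<and> (\<forall>v\<in>W. \<forall>w\<in>W. v + w \<in> W) \<and> (\<forall>c. \<forall>v\<in>W. c \<cdot>\<^sub>v v \<in> W)"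
proof -
  interpret vec_space "TYPE('k)" d .
  show ?thesis
    using vec_vs vec_module
    by (auto simp: subspace_def submodule_def module_vec_simps class_ring_simps)
qed

lemma mult_unit_vec:
  assumes "M \<in> carrier_mat n m" "j < m"
  shows "M *\<^sub>v unit_vec m j = col M (j :: nat)" "(M :: 'k::field mat) *\<^sub>v unit_vec m j \<in> carrier_vec n"
  using assms by (auto intro!: eq_vecI)

lemma smult_mult_mat_vec:
  assumes "M \<in> carrier_mat n m" "u \<in> carrier_vec m"
  shows "(c \<cdot>\<^sub>m M) *\<^sub>v u = c \<cdot>\<^sub>v (M *\<^sub>v (u :: 'k::comm_ring_1 vec))"
  using assms by (auto intro!: eq_vecI simp: scalar_prod_def sum_distrib_left mult.assoc)

lemma scaled_inverse:
  fixes M N :: "'k::field mat"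
  assumes "M \<in> carrier_mat d d" "N \<in> carrier_mat d d" "M * N = c \<cdot>\<^sub>m 1\<^sub>m d" "c \<noteq> 0"
  shows "M * (inverse c \<cdot>\<^sub>m N) = 1\<^sub>m d" "(inverse c \<cdot>\<^sub>m N) * M = 1\<^sub>m d"
proof -
  show 1: "M * (inverse c \<cdot>\<^sub>m N) = 1\<^sub>m d"
    using assms by (simp add: mult_smult_distrib[of _ d d _ d]) (auto intro!: eq_matI)
  show "(inverse c \<cdot>\<^sub>m N) * M = 1\<^sub>m d"
    using mat_mult_left_right_inverse[OF _ _ 1] assms by simp
qed

lemma inverse_if_injective:
  fixes P :: "'k::field mat"
  assumes P: "P \<in> carrier_mat d d"
    and inj: "\<And>c. c \<in> carrier_vec d \<Longrightarrow> P *\<^sub>v c = 0\<^sub>v d \<Longrightarrow> c = 0\<^sub>v d"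
  obtains Q where "Q \<in> carrier_mat d d" "P * Q = 1\<^sub>m d" "Q * P = 1\<^sub>m d"
proof -
  have "det P \<noteq> 0"
    using det_0_iff_vec_prod_zero_field[OF P] inj by auto
  from det_non_zero_imp_unit[OF P this, of "()"] show ?thesis
    using that by (auto simp: Units_def ring_mat_simps)
qed

text \<open>Padding \<open>M\<close> with zero columns gives a singular square matrix, and a nonzero vector in the kernel of the
  transpose is orthogonal to the image.\<close>

lemma wide_image_proper:
  fixes M :: "'k::field mat"
  assumes M: "M \<in> carrier_mat d k" and k: "k < d"
  shows "\<exists>u\<in>carrier_vec d. \<forall>c\<in>carrier_vec k. M *\<^sub>v c \<noteq> u"
proof (rule ccontr)
  assume *: "\<not> ?thesis"
  define M' where "M' = mat d d (\<lambda>(i, j). if j < k then M $$ (i, j) else 0)"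
  have M': "M' \<in> carrier_mat d d" by (simp add: M'_def)
  have "M' *\<^sub>v unit_vec d k = 0\<^sub>v d"
    using k by (auto simp: M'_def scalar_prod_def unit_vec_def intro!: eq_vecI sum.neutral)
  moreover have "unit_vec d k \<noteq> (0\<^sub>v d :: 'k vec)"
    using k by (metis index_unit_vec(2) index_zero_vec(1) zero_neq_one)
  ultimately have "det M' = 0"
    using det_0_iff_vec_prod_zero_field[OF M'] unit_vec_carrier by blast
  then have "det (M'\<^sup>T) = 0" by (simp add: det_transpose[OF M'])
  then obtain u where u: "u \<in> carrier_vec d" "u \<noteq> 0\<^sub>v d" "M'\<^sup>T *\<^sub>v u = 0\<^sub>v d"
    using det_0_iff_vec_prod_zero_field[of "M'\<^sup>T" d] M' by auto
  have "x \<bullet> u = 0" if x: "x \<in> carrier_vec d" for x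
  proof -
    obtain c where c: "c \<in> carrier_vec k" "M *\<^sub>v c = x" using * x by auto
    define c' where "c' = vec d (\<lambda>j. if j < k then c $ j else 0)"
    have c': "c' \<in> carrier_vec d" by (simp add: c'_def)
    have "M' *\<^sub>v c' = x"
    proof (rule eq_vecI)
      fix i assume "i < dim_vec x"
      then have i: "i < d" using x by auto
      have "(M' *\<^sub>v c') $ i = (\<Sum>j\<in>{0..<d}. if j < k then M $$ (i, j) * c $ j else 0)"
        using i by (auto simp: M'_def c'_def scalar_prod_def intro!: sum.cong)
      also have "\<dots> = (\<Sum>j\<in>{0..<k}. M $$ (i, j) * c $ j)"
        using k by (intro sum.mono_neutral_cong_right) auto
      also have "\<dots> = (M *\<^sub>v c) $ i"
        using M c(1) i by (auto simp: scalar_prod_def intro!: sum.cong)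
      finally show "(M' *\<^sub>v c') $ i = x $ i" using c(2) by simp
    qed (use M' x in auto)
    then show ?thesis
      using transpose_vec_mult_scalar[OF M' c' u(1)] u(3) c' x comm_scalar_prod[OF x u(1)] by simp
  qed
  then have "unit_vec d i \<bullet> u = 0" for i by simp
  then have "u $ i = 0" if "i < d" for i using scalar_prod_left_unit[OF u(1) that] by simp
  then have "u = 0\<^sub>v d" using u(1) by (auto intro!: eq_vecI)
  with u(2) show False by simp
qed

subsection \<open>Products of linear factors of a matrix\<close>

fun lin_prod :: "'k::comm_ring_1 list \<Rightarrow> 'k mat \<Rightarrow> 'k mat" where
  "lin_prod [] B = 1\<^sub>m (dim_row B)"
| "lin_prod (e # es) B = (B - e \<cdot>\<^sub>m 1\<^sub>m (dim_row B)) * lin_prod es B"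

lemma lin_prod_carrier [simp]: "B \<in> carrier_mat n n \<Longrightarrow> lin_prod es B \<in> carrier_mat n n"
  by (induction es) auto

lemma lin_prod_vec_carrier [simp]:
  "B \<in> carrier_mat n n \<Longrightarrow> u \<in> carrier_vec n \<Longrightarrow> lin_prod es B *\<^sub>v u \<in> carrier_vec n"
  by (rule mult_mat_vec_carrier[OF lin_prod_carrier])

lemma lin_prod_Nil_vec [simp]:
  "B \<in> carrier_mat n n \<Longrightarrow> u \<in> carrier_vec n \<Longrightarrow> lin_prod [] B *\<^sub>v u = u"
  by auto

lemma lin_prod_Cons_vec:
  assumes "B \<in> carrier_mat n n" "u \<in> carrier_vec n"
  shows "lin_prod (e # es) B *\<^sub>v u = B *\<^sub>v (lin_prod es B *\<^sub>v u) - e \<cdot>\<^sub>v (lin_prod es B *\<^sub>v u)"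
proof -
  have w: "lin_prod es B *\<^sub>v u \<in> carrier_vec n" using assms by simp
  have "lin_prod (e # es) B *\<^sub>v u = (B - e \<cdot>\<^sub>m 1\<^sub>m n) *\<^sub>v (lin_prod es B *\<^sub>v u)"
    using assms unfolding lin_prod.simps by (subst assoc_mult_mat_vec[of _ n n _ n]) auto
  also have "\<dots> = B *\<^sub>v (lin_prod es B *\<^sub>v u) - (e \<cdot>\<^sub>m 1\<^sub>m n) *\<^sub>v (lin_prod es B *\<^sub>v u)"
    using assms w by (intro minus_mult_distrib_mat_vec[of _ n n]) auto
  also have "(e \<cdot>\<^sub>m 1\<^sub>m n) *\<^sub>v (lin_prod es B *\<^sub>v u) = e \<cdot>\<^sub>v (lin_prod es B *\<^sub>v u)"
    using w by (simp add: smult_mult_mat_vec[of _ n n])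
  finally show ?thesis .
qed

lemma eq_mat_on_vecI:
  fixes M :: "'k::field mat"
  assumes "M \<in> carrier_mat n m" "N \<in> carrier_mat n m"
    and "\<And>u. u \<in> carrier_vec m \<Longrightarrow> M *\<^sub>v u = N *\<^sub>v u"
  shows "M = N"
proof (rule eq_matI)
  fix i j assume "i < dim_row N" "j < dim_col N"
  then have "i < n" "j < m" using assms by auto
  moreover have "col M j = col N j"
    using assms(3)[of "unit_vec m j"] \<open>j < m\<close> by (simp add: mult_unit_vec[OF assms(1)] mult_unit_vec[OF assms(2)])
  then have "col M j $ i = col N j $ i" by simp
  ultimately show "M $$ (i, j) = N $$ (i, j)" using assms(1,2) by simp
qed (use assms in auto)

lemma lin_prod_intertwine:
  assumes "B \<in> carrier_mat n n" "B' \<in> carrier_mat m m" "S \<in> carrier_mat n m" "B * S = S * B'"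
  shows "lin_prod es B * S = S * (lin_prod es B' :: 'k::field mat)"
proof (rule eq_mat_on_vecI[of _ n m])
  fix u :: "'k vec" assume u: "u \<in> carrier_vec m"
  have "lin_prod es B *\<^sub>v (S *\<^sub>v u) = S *\<^sub>v (lin_prod es B' *\<^sub>v u)"
  proof (induction es)
    case (Cons e es)
    let ?w = "lin_prod es B' *\<^sub>v u"
    have w: "?w \<in> carrier_vec m" using assms u by simp
    have "B *\<^sub>v (S *\<^sub>v ?w) = S *\<^sub>v (B' *\<^sub>v ?w)"
      using assms w by (metis assoc_mult_mat_vec)
    then show ?case
      using Cons assms u w
      by (simp add: lin_prod_Cons_vec[of _ n] lin_prod_Cons_vec[of _ m] del: lin_prod.simps
        add: mult_minus_distrib_mat_vec[of _ n m] mult_mat_vec[of _ n m])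
  qed (use assms u in auto)
  then show "lin_prod es B * S *\<^sub>v u = S * lin_prod es B' *\<^sub>v u"
    using assms u by (simp add: assoc_mult_mat_vec[of _ n n _ m] assoc_mult_mat_vec[of _ n m _ m])
qed (use assms lin_prod_carrier[OF assms(1)] lin_prod_carrier[OF assms(2)] in \<open>auto intro: mult_carrier_mat[of _ n n _ m] mult_carrier_mat[of _ n m _ m]\<close>)

lemma lin_prod_commute:
  assumes "B \<in> carrier_mat n n"
  shows "lin_prod es B * B = B * (lin_prod es B :: 'k::field mat)"
  using lin_prod_intertwine[of B n B n B] assms by simp

lemma lin_prod_append:
  assumes "B \<in> carrier_mat n n"
  shows "lin_prod (es @ fs) B = lin_prod es B * (lin_prod fs B :: 'k::field mat)"
  using assms by (induction es) (auto simp: assoc_mult_mat[of _ n n _ n _ n] left_mult_one_mat[of _ n n] minus_carrier_mat)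

lemma lin_prod_eigenvector:
  assumes "B \<in> carrier_mat n n" "u \<in> carrier_vec n" "B *\<^sub>v u = \<mu> \<cdot>\<^sub>v (u :: 'k::field vec)"
  shows "lin_prod es B *\<^sub>v u = (\<Prod>e\<leftarrow>es. \<mu> - e) \<cdot>\<^sub>v u"
proof (induction es)
  case (Cons e es)
  then show ?case
    using assms by (simp add: lin_prod_Cons_vec[of _ n] mult_mat_vec[of _ n n] del: lin_prod.simps)
      (auto intro!: eq_vecI simp: algebra_simps)
qed (use assms in auto)

lemma lin_prod_swap:
  assumes B: "B \<in> carrier_mat n n"
  shows "lin_prod es B * lin_prod fs B = lin_prod fs B * (lin_prod es B :: 'k::field mat)"
  using lin_prod_intertwine[of B n B n "lin_prod fs B" es] lin_prod_commute[OF B, of fs] B by simp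

lemma lin_prod_mset_eq:
  assumes B: "B \<in> carrier_mat n n" and "mset es = mset fs"
  shows "lin_prod es B = (lin_prod fs B :: 'k::field mat)"
  using assms(2)
proof (induction es arbitrary: fs)
  case (Cons e es)
  then have "e \<in> set fs" by (metis list.set_intros(1) set_mset_mset)
  then obtain xs ys where fs: "fs = xs @ e # ys" by (auto simp: in_set_conv_decomp)
  with Cons have es: "lin_prod es B = lin_prod (xs @ ys) B" by auto
  have "lin_prod fs B = lin_prod xs B * (lin_prod [e] B * lin_prod ys B)"
    using lin_prod_append[OF B, of xs "e # ys"] lin_prod_append[OF B, of "[e]" ys] by (simp add: fs)
  also have "\<dots> = (lin_prod xs B * lin_prod [e] B) * lin_prod ys B"
    using B by (intro assoc_mult_mat[symmetric, of _ n n _ n _ n]) (auto simp del: lin_prod.simps)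
  also have "lin_prod xs B * lin_prod [e] B = lin_prod [e] B * lin_prod xs B"
    by (rule lin_prod_swap[OF B])
  also have "lin_prod [e] B * lin_prod xs B * lin_prod ys B = lin_prod [e] B * (lin_prod xs B * lin_prod ys B)"
    using B by (intro assoc_mult_mat[of _ n n _ n _ n]) (auto simp del: lin_prod.simps)
  also have "\<dots> = lin_prod (e # es) B"
    using lin_prod_append[OF B, of "[e]" es] lin_prod_append[OF B, of xs ys] es by simp
  finally show ?case ..
qed auto

subsection \<open>Deflation by an eigenvector\<close>

lemma matrix_with_first_column:
  fixes y :: "'k::field vec"
  assumes y: "y \<in> carrier_vec (Suc n)" "y \<noteq> 0\<^sub>v (Suc n)"
  obtains S T where "S \<in> carrier_mat (Suc n) (Suc n)" "T \<in> carrier_mat (Suc n) (Suc n)"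
    "S * T = 1\<^sub>m (Suc n)" "T * S = 1\<^sub>m (Suc n)" "S *\<^sub>v unit_vec (Suc n) 0 = y"
proof -
  obtain k where k: "k < Suc n" "y $ k \<noteq> 0" using y by (metis carrier_vecD eq_vecI index_zero_vec)
  \<comment> \<open>The identity matrix with columns \<open>0\<close> and \<open>k\<close> exchanged and the new column \<open>0\<close> replaced by \<open>y\<close>.\<close>
  define S where "S = mat (Suc n) (Suc n)
    (\<lambda>(i, j). if j = 0 then y $ i else if i = (if j = k then 0 else j) then 1 else 0)"
  have S: "S \<in> carrier_mat (Suc n) (Suc n)" by (simp add: S_def)
  have first: "S *\<^sub>v unit_vec (Suc n) 0 = y"
    using y by (subst mult_unit_vec[OF S]) (auto simp: S_def intro!: eq_vecI)
  have inj: "c = 0\<^sub>v (Suc n)" if c: "c \<in> carrier_vec (Suc n)" and Sc: "S *\<^sub>v c = 0\<^sub>v (Suc n)" for c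
  proof -
    have sum: "(\<Sum>j\<in>{0..<Suc n}. S $$ (i, j) * c $ j) = 0" if "i < Suc n" for i
    proof -
      have "(S *\<^sub>v c) $ i = 0" using Sc that by simp
      then show ?thesis using that S c by (simp add: scalar_prod_def)
    qed
    have "(\<Sum>j\<in>{0..<Suc n}. S $$ (k, j) * c $ j) = (\<Sum>j\<in>{0}. S $$ (k, j) * c $ j)"
      using k by (intro sum.mono_neutral_right) (auto simp: S_def)
    then have c0: "c $ 0 = 0" using sum[OF k(1)] k by (simp add: S_def)
    show ?thesis
    proof (rule eq_vecI)
      fix j assume "j < dim_vec (0\<^sub>v (Suc n) :: 'k vec)"
      then have j: "j < Suc n" by simp
      show "c $ j = 0\<^sub>v (Suc n) $ j"
      proof (cases "j = 0")
        case False
        define i where "i = (if j = k then 0 else j)"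
        have i: "i < Suc n" using j by (simp add: i_def)
        have "(\<Sum>l\<in>{0..<Suc n}. S $$ (i, l) * c $ l) = (\<Sum>l\<in>{j}. S $$ (i, l) * c $ l)"
          using j i c0 False by (intro sum.mono_neutral_right) (auto simp: S_def i_def split: if_splits)
        then show ?thesis using sum[OF i] i j False by (simp add: S_def i_def)
      qed (use c0 in auto)
    qed (use c in auto)
  qed
  from inverse_if_injective[OF S inj] show ?thesis using that S first by metis
qed

definition tail_vec :: "'k vec \<Rightarrow> 'k vec" where
  "tail_vec u = vec (dim_vec u - 1) (\<lambda>i. u $ Suc i)"

text \<open>In a basis that starts with \<open>y\<close> the matrix is block triangular, and \<open>es\<close> are the eigenvalues of the block
  \<open>N\<close> that acts on the quotient by the line of \<open>y\<close>. The claim is that the product of linear factors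
  vanishes on this quotient. It follows by induction: the claim for \<open>N\<close> and an eigenvector for the head of
  the list puts the image of the remaining factors into an eigenline, which the first factor kills.\<close>

lemma deflation:
  fixes B :: "'k::field mat"
  assumes "B \<in> carrier_mat n n" "char_poly B = (\<Prod>e\<leftarrow>\<mu> # es. [:-e, 1:])"
    and "y \<in> carrier_vec n" "y \<noteq> 0\<^sub>v n" "B *\<^sub>v y = \<mu> \<cdot>\<^sub>v y" and "u \<in> carrier_vec n"
  shows "\<exists>a. lin_prod es B *\<^sub>v u = a \<cdot>\<^sub>v y"
  using assms
proof (induction es arbitrary: \<mu> n B y u)
  case Nil
  then have "n = 1"
    using degree_monic_char_poly[of B n] by simp
  have "y $ 0 \<noteq> 0"
  proof
    assume "y $ 0 = 0"
    then have "y = 0\<^sub>v n" using Nil.prems(3) \<open>n = 1\<close> by (intro eq_vecI) auto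
    with Nil.prems(4) show False by simp
  qed
  then have "u = (u $ 0 / y $ 0) \<cdot>\<^sub>v y"
    using Nil.prems(3,6) \<open>n = 1\<close> by (intro eq_vecI) auto
  then show ?case using Nil.prems(1,6) by (metis lin_prod_Nil_vec)
next
  case (Cons e es)
  note B = Cons.prems(1) and cp = Cons.prems(2) and y = Cons.prems(3-5) and u = Cons.prems(6)
  have "degree (char_poly B) = Suc (Suc (length es))"
    unfolding cp using degree_linear_factors[of uminus "\<mu> # e # es"] by (simp del: mult_pCons_left)
  then obtain m where n: "n = Suc m" using degree_monic_char_poly[OF B] by auto
  from matrix_with_first_column[of y m] y[unfolded n] obtain S T where
    S: "S \<in> carrier_mat n n" and T: "T \<in> carrier_mat n n" and ST: "S * T = 1\<^sub>m n" and TS: "T * S = 1\<^sub>m n"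
    and Se: "S *\<^sub>v unit_vec n 0 = y"
    unfolding n by metis
  define M where "M = T * B * S"
  have M: "M \<in> carrier_mat n n" using B S T by (simp add: M_def)
  have SM: "B * S = S * M"
  proof -
    have "S * M = (S * T) * (B * S)"
      using B S T by (simp add: M_def assoc_mult_mat[of _ n n _ n _ n])
    then show ?thesis using ST B S by simp
  qed
  have sim: "char_poly M = char_poly B"
    by (intro char_poly_similar similar_matI[of _ _ T S n]) (use B S T ST TS M in \<open>auto simp: M_def\<close>)
  have "S *\<^sub>v (M *\<^sub>v unit_vec n 0) = S *\<^sub>v (\<mu> \<cdot>\<^sub>v unit_vec n 0)"
    using SM S M B y Se by (metis assoc_mult_mat_vec mult_mat_vec unit_vec_carrier)
  have TSv: "T *\<^sub>v (S *\<^sub>v w) = w" if "w \<in> carrier_vec n" for w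
    using assoc_mult_mat_vec[OF T S that] TS that by simp
  from \<open>S *\<^sub>v (M *\<^sub>v unit_vec n 0) = S *\<^sub>v (\<mu> \<cdot>\<^sub>v unit_vec n 0)\<close>
  have "T *\<^sub>v (S *\<^sub>v (M *\<^sub>v unit_vec n 0)) = T *\<^sub>v (S *\<^sub>v (\<mu> \<cdot>\<^sub>v unit_vec n 0))" by simp
  then have "M *\<^sub>v unit_vec n 0 = \<mu> \<cdot>\<^sub>v unit_vec n 0"
    using TSv mult_unit_vec(2)[OF M, of 0] n by simp
  then have col0: "M $$ (i, 0) = (if i = 0 then \<mu> else 0)" if "i < n" for i
  proof -
    have "(M *\<^sub>v unit_vec n 0) $ i = M $$ (i, 0)"
      using mult_unit_vec(1)[OF M, of 0] that n M by simp
    then show ?thesis using \<open>M *\<^sub>v unit_vec n 0 = \<mu> \<cdot>\<^sub>v unit_vec n 0\<close> that by auto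
  qed
  define A1 A2 N where "A1 = mat 1 1 (\<lambda>_. \<mu>)" and "A2 = mat 1 m (\<lambda>(i, j). M $$ (0, Suc j))"
    and "N = mat m m (\<lambda>(i, j). M $$ (Suc i, Suc j))"
  have N: "N \<in> carrier_mat m m" by (simp add: N_def)
  have "M = four_block_mat A1 A2 (0\<^sub>m m 1) N"
    using M col0 by (auto simp: n A1_def A2_def N_def four_block_mat_def Let_def intro!: eq_matI)
  then have "char_poly M = char_poly A1 * char_poly N"
    using char_poly_four_block_zeros_col[of A1 A2 m N] by (simp add: A1_def A2_def N_def)
  also have "char_poly A1 = [:- \<mu>, 1:]"
    by (subst char_poly_upper_triangular[of _ 1]) (auto simp: A1_def diag_mat_def)
  finally have cpN: "char_poly N = (\<Prod>e\<leftarrow>e # es. [:- e, 1:])"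
    using cp sim by (simp del: mult_pCons_left)
  have tail_M: "tail_vec (M *\<^sub>v w) = N *\<^sub>v tail_vec w" if w: "w \<in> carrier_vec n" for w
  proof (rule eq_vecI)
    fix i assume "i < dim_vec (N *\<^sub>v tail_vec w)"
    then have i: "i < m" by (simp add: N_def)
    have "(M *\<^sub>v w) $ Suc i = (\<Sum>j\<in>{0..<Suc m}. M $$ (Suc i, j) * w $ j)"
      using i M w n by (simp add: scalar_prod_def)
    also have "\<dots> = (\<Sum>j\<in>{0..<m}. M $$ (Suc i, Suc j) * w $ Suc j)"
      using i col0[of "Suc i"] n by (subst sum.atLeast0_lessThan_Suc_shift) simp
    finally show "tail_vec (M *\<^sub>v w) $ i = (N *\<^sub>v tail_vec w) $ i"
      using i M w n by (simp add: tail_vec_def N_def scalar_prod_def)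
  qed (use M n w in \<open>simp add: tail_vec_def N_def\<close>)
  have tail_diff: "tail_vec (a - f \<cdot>\<^sub>v b) = tail_vec a - f \<cdot>\<^sub>v tail_vec b"
    if "a \<in> carrier_vec n" "b \<in> carrier_vec n" for a b :: "'k vec" and f
    using that n by (auto simp: tail_vec_def intro!: eq_vecI)
  have tail_lin_prod: "tail_vec (lin_prod fs M *\<^sub>v w) = lin_prod fs N *\<^sub>v tail_vec w"
    if w: "w \<in> carrier_vec n" for w fs
  proof (induction fs)
    case Nil
    then show ?case using M N w n by (auto simp: tail_vec_def)
  next
    case (Cons f fs)
    let ?w = "lin_prod fs M *\<^sub>v w"
    have w': "?w \<in> carrier_vec n" using M w by simp
    have "tail_vec (M *\<^sub>v ?w - f \<cdot>\<^sub>v ?w) = tail_vec (M *\<^sub>v ?w) - f \<cdot>\<^sub>v tail_vec ?w"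
      by (rule tail_diff) (use w' M n in auto)
    moreover have "tail_vec w \<in> carrier_vec m" using w n by (simp add: tail_vec_def)
    ultimately show ?case
      using Cons M N w w' tail_M[OF w']
      by (simp add: lin_prod_Cons_vec[of _ n] lin_prod_Cons_vec[of _ m] del: lin_prod.simps)
  qed
  have N0: "lin_prod (e # es) N *\<^sub>v w = 0\<^sub>v m" if w: "w \<in> carrier_vec m" for w
  proof -
    have "poly (char_poly N) e = 0" by (simp add: cpN)
    then obtain z where z: "z \<in> carrier_vec m" "z \<noteq> 0\<^sub>v m" "N *\<^sub>v z = e \<cdot>\<^sub>v z"
      using eigenvalue_root_char_poly[OF N] N by (auto simp: eigenvalue_def eigenvector_def)
    obtain a where "lin_prod es N *\<^sub>v w = a \<cdot>\<^sub>v z"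
      using Cons.IH[OF N cpN z w] by blast
    then show ?thesis
      using N w z by (simp add: lin_prod_Cons_vec[of _ m] mult_mat_vec[of _ m m] del: lin_prod.simps)
        (auto intro!: eq_vecI)
  qed
  define w where "w = lin_prod (e # es) M *\<^sub>v (T *\<^sub>v u)"
  have Tu: "T *\<^sub>v u \<in> carrier_vec n" using T u by simp
  have w: "w \<in> carrier_vec n" unfolding w_def using M Tu by (simp del: lin_prod.simps)
  have "tail_vec (T *\<^sub>v u) \<in> carrier_vec m"
    using carrier_vecD[OF Tu] n by (simp add: tail_vec_def del: dim_mult_mat_vec)
  then have "tail_vec w = 0\<^sub>v m"
    unfolding w_def tail_lin_prod[OF Tu] by (rule N0)
  then have "tail_vec w $ j = 0" if "j < m" for j using that by simp
  then have "w $ Suc j = 0" if "j < m" for j using that w n by (simp add: tail_vec_def)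
  then have "w = w $ 0 \<cdot>\<^sub>v unit_vec n 0"
    using w n by (intro eq_vecI) (auto simp: unit_vec_def less_Suc_eq_0_disj)
  then have "S *\<^sub>v w = w $ 0 \<cdot>\<^sub>v y"
    using Se S by (metis mult_mat_vec unit_vec_carrier)
  moreover have "S *\<^sub>v w = (lin_prod (e # es) B * S) *\<^sub>v (T *\<^sub>v u)"
    unfolding w_def lin_prod_intertwine[OF B M S SM]
    using S M Tu by (simp add: assoc_mult_mat_vec[of _ n n _ n] del: lin_prod.simps)
  moreover have "\<dots> = lin_prod (e # es) B *\<^sub>v ((S * T) *\<^sub>v u)"
    using S B T u by (simp add: assoc_mult_mat_vec[of _ n n _ n] del: lin_prod.simps)
  ultimately show ?case using ST u by (metis one_mult_mat_vec)
qed

text \<open>The Cayley--Hamilton theorem for a split characteristic polynomial: the tail of the product maps into an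
  eigenline by deflation, and the head kills it.\<close>

lemma lin_prod_char_poly:
  fixes B :: "'k::field mat"
  assumes B: "B \<in> carrier_mat n n" and cp: "char_poly B = (\<Prod>e\<leftarrow>es. [:-e, 1:])" and "es \<noteq> []"
  shows "lin_prod es B = 0\<^sub>m n n"
proof (rule eq_mat_on_vecI[of _ n n])
  fix u :: "'k vec" assume u: "u \<in> carrier_vec n"
  obtain \<mu> fs where es: "es = \<mu> # fs" using assms(3) by (cases es) auto
  have "poly (char_poly B) \<mu> = 0" by (simp add: cp es)
  then obtain z where z: "z \<in> carrier_vec n" "z \<noteq> 0\<^sub>v n" "B *\<^sub>v z = \<mu> \<cdot>\<^sub>v z"
    using eigenvalue_root_char_poly[OF B] B by (auto simp: eigenvalue_def eigenvector_def)
  obtain a where "lin_prod fs B *\<^sub>v u = a \<cdot>\<^sub>v z"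
    using deflation[OF B cp[unfolded es] z u] by blast
  then show "lin_prod es B *\<^sub>v u = 0\<^sub>m n n *\<^sub>v u"
    using B u z by (simp add: es lin_prod_Cons_vec[of _ n] mult_mat_vec[of _ n n] del: lin_prod.simps)
      (auto intro!: eq_vecI)
qed (use B in auto)

subsection \<open>Linear combinations of a list of vectors\<close>

fun lin_comb :: "nat \<Rightarrow> 'k::field vec list \<Rightarrow> 'k list \<Rightarrow> 'k vec" where
  "lin_comb d (u # us) (a # as) = a \<cdot>\<^sub>v u + lin_comb d us as"
| "lin_comb d _ _ = 0\<^sub>v d"

definition lin_span :: "nat \<Rightarrow> 'k::field vec list \<Rightarrow> 'k vec set" where
  "lin_span d us = {lin_comb d us as |as. length as = length us}"

lemma vec_rearrange:
  fixes u p q :: "'k::field vec"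
  shows "u \<in> carrier_vec d \<Longrightarrow> p \<in> carrier_vec d \<Longrightarrow> q \<in> carrier_vec d \<Longrightarrow>
      (a \<cdot>\<^sub>v u + p) + (b \<cdot>\<^sub>v u + q) = (a + b) \<cdot>\<^sub>v u + (p + q)"
    and "u \<in> carrier_vec d \<Longrightarrow> p \<in> carrier_vec d \<Longrightarrow> c \<cdot>\<^sub>v (a \<cdot>\<^sub>v u + p) = (c * a) \<cdot>\<^sub>v u + c \<cdot>\<^sub>v p"
    and "u \<in> carrier_vec d \<Longrightarrow> p \<in> carrier_vec d \<Longrightarrow> i < d \<Longrightarrow> (a \<cdot>\<^sub>v u + p) $ i = a * u $ i + p $ i"
    and "u \<in> carrier_vec d \<Longrightarrow> p \<in> carrier_vec d \<Longrightarrow> 0 \<cdot>\<^sub>v u + p = p"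
    and "u \<in> carrier_vec d \<Longrightarrow> 0 \<cdot>\<^sub>v u = 0\<^sub>v d"
  by (auto intro!: eq_vecI simp: algebra_simps dest!: carrier_vecD)

lemma smult_zero_vec_right [simp]: "c \<cdot>\<^sub>v 0\<^sub>v d = (0\<^sub>v d :: 'k::field vec)"
  by (intro eq_vecI) auto

lemma mult_zero_vec_right: "M \<in> carrier_mat n m \<Longrightarrow> M *\<^sub>v 0\<^sub>v m = (0\<^sub>v n :: 'k::field vec)"
  by (intro eq_vecI) auto

lemma lin_comb_carrier [simp]: "set us \<subseteq> carrier_vec d \<Longrightarrow> lin_comb d us as \<in> carrier_vec d"
  by (induction d us as rule: lin_comb.induct) auto

lemma mat_of_cols_mult_vec:
  assumes "set us \<subseteq> carrier_vec d" "length as = length us"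
  shows "mat_of_cols d us *\<^sub>v vec_of_list as = lin_comb d us as"
  using assms
proof (induction d us as rule: lin_comb.induct)
  case (1 d u us a as)
  show ?case
  proof (rule eq_vecI)
    fix i assume "i < dim_vec (lin_comb d (u # us) (a # as))"
    moreover have "lin_comb d us as \<in> carrier_vec d" using 1(2) by simp
    ultimately have i: "i < d" using 1(2) by auto
    have "(mat_of_cols d us *\<^sub>v vec_of_list as) $ i = lin_comb d us as $ i" using 1 by simp
    then have "(\<Sum>j\<in>{0..<length us}. (us ! j $ i) * as ! j) = lin_comb d us as $ i"
      using i 1(3) by (simp add: scalar_prod_def mat_of_cols_def vec_of_list_index)
    moreover have "lin_comb d (u # us) (a # as) $ i = a * u $ i + lin_comb d us as $ i"
      using vec_rearrange(3)[OF _ \<open>lin_comb d us as \<in> carrier_vec d\<close> i] 1(2) by auto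
    ultimately show "(mat_of_cols d (u # us) *\<^sub>v vec_of_list (a # as)) $ i = lin_comb d (u # us) (a # as) $ i"
      using i 1(3)
      by (simp add: scalar_prod_def mat_of_cols_def vec_of_list_index sum.atLeast0_lessThan_Suc_shift
          del: vec_of_list_Cons sum.op_ivl_Suc lin_comb.simps)
  next
    have "lin_comb d (u # us) (a # as) \<in> carrier_vec d" using 1(2) by (intro lin_comb_carrier)
    then show "dim_vec (mat_of_cols d (u # us) *\<^sub>v vec_of_list (a # as)) = dim_vec (lin_comb d (u # us) (a # as))"
      by (metis carrier_vecD dim_mult_mat_vec mat_of_cols_carrier(2))
  qed
qed (auto intro!: eq_vecI simp: scalar_prod_def)

lemma lin_comb_add:
  assumes "set us \<subseteq> carrier_vec d" "length as = length us" "length bs = length us"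
  shows "lin_comb d us as + lin_comb d us bs = lin_comb d us (map2 (+) as bs)"
  using assms
proof (induction us arbitrary: as bs)
  case (Cons u us)
  then obtain a as' b bs' where ab: "as = a # as'" "bs = b # bs'"
    by (metis length_Suc_conv list.size(4))
  have "lin_comb d us as' \<in> carrier_vec d" "lin_comb d us bs' \<in> carrier_vec d" using Cons.prems by auto
  then show ?case
    using Cons ab by (simp add: vec_rearrange[of _ d] flip: Cons.IH)
qed auto

lemma lin_comb_smult:
  assumes "set us \<subseteq> carrier_vec d" "length as = length us"
  shows "c \<cdot>\<^sub>v lin_comb d us as = lin_comb d us (map ((*) c) as)"
  using assms
proof (induction us arbitrary: as)
  case (Cons u us)
  then obtain a as' where ab: "as = a # as'"
    by (metis length_Suc_conv list.size(4))
  have "lin_comb d us as' \<in> carrier_vec d" using Cons.prems by auto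
  then show ?case
    using Cons ab by (simp add: vec_rearrange[of _ d] flip: Cons.IH)
qed auto

lemma lin_comb_append:
  assumes "set us \<subseteq> carrier_vec d" "set vs \<subseteq> carrier_vec d" "length as = length us"
  shows "lin_comb d (us @ vs) (as @ bs) = lin_comb d us as + lin_comb d vs bs"
  using assms
proof (induction us arbitrary: as)
  case (Cons u us)
  then obtain a as' where ab: "as = a # as'"
    by (metis length_Suc_conv list.size(4))
  have "lin_comb d us as' \<in> carrier_vec d" "lin_comb d vs bs \<in> carrier_vec d" using Cons.prems by auto
  then show ?case
    using Cons ab by (simp add: assoc_add_vec[of _ d])
qed auto

lemma lin_comb_zero: "set us \<subseteq> carrier_vec d \<Longrightarrow> lin_comb d us (replicate (length us) 0) = 0\<^sub>v d"
  by (induction us) auto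

lemma lin_span_subspace:
  assumes us: "set us \<subseteq> carrier_vec d"
  shows "subspace class_ring (lin_span d us) (module_vec TYPE('k::field) d)"
  unfolding subspace_module_vec_iff
proof (intro conjI ballI allI)
  show "lin_span d us \<subseteq> carrier_vec d" using us by (auto simp: lin_span_def)
  show "0\<^sub>v d \<in> lin_span d us"
    using lin_comb_zero[OF us] unfolding lin_span_def by (metis (mono_tags, lifting) length_replicate mem_Collect_eq)
next
  fix v w assume "v \<in> lin_span d us" "w \<in> lin_span d us"
  then show "v + w \<in> lin_span d us"
    using lin_comb_add[OF us] by (fastforce simp: lin_span_def)
next
  fix v :: "'k vec" and c assume "v \<in> lin_span d us"
  then show "c \<cdot>\<^sub>v v \<in> lin_span d us"
    using lin_comb_smult[OF us] by (fastforce simp: lin_span_def)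
qed

lemma lin_span_smult:
  "set us \<subseteq> carrier_vec d \<Longrightarrow> w \<in> lin_span d us \<Longrightarrow> c \<cdot>\<^sub>v w \<in> lin_span d (us :: 'k::field vec list)"
  using lin_span_subspace[of us d] by (auto simp: subspace_module_vec_iff)

lemma lin_span_least:
  assumes "subspace class_ring W (module_vec TYPE('k::field) d)" "set us \<subseteq> W"
  shows "lin_span d us \<subseteq> W"
proof -
  have "lin_comb d us as \<in> W" for as
    using assms by (induction d us as rule: lin_comb.induct) (auto simp: subspace_module_vec_iff)
  then show ?thesis by (auto simp: lin_span_def)
qed

lemma lin_span_superset: "set us \<subseteq> carrier_vec d \<Longrightarrow> set us \<subseteq> lin_span d (us :: 'k::field vec list)"
proof (induction us)
  case (Cons u us)
  have "u = lin_comb d (u # us) (1 # replicate (length us) 0)"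
    using Cons.prems by (auto simp: lin_comb_zero)
  then have "u \<in> lin_span d (u # us)"
    unfolding lin_span_def by (metis (mono_tags, lifting) length_Cons length_replicate mem_Collect_eq)
  moreover have "lin_span d us \<subseteq> lin_span d (u # us)"
  proof
    fix w assume "w \<in> lin_span d us"
    then obtain as where as: "w = lin_comb d us as" "length as = length us" by (auto simp: lin_span_def)
    have "w = lin_comb d (u # us) (0 # as)"
      using Cons.prems as lin_comb_carrier[of us d as] by (simp add: vec_rearrange[of _ d])
    then show "w \<in> lin_span d (u # us)"
      unfolding lin_span_def using as(2) by (metis (mono_tags, lifting) length_Cons mem_Collect_eq)
  qed
  ultimately show ?case using Cons by auto
qed auto

lemma lin_span_proper:
  assumes "set us \<subseteq> carrier_vec d" "length us < d"
  shows "lin_span d us \<noteq> (carrier_vec d :: 'k::field vec set)"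
proof -
  have M: "mat_of_cols d us \<in> carrier_mat d (length us)" by simp
  from wide_image_proper[OF M assms(2)] obtain u where u: "u \<in> carrier_vec d"
    and neq: "\<And>c. c \<in> carrier_vec (length us) \<Longrightarrow> mat_of_cols d us *\<^sub>v c \<noteq> u" by blast
  have "lin_comb d us as \<noteq> u" if "length as = length us" for as
    using neq[of "vec_of_list as"] mat_of_cols_mult_vec[OF assms(1) that] that
    by (metis carrier_vec_dim_vec dim_vec_of_list)
  then have "u \<notin> lin_span d us" by (auto simp: lin_span_def)
  with u show ?thesis by blast
qed

lemma lin_comb_independent:
  fixes us :: "'k::field vec list"
  assumes "set us \<subseteq> carrier_vec d" "\<And>k. k < length us \<Longrightarrow> us ! k \<notin> lin_span d (take k us)"
    and "length as = length us" "lin_comb d us as = 0\<^sub>v d"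
  shows "as = replicate (length us) 0"
  using assms
proof (induction us arbitrary: as rule: rev_induct)
  case (snoc u us)
  then obtain bs a where as: "as = bs @ [a]" "length bs = length us"
    by (metis append_butlast_last_id length_0_conv length_append_singleton length_butlast diff_Suc_1 nat.distinct(1))
  let ?w = "lin_comb d us bs"
  have us: "set us \<subseteq> carrier_vec d" and u: "u \<in> carrier_vec d" using snoc.prems(1) by auto
  have w: "?w \<in> carrier_vec d" using us by simp
  have eq: "?w + a \<cdot>\<^sub>v u = 0\<^sub>v d"
    using snoc.prems(4) lin_comb_append[OF us, of "[u]" bs "[a]"] as u by simp
  have "a = 0"
  proof (rule ccontr)
    assume "a \<noteq> 0"
    have "u = (- inverse a) \<cdot>\<^sub>v ?w"
    proof (rule eq_vecI)
      fix i assume "i < dim_vec ((- inverse a) \<cdot>\<^sub>v ?w)"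
      then have i: "i < d" using carrier_vecD[OF w] by simp
      then have "?w $ i + a * u $ i = 0" using arg_cong[OF eq, of "\<lambda>v. v $ i"] w u by simp
      then show "u $ i = ((- inverse a) \<cdot>\<^sub>v ?w) $ i"
        using i carrier_vecD[OF w] \<open>a \<noteq> 0\<close> by (simp add: field_simps eq_neg_iff_add_eq_0)
    qed (use w u in auto)
    then have "u \<in> lin_span d us"
      using as(2) us unfolding lin_span_def by (auto simp: lin_comb_smult)
    with snoc.prems(2)[of "length us"] show False by simp
  qed
  moreover from this have "?w = 0\<^sub>v d" using eq w u by (simp add: vec_rearrange(5)[of _ d])
  moreover have "us ! k \<notin> lin_span d (take k us)" if "k < length us" for k
    using snoc.prems(2)[of k] that by (simp add: nth_append)
  ultimately have "bs = replicate (length us) 0" using snoc.IH[OF us] as(2) by blast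
  then show ?case using as \<open>a = 0\<close> by (simp add: replicate_append_same)
qed auto

section \<open>Pairs of matrices with \<open>X\<^sup>2 = Y\<^sup>3\<close> scalar\<close>

text \<open>The action of the braid group on a simple module in terms of \<open>X = \<sigma>\<^sub>1\<sigma>\<^sub>2\<sigma>\<^sub>1\<close> and \<open>Y = \<sigma>\<^sub>1\<sigma>\<^sub>2\<close>.\<close>

locale twist_pair =
  fixes d :: nat and X Y :: "'k::field mat" and \<delta> :: 'k
  assumes X [simp]: "X \<in> carrier_mat d d" and Y [simp]: "Y \<in> carrier_mat d d"
    and X2: "X * X = \<delta> \<cdot>\<^sub>m 1\<^sub>m d" and Y3: "Y * (Y * Y) = \<delta> \<cdot>\<^sub>m 1\<^sub>m d" and \<delta> [simp]: "\<delta> \<noteq> 0"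

text \<open>This is \<open>\<sigma>\<^sub>2 = X Y\<^sup>-\<^sup>1\<close>, because \<open>Y\<^sup>-\<^sup>1 = \<delta>\<^sup>-\<^sup>1 Y\<^sup>2\<close>.\<close>

definition braid_mat :: "'k::field \<Rightarrow> 'k mat \<Rightarrow> 'k mat \<Rightarrow> 'k mat" where
  "braid_mat \<delta> X Y = inverse \<delta> \<cdot>\<^sub>m (X * (Y * Y))"

context twist_pair
begin

abbreviation "B \<equiv> braid_mat \<delta> X Y"

lemma B [simp]: "B \<in> carrier_mat d d"
  unfolding braid_mat_def by (intro smult_carrier_mat mult_carrier_mat[of _ d d]) auto

lemma XV [simp]: "u \<in> carrier_vec d \<Longrightarrow> X *\<^sub>v u \<in> carrier_vec d"
  and YV [simp]: "u \<in> carrier_vec d \<Longrightarrow> Y *\<^sub>v u \<in> carrier_vec d"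
  and BV [simp]: "u \<in> carrier_vec d \<Longrightarrow> B *\<^sub>v u \<in> carrier_vec d"
  using X Y B by (auto intro: mult_mat_vec_carrier simp del: X Y B)

lemma XX [simp]: "u \<in> carrier_vec d \<Longrightarrow> X *\<^sub>v (X *\<^sub>v u) = \<delta> \<cdot>\<^sub>v u"
  using assoc_mult_mat_vec[OF X X, of u] by (simp add: X2 smult_mult_mat_vec[of _ d d])

lemma YYY [simp]: "u \<in> carrier_vec d \<Longrightarrow> Y *\<^sub>v (Y *\<^sub>v (Y *\<^sub>v u)) = \<delta> \<cdot>\<^sub>v u"
  using assoc_mult_mat_vec[OF Y mult_carrier_mat[OF Y Y], of u]
  by (simp add: Y3 smult_mult_mat_vec[of _ d d] assoc_mult_mat_vec[OF Y Y])

lemma Xs [simp]: "u \<in> carrier_vec d \<Longrightarrow> X *\<^sub>v (c \<cdot>\<^sub>v u) = c \<cdot>\<^sub>v (X *\<^sub>v u)"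
  and Ys [simp]: "u \<in> carrier_vec d \<Longrightarrow> Y *\<^sub>v (c \<cdot>\<^sub>v u) = c \<cdot>\<^sub>v (Y *\<^sub>v u)"
  and Bs [simp]: "u \<in> carrier_vec d \<Longrightarrow> B *\<^sub>v (c \<cdot>\<^sub>v u) = c \<cdot>\<^sub>v (B *\<^sub>v u)"
  by (rule mult_mat_vec[of _ d d]; simp)+

lemma B_vec: "u \<in> carrier_vec d \<Longrightarrow> B *\<^sub>v u = inverse \<delta> \<cdot>\<^sub>v (X *\<^sub>v (Y *\<^sub>v (Y *\<^sub>v u)))"
  unfolding braid_mat_def
  using smult_mult_mat_vec[OF mult_carrier_mat[OF X mult_carrier_mat[OF Y Y]], of u "inverse \<delta>"]
  by (simp add: assoc_mult_mat_vec[OF X mult_carrier_mat[OF Y Y]] assoc_mult_mat_vec[OF Y Y])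

lemma BY: "u \<in> carrier_vec d \<Longrightarrow> B *\<^sub>v (Y *\<^sub>v u) = X *\<^sub>v u"
  by (simp add: B_vec smult_smult_assoc)

end

definition irreducible_pair :: "nat \<Rightarrow> 'k::field mat \<Rightarrow> 'k mat \<Rightarrow> bool" where
  "irreducible_pair d X Y \<longleftrightarrow> (\<forall>W. subspace class_ring W (module_vec TYPE('k) d) \<longrightarrow>
     (\<forall>w\<in>W. X *\<^sub>v w \<in> W \<and> Y *\<^sub>v w \<in> W) \<longrightarrow> W = {0\<^sub>v d} \<or> W = carrier_vec d)"

fun orbit :: "'k::field mat \<Rightarrow> 'k mat \<Rightarrow> 'k vec \<Rightarrow> 'k vec list" where
  "orbit X Y v = [v, Y *\<^sub>v v, Y *\<^sub>v (Y *\<^sub>v v), X *\<^sub>v (Y *\<^sub>v (Y *\<^sub>v v)), Y *\<^sub>v (X *\<^sub>v (Y *\<^sub>v (Y *\<^sub>v v)))]"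

locale irreducible_twist_pair = twist_pair +
  assumes irreducible: "irreducible_pair d X Y"
begin

lemma no_small_invariant_span:
  assumes us: "set us \<subseteq> carrier_vec d" "length us < d" and v: "v \<in> set us" "v \<noteq> 0\<^sub>v d"
    and inv: "\<And>u. u \<in> set us \<Longrightarrow> X *\<^sub>v u \<in> lin_span d us \<and> Y *\<^sub>v u \<in> lin_span d us"
  shows False
proof -
  let ?W = "lin_span d us"
  note sub = lin_span_subspace[OF us(1)]
  have *: "\<forall>w\<in>?W. M *\<^sub>v w \<in> ?W"
    if M: "M \<in> carrier_mat d d" and MW: "\<And>u. u \<in> set us \<Longrightarrow> M *\<^sub>v u \<in> ?W" for M
  proof -
    have M0: "M *\<^sub>v 0\<^sub>v d = 0\<^sub>v d" by (rule mult_zero_vec_right[OF M])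
    have "subspace class_ring {w \<in> carrier_vec d. M *\<^sub>v w \<in> ?W} (module_vec TYPE('a) d)"
      using sub M unfolding subspace_module_vec_iff
      by (auto simp: M0 mult_add_distrib_mat_vec[OF M] mult_mat_vec[OF M])
    from lin_span_least[OF this, of us] us MW show ?thesis by auto
  qed
  have "?W = {0\<^sub>v d} \<or> ?W = carrier_vec d"
    using irreducible sub *[OF X] *[OF Y] inv unfolding irreducible_pair_def by blast
  moreover have "v \<in> ?W" using lin_span_superset[OF us(1)] v by auto
  ultimately show False using v lin_span_proper[OF us] by auto
qed

text \<open>If the \<open>k\<close>-th vector depends on its predecessors, then these span an invariant subspace. Indeed \<open>X v\<close> and
  \<open>X Y v\<close> are multiples of \<open>Y v\<close> and \<open>v\<close>, the scalars \<open>X\<^sup>2\<close> and \<open>Y\<^sup>3\<close> bring other products back, and the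
  only remaining image of a predecessor is the \<open>k\<close>-th vector itself.\<close>

lemma orbit_independent:
  assumes v: "v \<in> carrier_vec d" "v \<noteq> 0\<^sub>v d" and eig: "X *\<^sub>v v = \<alpha> \<cdot>\<^sub>v (Y *\<^sub>v v)" and \<alpha>: "\<alpha> \<noteq> 0"
    and k: "k < d" "k < 5"
  shows "orbit X Y v ! k \<notin> lin_span d (take k (orbit X Y v))"
proof
  let ?us = "take k (orbit X Y v)" and ?W = "lin_span d (take k (orbit X Y v))"
  assume mem: "orbit X Y v ! k \<in> ?W"
  have us: "set ?us \<subseteq> carrier_vec d" using v(1) set_take_subset[of k "orbit X Y v"] by auto
  have "X *\<^sub>v (X *\<^sub>v v) = \<alpha> \<cdot>\<^sub>v (X *\<^sub>v (Y *\<^sub>v v))" using v eig by simp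
  then have "inverse \<alpha> \<cdot>\<^sub>v (\<delta> \<cdot>\<^sub>v v) = inverse \<alpha> \<cdot>\<^sub>v (\<alpha> \<cdot>\<^sub>v (X *\<^sub>v (Y *\<^sub>v v)))" using v by simp
  then have XY: "X *\<^sub>v (Y *\<^sub>v v) = (\<delta> / \<alpha>) \<cdot>\<^sub>v v"
    using v \<alpha> by (simp add: smult_smult_assoc divide_inverse mult.commute)
  note sup = lin_span_superset[OF us]
  have k5: "k = 0 \<or> k = 1 \<or> k = 2 \<or> k = 3 \<or> k = 4" using k by auto
  show False
  proof (cases "k = 0")
    case True
    then show ?thesis using mem v by (auto simp: lin_span_def)
  next
    case False
    show ?thesis
    proof (rule no_small_invariant_span[OF us])
      show "length ?us < d" using k by simp
      show "v \<in> set ?us" using False by (cases k) auto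
      show "X *\<^sub>v u \<in> ?W \<and> Y *\<^sub>v u \<in> ?W" if "u \<in> set ?us" for u
        using that False k5 mem sup v
        by (elim disjE) (auto simp: eig XY intro!: lin_span_smult)
    qed (rule v)
  qed
qed

lemma orbit_basis:
  assumes v: "v \<in> carrier_vec d" "v \<noteq> 0\<^sub>v d" and eig: "X *\<^sub>v v = \<alpha> \<cdot>\<^sub>v (Y *\<^sub>v v)" and \<alpha>: "\<alpha> \<noteq> 0"
    and d: "d \<le> 5"
  obtains P Q where "P \<in> carrier_mat d d" "Q \<in> carrier_mat d d" "P * Q = 1\<^sub>m d" "Q * P = 1\<^sub>m d"
    "\<And>j. j < d \<Longrightarrow> P *\<^sub>v unit_vec d j = orbit X Y v ! j"
proof -
  let ?us = "take d (orbit X Y v)"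
  define P where "P = mat_of_cols d ?us"
  have us: "set ?us \<subseteq> carrier_vec d" "length ?us = d"
    using v(1) set_take_subset[of d "orbit X Y v"] d by auto
  have P: "P \<in> carrier_mat d d" using us(2) unfolding P_def by (metis mat_of_cols_carrier(1))
  have inj: "c = 0\<^sub>v d" if c: "c \<in> carrier_vec d" "P *\<^sub>v c = 0\<^sub>v d" for c
  proof -
    define as where "as = list_of_vec c"
    have as: "length as = d" "c = vec_of_list as" using c(1) by (auto simp: as_def vec_list)
    have "lin_comb d ?us as = 0\<^sub>v d"
      using mat_of_cols_mult_vec[OF us(1)] us(2) as c(2) by (simp add: P_def)
    moreover have "?us ! k \<notin> lin_span d (take k ?us)" if "k < length ?us" for k
      using orbit_independent[OF v eig \<alpha>, of k] that us(2) d by (simp add: min_def)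
    ultimately have "as = replicate (length ?us) 0"
      using lin_comb_independent[OF us(1)] us(2) as(1) by metis
    then show ?thesis using us(2) by (auto simp: as(2) vec_of_list_index intro!: eq_vecI)
  qed
  from inverse_if_injective[OF P inj] obtain Q where Q: "Q \<in> carrier_mat d d" "P * Q = 1\<^sub>m d" "Q * P = 1\<^sub>m d"
    by blast
  have "P *\<^sub>v unit_vec d j = orbit X Y v ! j" if "j < d" for j
  proof -
    have "?us ! j \<in> carrier_vec d" using us that by (metis nth_mem subsetD)
    then have "col P j = ?us ! j" unfolding P_def using us(2) that by (intro col_mat_of_cols) auto
    then show ?thesis using mult_unit_vec(1)[OF P that] that by simp
  qed
  with P Q show ?thesis using that by blast
qed

text \<open>From \<open>F B = \<mu> F\<close> one gets \<open>F X = \<mu> F Y\<close> and \<open>F Y X = (\<delta>/\<mu>) F\<close>. With these rules the vanishing of \<open>F\<close> at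
  \<open>v\<close> and \<open>Y v\<close> spreads to the other basis vectors.\<close>

lemma annihilates_orbit:
  assumes v: "v \<in> carrier_vec d" "v \<noteq> 0\<^sub>v d" and eig: "X *\<^sub>v v = \<alpha> \<cdot>\<^sub>v (Y *\<^sub>v v)" and \<alpha>: "\<alpha> \<noteq> 0"
    and d: "d \<le> 5"
    and F: "F \<in> carrier_mat d d" "\<And>u. u \<in> carrier_vec d \<Longrightarrow> F *\<^sub>v (B *\<^sub>v u) = \<mu> \<cdot>\<^sub>v (F *\<^sub>v u)" "\<mu> \<noteq> 0"
    and Fv: "F *\<^sub>v v = 0\<^sub>v d" "F *\<^sub>v (Y *\<^sub>v v) = 0\<^sub>v d"
  shows "F = 0\<^sub>m d d"
proof -
  have FX: "F *\<^sub>v (X *\<^sub>v u) = \<mu> \<cdot>\<^sub>v (F *\<^sub>v (Y *\<^sub>v u))" if "u \<in> carrier_vec d" for u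
    using F(2)[of "Y *\<^sub>v u"] that by (simp add: BY)
  have FYX: "F *\<^sub>v (Y *\<^sub>v (X *\<^sub>v u)) = (\<delta> / \<mu>) \<cdot>\<^sub>v (F *\<^sub>v u)" if u: "u \<in> carrier_vec d" for u
  proof -
    have "\<delta> \<cdot>\<^sub>v (F *\<^sub>v u) = \<mu> \<cdot>\<^sub>v (F *\<^sub>v (Y *\<^sub>v (X *\<^sub>v u)))"
      using FX[of "X *\<^sub>v u"] u F(1) by (simp add: mult_mat_vec[of _ d d])
    then have "inverse \<mu> \<cdot>\<^sub>v (\<delta> \<cdot>\<^sub>v (F *\<^sub>v u)) = inverse \<mu> \<cdot>\<^sub>v (\<mu> \<cdot>\<^sub>v (F *\<^sub>v (Y *\<^sub>v (X *\<^sub>v u))))" by simp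
    then show ?thesis using F(3) by (simp add: smult_smult_assoc divide_inverse mult.commute)
  qed
  have "\<alpha> \<cdot>\<^sub>v (F *\<^sub>v (Y *\<^sub>v (Y *\<^sub>v v))) = F *\<^sub>v (Y *\<^sub>v (X *\<^sub>v v))"
    using eig v(1) F(1) by (simp add: mult_mat_vec[of _ d d])
  also have "\<dots> = 0\<^sub>v d" using FYX[OF v(1)] Fv by simp
  finally have "inverse \<alpha> \<cdot>\<^sub>v (\<alpha> \<cdot>\<^sub>v (F *\<^sub>v (Y *\<^sub>v (Y *\<^sub>v v)))) = 0\<^sub>v d" by simp
  then have F2: "F *\<^sub>v (Y *\<^sub>v (Y *\<^sub>v v)) = 0\<^sub>v d" using \<alpha> by (simp add: smult_smult_assoc)
  have F3: "F *\<^sub>v (X *\<^sub>v (Y *\<^sub>v (Y *\<^sub>v v))) = 0\<^sub>v d"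
    using FX[of "Y *\<^sub>v (Y *\<^sub>v v)"] v(1) Fv(1) F(1) by (simp add: mult_mat_vec[of _ d d])
  have F4: "F *\<^sub>v (Y *\<^sub>v (X *\<^sub>v (Y *\<^sub>v (Y *\<^sub>v v)))) = 0\<^sub>v d"
    using FYX[of "Y *\<^sub>v (Y *\<^sub>v v)"] v(1) F2 by simp
  obtain P Q where P: "P \<in> carrier_mat d d" and Q: "Q \<in> carrier_mat d d" and PQ: "P * Q = 1\<^sub>m d"
    and Pj: "\<And>j. j < d \<Longrightarrow> P *\<^sub>v unit_vec d j = orbit X Y v ! j"
    using orbit_basis[OF v eig \<alpha> d] by metis
  have "F * P = 0\<^sub>m d d"
  proof (rule eq_matI)
    fix i j assume "i < dim_row (0\<^sub>m d d :: 'a mat)" "j < dim_col (0\<^sub>m d d :: 'a mat)"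
    then have ij: "i < d" "j < d" by auto
    then have "j = 0 \<or> j = 1 \<or> j = 2 \<or> j = 3 \<or> j = 4" using d by auto
    then have "F *\<^sub>v (P *\<^sub>v unit_vec d j) = 0\<^sub>v d"
      unfolding Pj[OF ij(2)] using Fv F2 F3 F4 by auto
    then have "(F *\<^sub>v (P *\<^sub>v unit_vec d j)) $ i = 0" using ij by simp
    moreover have "P *\<^sub>v unit_vec d j = col P j" by (rule mult_unit_vec(1)[OF P ij(2)])
    ultimately show "(F * P) $$ (i, j) = 0\<^sub>m d d $$ (i, j)" using F(1) P ij by simp
  qed (use F P in auto)
  then have "F * P * Q = 0\<^sub>m d d" using Q by simp
  moreover have "F * P * Q = F" using assoc_mult_mat[OF F(1) P Q] PQ F(1) by simp
  ultimately show ?thesis by simp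
qed

end

subsection \<open>Change of basis\<close>

locale base_change =
  fixes d :: nat and P Q :: "'k::field mat"
  assumes P [simp]: "P \<in> carrier_mat d d" and Q [simp]: "Q \<in> carrier_mat d d"
    and PQ: "P * Q = 1\<^sub>m d" and QP: "Q * P = 1\<^sub>m d"
begin

lemma PV [simp]: "u \<in> carrier_vec d \<Longrightarrow> P *\<^sub>v u \<in> carrier_vec d"
  and QV [simp]: "u \<in> carrier_vec d \<Longrightarrow> Q *\<^sub>v u \<in> carrier_vec d"
  using P Q by (auto intro: mult_mat_vec_carrier simp del: P Q)

lemma PQV [simp]: "u \<in> carrier_vec d \<Longrightarrow> P *\<^sub>v (Q *\<^sub>v u) = u"
  and QPV [simp]: "u \<in> carrier_vec d \<Longrightarrow> Q *\<^sub>v (P *\<^sub>v u) = u"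
  using assoc_mult_mat_vec[OF P Q, of u] assoc_mult_mat_vec[OF Q P, of u] PQ QP by auto

lemma Ps [simp]: "u \<in> carrier_vec d \<Longrightarrow> P *\<^sub>v (c \<cdot>\<^sub>v u) = c \<cdot>\<^sub>v (P *\<^sub>v u)"
  and Qs [simp]: "u \<in> carrier_vec d \<Longrightarrow> Q *\<^sub>v (c \<cdot>\<^sub>v u) = c \<cdot>\<^sub>v (Q *\<^sub>v u)"
  by (rule mult_mat_vec[of _ d d]; simp)+

lemma conjugate:
  assumes M: "M \<in> carrier_mat d d"
  shows "Q * M * P \<in> carrier_mat d d" "M * P = P * (Q * M * P)"
    "u \<in> carrier_vec d \<Longrightarrow> (Q * M * P) *\<^sub>v u = Q *\<^sub>v (M *\<^sub>v (P *\<^sub>v u))"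
    "char_poly (Q * M * P) = char_poly M"
proof -
  show c: "Q * M * P \<in> carrier_mat d d" using M P Q by (metis mult_carrier_mat)
  have "P * (Q * M * P) = P * (Q * (M * P))" using M P Q by (metis assoc_mult_mat)
  also have "\<dots> = P * Q * (M * P)" using M P Q by (metis assoc_mult_mat mult_carrier_mat)
  finally show "M * P = P * (Q * M * P)" using PQ M P by (metis left_mult_one_mat mult_carrier_mat)
  show "u \<in> carrier_vec d \<Longrightarrow> (Q * M * P) *\<^sub>v u = Q *\<^sub>v (M *\<^sub>v (P *\<^sub>v u))"
    using assoc_mult_mat_vec[OF mult_carrier_mat[OF Q M] P] assoc_mult_mat_vec[OF Q M] by simp
  show "char_poly (Q * M * P) = char_poly M"
    by (intro char_poly_similar similar_matI[of _ _ Q P d]) (use M c PQ QP in auto)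
qed

lemma intertwined_eq:
  assumes M: "M \<in> carrier_mat d d" and N: "N \<in> carrier_mat d d" and MN: "M * P = P * N"
  shows "Q * M * P = N"
  using assoc_mult_mat[OF Q M P] assoc_mult_mat[OF Q P N] MN QP N by simp

end

locale twist_pair_base_change = twist_pair d X Y \<delta> + base_change d P Q
  for d and X Y :: "'k::field mat" and \<delta> and P Q :: "'k mat"
begin

lemma conjugate_pair: "twist_pair d (Q * X * P) (Q * Y * P) \<delta>"
  and conjugate_braid_mat: "braid_mat \<delta> (Q * X * P) (Q * Y * P) = Q * B * P"
proof -
  note c [simp] = conjugate(1)[OF X] conjugate(1)[OF Y] conjugate(1)[OF B]
  note v [simp] = conjugate(3)[OF X] conjugate(3)[OF Y] conjugate(3)[OF B]
  have 1: "(Q * X * P) * (Q * X * P) = \<delta> \<cdot>\<^sub>m 1\<^sub>m d"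
    by (rule eq_mat_on_vecI[of _ d d])
      (auto simp: assoc_mult_mat_vec[OF c(1) c(1)] smult_mult_mat_vec[of _ d d] intro: mult_carrier_mat[OF c(1) c(1)])
  have 2: "(Q * Y * P) * ((Q * Y * P) * (Q * Y * P)) = \<delta> \<cdot>\<^sub>m 1\<^sub>m d"
    by (rule eq_mat_on_vecI[of _ d d])
      (auto simp: assoc_mult_mat_vec[OF c(2) mult_carrier_mat[OF c(2) c(2)]] assoc_mult_mat_vec[OF c(2) c(2)]
        smult_mult_mat_vec[of _ d d] intro: mult_carrier_mat[OF c(2) mult_carrier_mat[OF c(2) c(2)]])
  show pair: "twist_pair d (Q * X * P) (Q * Y * P) \<delta>"
    by unfold_locales (simp_all add: 1 2)
  interpret N: twist_pair d "Q * X * P" "Q * Y * P" \<delta> by (rule pair)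
  show "N.B = Q * B * P"
    by (rule eq_mat_on_vecI[of _ d d]) (auto simp: N.B_vec B_vec)
qed

end

subsection \<open>Schur's lemma\<close>

lemma eigenvector_exists:
  fixes M :: "'k::alg_closed_field mat"
  assumes M: "M \<in> carrier_mat d d" and d: "d \<noteq> 0"
  obtains \<theta> v where "v \<in> carrier_vec d" "v \<noteq> 0\<^sub>v d" "M *\<^sub>v v = \<theta> \<cdot>\<^sub>v v"
proof -
  have "degree (char_poly M) > 0" using degree_monic_char_poly[OF M] d by simp
  then obtain \<theta> where "poly (char_poly M) \<theta> = 0" using alg_closed_imp_poly_has_root by blast
  then show ?thesis
    using that M eigenvalue_root_char_poly[OF M, of \<theta>] unfolding eigenvalue_def eigenvector_def by auto
qed

lemma eigenspace_subspace:
  fixes M :: "'k::field mat"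
  assumes M: "M \<in> carrier_mat d d"
  shows "subspace class_ring {w \<in> carrier_vec d. M *\<^sub>v w = \<theta> \<cdot>\<^sub>v w} (module_vec TYPE('k) d)"
proof -
  have M0: "M *\<^sub>v 0\<^sub>v d = 0\<^sub>v d" by (rule mult_zero_vec_right[OF M])
  show ?thesis
    unfolding subspace_module_vec_iff
    by (auto simp: M0 mult_add_distrib_mat_vec[OF M] mult_mat_vec[OF M] smult_add_distrib_vec smult_smult_assoc mult.commute)
qed

lemma schur:
  fixes X Y :: "'k::alg_closed_field mat"
  assumes irr: "irreducible_pair d X Y" and XY: "X \<in> carrier_mat d d" "Y \<in> carrier_mat d d"
    and R: "R \<in> carrier_mat d d" "R * X = X * R" "R * Y = Y * R" and d: "d \<noteq> 0"
  shows "\<exists>\<theta>. \<forall>w\<in>carrier_vec d. R *\<^sub>v w = \<theta> \<cdot>\<^sub>v w"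
proof -
  obtain \<theta> v where v: "v \<in> carrier_vec d" "v \<noteq> 0\<^sub>v d" "R *\<^sub>v v = \<theta> \<cdot>\<^sub>v v"
    using eigenvector_exists[OF R(1) d] by blast
  let ?W = "{w \<in> carrier_vec d. R *\<^sub>v w = \<theta> \<cdot>\<^sub>v w}"
  have *: "R *\<^sub>v (M *\<^sub>v w) = \<theta> \<cdot>\<^sub>v (M *\<^sub>v w)"
    if "M \<in> carrier_mat d d" "R * M = M * R" "w \<in> ?W" for M w
    using that assoc_mult_mat_vec[OF R(1) that(1), of w] assoc_mult_mat_vec[OF that(1) R(1), of w]
    by (auto simp: mult_mat_vec[of _ d d])
  have "?W = {0\<^sub>v d} \<or> ?W = carrier_vec d"
    using irr eigenspace_subspace[OF R(1), of \<theta>] *[OF XY(1) R(2)] *[OF XY(2) R(3)]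
      mult_mat_vec_carrier[OF XY(1)] mult_mat_vec_carrier[OF XY(2)]
    unfolding irreducible_pair_def by blast
  then have "?W = carrier_vec d" using v by blast
  then show ?thesis by blast
qed

declare lin_prod.simps [simp del]

section \<open>Normal forms of irreducible pairs\<close>

subsection \<open>Vectors and matrices given by coordinate lists\<close>

definition cvec :: "'k::field list \<Rightarrow> 'k vec" where
  "cvec = vec_of_list"

text \<open>Matrices as lists of columns. With all coordinates explicit, products are computed by rewriting.\<close>

definition cmat :: "nat \<Rightarrow> 'k::field list list \<Rightarrow> 'k mat" where
  "cmat n css = mat_of_cols n (map cvec css)"

fun list_comb :: "'k::field list list \<Rightarrow> 'k list \<Rightarrow> 'k list" where
  "list_comb [c] [a] = map ((*) a) c"
| "list_comb (c # cs) (a # as) = map2 (\<lambda>x y. a * x + y) c (list_comb cs as)"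
| "list_comb _ _ = []"

lemma cvec_carrier [simp]: "cvec xs \<in> carrier_vec n \<longleftrightarrow> length xs = n"
  by (metis carrier_vecD carrier_vecI cvec_def dim_vec_of_list)

lemma cvec_eq_iff [simp]: "cvec xs = cvec ys \<longleftrightarrow> xs = ys"
  unfolding cvec_def by (metis list_vec)

lemma cvec_index [simp]: "cvec xs $ i = xs ! i"
  by (simp add: cvec_def vec_of_list_index)

lemma cvec_dim [simp]: "dim_vec (cvec xs) = length xs"
  by (simp add: cvec_def)

lemma cvec_add [simp]: "length xs = length ys \<Longrightarrow> cvec xs + cvec ys = cvec (map2 (+) xs ys)"
  and cvec_diff [simp]: "length xs = length ys \<Longrightarrow> cvec xs - cvec ys = cvec (map2 (-) xs ys)"
  and cvec_smult [simp]: "c \<cdot>\<^sub>v cvec xs = cvec (map ((*) c) xs)"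
  by (auto intro!: eq_vecI)

lemma cvec_cases:
  assumes "u \<in> carrier_vec n"
  obtains xs where "length xs = n" "u = cvec xs"
  using assms that[of "list_of_vec u"] by (auto simp: cvec_def vec_list)

lemma unit_vec_cvec: "unit_vec n j = cvec ((replicate n 0)[j := 1])"
  by (intro eq_vecI) (auto simp: unit_vec_def nth_list_update)

lemma zero_vec_cvec: "0\<^sub>v n = cvec (replicate n 0)"
  by (intro eq_vecI) auto

lemma cmat_carrier [simp]: "length css = m \<Longrightarrow> cmat n css \<in> carrier_mat n m"
  by (auto simp: cmat_def)

lemma cmat_dim [simp]: "dim_row (cmat n css) = n"
  by (simp add: cmat_def)

lemma lin_prod_Cons_cmat [simp]:
  "length css = n \<Longrightarrow> length xs = n \<Longrightarrow> lin_prod [] (cmat n css) *\<^sub>v cvec xs = cvec xs"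
  "length css = n \<Longrightarrow> length xs = n \<Longrightarrow> lin_prod (e # es) (cmat n css) *\<^sub>v cvec xs =
     cmat n css *\<^sub>v (lin_prod es (cmat n css) *\<^sub>v cvec xs) - e \<cdot>\<^sub>v (lin_prod es (cmat n css) *\<^sub>v cvec xs)"
  using lin_prod_Cons_vec[of "cmat n css" n "cvec xs" e es]
    lin_prod_Nil_vec[of "cmat n css" n "cvec xs"] by simp_all

lemma length_list_comb:
  "css \<noteq> [] \<Longrightarrow> length as = length css \<Longrightarrow> \<forall>c\<in>set css. length c = n \<Longrightarrow> length (list_comb css as) = n"
proof (induction css as rule: list_comb.induct)
  case ("2_2" c cs a a' as)
  then show ?case by (cases cs) auto
qed auto

lemma cmat_mult [simp]:
  assumes "css \<noteq> []" "length as = length css" "\<forall>c\<in>set css. length c = n"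
  shows "cmat n css *\<^sub>v cvec as = cvec (list_comb css as)"
proof -
  have "lin_comb n (map cvec css) as = cvec (list_comb css as)"
    using assms
  proof (induction css as rule: list_comb.induct)
    case (1 c a)
    then show ?case by (auto simp: zero_vec_cvec intro!: nth_equalityI)
  next
    case ("2_1" c c' cs a as)
    then show ?case
      using length_list_comb[of "c' # cs" as n] by (auto intro!: nth_equalityI)
  next
    case ("2_2" c cs a a' as)
    then show ?case
      using length_list_comb[of cs "a' # as" n] by (cases cs) (auto intro!: nth_equalityI)
  qed auto
  moreover have "cmat n css *\<^sub>v cvec as = lin_comb n (map cvec css) as"
    unfolding cmat_def using assms by (subst cvec_def) (intro mat_of_cols_mult_vec; auto)
  ultimately show ?thesis by simp
qed

lemma cmat_eqI:
  assumes "M \<in> carrier_mat n m" "length css = m"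
    and "\<And>j. j < m \<Longrightarrow> M *\<^sub>v unit_vec m j = cvec (css ! j)"
  shows "M = cmat n css"
proof (rule eq_matI)
  fix i j assume "i < dim_row (cmat n css)" "j < dim_col (cmat n css)"
  then have ij: "i < n" "j < m" using assms(2) by (auto simp: cmat_def)
  have "col M j $ i = css ! j ! i" using assms(3)[OF ij(2)] mult_unit_vec(1)[OF assms(1) ij(2)] by simp
  then show "M $$ (i, j) = cmat n css $$ (i, j)"
    using ij assms(1,2) by (simp add: cmat_def mat_of_cols_def)
qed (use assms in \<open>auto simp: cmat_def\<close>)

lemma carrier_vec_cases:
  "u \<in> carrier_vec 2 \<Longrightarrow> \<exists>a b. u = cvec [a, b]"
  "u \<in> carrier_vec 3 \<Longrightarrow> \<exists>a b c. u = cvec [a, b, c]"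
  "u \<in> carrier_vec 4 \<Longrightarrow> \<exists>a b c e. u = cvec [a, b, c, e]"
  "u \<in> carrier_vec 5 \<Longrightarrow> \<exists>a b c e f. u = cvec [a, b, c, e, f]"
  by (erule cvec_cases, auto simp: numeral_eq_Suc length_Suc_conv)+

lemma less_numeral_cases:
  "j < (2::nat) \<longleftrightarrow> j = 0 \<or> j = 1"
  "j < (3::nat) \<longleftrightarrow> j = 0 \<or> j = 1 \<or> j = 2"
  "j < (4::nat) \<longleftrightarrow> j = 0 \<or> j = 1 \<or> j = 2 \<or> j = 3"
  "j < (5::nat) \<longleftrightarrow> j = 0 \<or> j = 1 \<or> j = 2 \<or> j = 3 \<or> j = 4"
  by auto

lemma unit_cvecs [simp]:
  "unit_vec 2 0 = cvec [1, 0]" "unit_vec 2 (Suc 0) = cvec [0, 1]"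
  "unit_vec 3 0 = cvec [1, 0, 0]" "unit_vec 3 (Suc 0) = cvec [0, 1, 0]" "unit_vec 3 2 = cvec [0, 0, 1]"
  "unit_vec 4 0 = cvec [1, 0, 0, 0]" "unit_vec 4 (Suc 0) = cvec [0, 1, 0, 0]"
  "unit_vec 4 2 = cvec [0, 0, 1, 0]" "unit_vec 4 3 = cvec [0, 0, 0, 1]"
  "unit_vec 5 0 = cvec [1, 0, 0, 0, 0]" "unit_vec 5 (Suc 0) = cvec [0, 1, 0, 0, 0]"
  "unit_vec 5 2 = cvec [0, 0, 1, 0, 0]" "unit_vec 5 3 = cvec [0, 0, 0, 1, 0]" "unit_vec 5 4 = cvec [0, 0, 0, 0, 1]"
  by (simp_all add: unit_vec_cvec numeral_eq_Suc)

subsection \<open>The column of \<open>\<sigma>\<^sub>2\<close> that the spectrum determines\<close>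

text \<open>In the basis of the orbit, the relations leave only the column \<open>b\<close> of \<open>\<sigma>\<^sub>2\<close> open. The same
  holds in the smaller dimensions below.\<close>

definition B5 :: "'k::field \<Rightarrow> 'k \<Rightarrow> 'k list \<Rightarrow> 'k mat" where
  "B5 \<alpha> \<delta> b = cmat 5 [[0,0,0,1/\<delta>,0], [0,\<alpha>,0,0,0], [\<delta>/\<alpha>,0,0,0,0], b, [0,0,\<delta>,0,0]]"

text \<open>Here \<open>p, q, r, s\<close> are the eigenvalues other than \<open>\<alpha>\<close>, and the hypothesis is what deflation says about one
  basis vector. Four of its five coordinates vanish, which fixes four entries of the unknown column; the
  fifth one computes the scalar \<open>t\<close> from the entry that stays free.\<close>

lemma B5_deflated:
  assumes "\<alpha> \<noteq> 0" "\<delta> \<noteq> 0"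
    and "lin_prod [p,q,r,s] (B5 \<alpha> \<delta> [b0,b1,b2,b3,b4]) *\<^sub>v cvec [0,0,0,0,1] = t \<cdot>\<^sub>v cvec [0,1,0,0,0]"
  shows "b0 = - (p*q+p*r+p*s+q*r+q*s+r*s) * \<delta>" "b2 = (p*q*r+p*q*s+p*r*s+q*r*s) * \<alpha>"
    "b3 = p+q+r+s" "b4 = - p*q*r*s * \<alpha> / \<delta>" "t = b1 * \<delta> / \<alpha>"
proof -
  note * = assms(3)[unfolded B5_def, simplified]
  have "(\<alpha>*\<alpha>*\<delta>*\<delta>) * b3 = (\<alpha>*\<alpha>*\<delta>*\<delta>) * (p+q+r+s)"
    "\<delta> * b2 = \<delta> * ((p*q*r+p*q*s+p*r*s+q*r*s) * \<alpha>)"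
    using * assms(1,2) by (simp_all add: field_simps)
  moreover have "(\<alpha>*\<alpha>*\<delta>) * b0 = (\<alpha>*\<alpha>*\<delta>) * (- (p*q+p*r+p*s+q*r+q*s+r*s) * \<delta>)"
    using * assms(1,2) by (simp add: field_simps eq_neg_iff_add_eq_0)
  ultimately show "b3 = p+q+r+s" "b0 = - (p*q+p*r+p*s+q*r+q*s+r*s) * \<delta>"
    "b2 = (p*q*r+p*q*s+p*r*s+q*r*s) * \<alpha>"
    unfolding mult_cancel_left using assms(1,2) by simp_all
  show "b4 = - p*q*r*s * \<alpha> / \<delta>" "t = b1 * \<delta> / \<alpha>"
    using * assms(1,2) by (simp_all add: field_simps eq_neg_iff_add_eq_0)
qed

definition B4 :: "'k::field \<Rightarrow> 'k \<Rightarrow> 'k list \<Rightarrow> 'k mat" where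
  "B4 \<alpha> \<delta> b = cmat 4 [[0,0,0,1/\<delta>], [0,\<alpha>,0,0], [\<delta>/\<alpha>,0,0,0], b]"

lemma B4_deflated:
  assumes "\<alpha> \<noteq> 0" "\<delta> \<noteq> 0"
    and "lin_prod [p,q,r] (B4 \<alpha> \<delta> [b0,b1,b2,b3]) *\<^sub>v cvec [0,0,1,0] = t \<cdot>\<^sub>v cvec [0,1,0,0]"
  shows "b0 = - (p*q+p*r+q*r) * \<delta>" "b2 = p*q*r * \<alpha>" "b3 = p+q+r" "t = b1 / \<alpha>"
proof -
  note * = assms(3)[unfolded B4_def, simplified]
  have "(\<alpha>*\<delta>) * b3 = (\<alpha>*\<delta>) * (p+q+r)" using * assms(1,2) by (simp add: field_simps)
  then show "b3 = p+q+r" unfolding mult_cancel_left using assms(1,2) by simp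
  show "b0 = - (p*q+p*r+q*r) * \<delta>"
    using * assms(1,2) by (simp add: field_simps eq_neg_iff_add_eq_0)
  show "b2 = p*q*r * \<alpha>" "t = b1 / \<alpha>" using * assms(1,2) by (simp_all add: field_simps)
qed

definition B3mat :: "'k::field \<Rightarrow> 'k \<Rightarrow> 'k list \<Rightarrow> 'k mat" where
  "B3mat \<alpha> \<delta> b = cmat 3 [b, [0,\<alpha>,0], [\<delta>/\<alpha>,0,0]]"

lemma B3mat_deflated:
  assumes "\<alpha> \<noteq> 0" "\<delta> \<noteq> 0"
    and "lin_prod [p,q] (B3mat \<alpha> \<delta> [b0,b1,b2]) *\<^sub>v cvec [0,0,1] = t \<cdot>\<^sub>v cvec [0,1,0]"
  shows "b0 = p+q" "b2 = - p*q * \<alpha> / \<delta>" "t = b1 * \<delta> / \<alpha>"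
proof -
  note * = assms(3)[unfolded B3mat_def, simplified]
  have "\<delta> * b0 = \<delta> * (p+q)" using * assms(1,2) by (simp add: field_simps)
  then show "b0 = p+q" unfolding mult_cancel_left using assms(2) by simp
  show "b2 = - p*q * \<alpha> / \<delta>" "t = b1 * \<delta> / \<alpha>"
    using * assms(1,2) by (simp_all add: field_simps eq_neg_iff_add_eq_0)
qed

definition B2 :: "'k::field \<Rightarrow> 'k list \<Rightarrow> 'k mat" where
  "B2 \<alpha> b = cmat 2 [b, [0,\<alpha>]]"

lemma B2_deflated:
  assumes "lin_prod [p] (B2 \<alpha> [b0,b1]) *\<^sub>v cvec [1,0] = t \<cdot>\<^sub>v cvec [0,1]"
  shows "b0 = p" "t = b1"
  using assms by (simp_all add: B2_def)

subsection \<open>Solving for the matrix entries\<close>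

lemma (in twist_pair) orbit_relations:
  assumes v: "v \<in> carrier_vec d" and eig: "X *\<^sub>v v = \<alpha> \<cdot>\<^sub>v (Y *\<^sub>v v)" and \<alpha>: "\<alpha> \<noteq> 0"
  shows "X *\<^sub>v (Y *\<^sub>v v) = (\<delta> / \<alpha>) \<cdot>\<^sub>v v" "B *\<^sub>v v = inverse \<delta> \<cdot>\<^sub>v (X *\<^sub>v (Y *\<^sub>v (Y *\<^sub>v v)))"
    "B *\<^sub>v (Y *\<^sub>v v) = \<alpha> \<cdot>\<^sub>v (Y *\<^sub>v v)" "B *\<^sub>v (Y *\<^sub>v (Y *\<^sub>v v)) = (\<delta> / \<alpha>) \<cdot>\<^sub>v v"
proof -
  have "X *\<^sub>v (X *\<^sub>v v) = \<alpha> \<cdot>\<^sub>v (X *\<^sub>v (Y *\<^sub>v v))" using v eig by simp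
  then have "inverse \<alpha> \<cdot>\<^sub>v (\<delta> \<cdot>\<^sub>v v) = inverse \<alpha> \<cdot>\<^sub>v (\<alpha> \<cdot>\<^sub>v (X *\<^sub>v (Y *\<^sub>v v)))" using v by simp
  then show XY: "X *\<^sub>v (Y *\<^sub>v v) = (\<delta> / \<alpha>) \<cdot>\<^sub>v v"
    using v \<alpha> by (simp add: smult_smult_assoc divide_inverse mult.commute)
  then show "B *\<^sub>v v = inverse \<delta> \<cdot>\<^sub>v (X *\<^sub>v (Y *\<^sub>v (Y *\<^sub>v v)))" "B *\<^sub>v (Y *\<^sub>v v) = \<alpha> \<cdot>\<^sub>v (Y *\<^sub>v v)"
    "B *\<^sub>v (Y *\<^sub>v (Y *\<^sub>v v)) = (\<delta> / \<alpha>) \<cdot>\<^sub>v v"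
    using v eig by (simp_all add: B_vec[OF v] BY)
qed

text \<open>The arguments \<open>e1, e2, e3, e4\<close> are the elementary symmetric functions of the eigenvalues other than
  \<open>\<alpha>\<close>, here and in the other dimensions.\<close>

definition X5 :: "'k::field \<Rightarrow> 'k \<Rightarrow> 'k \<Rightarrow> 'k \<Rightarrow> 'k \<Rightarrow> 'k \<Rightarrow> 'k mat" where
  "X5 \<alpha> e1 e2 e3 e4 g =
    (let s1 = - (g^3*e1 + e3*\<alpha> + g^4)*g*e4 - e2*g^7; s2 = e3*\<alpha>*g + g^5
     in cmat 5 [[0,\<alpha>,0,0,0], [g^6/\<alpha>,0,0,0,0], [0,0,0,1,0], [0,0,g^6,0,0], [- (g^3*s1), \<alpha>*s1, - (g^3*s2), s2, g^3]])"

definition Y5 :: "'k::field \<Rightarrow> 'k \<Rightarrow> 'k \<Rightarrow> 'k \<Rightarrow> 'k mat" where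
  "Y5 \<alpha> e1 e3 g =
    (let k = g^6*e1 + g^3*e3*\<alpha> + g^7
     in cmat 5 [[0,1,0,0,0], [0,0,1,0,0], [g^6,0,0,0,0], [0,0,0,0,1], [g^4*k, g^2*k, k, - (g^4), - (g^2)]])"

text \<open>The unknowns are the last columns of \<open>X\<close> and \<open>Y\<close> and one column of \<open>B\<close>. Deflation gives the latter, up
  to one entry. The equations \<open>X\<^sup>2 = \<delta>\<close>, \<open>Y\<^sup>3 = \<delta>\<close> and \<open>B Y = X\<close> on the last basis vector determine
  the rest; in particular they force \<open>\<delta> = g\<^sup>6\<close> for \<open>g = \<delta> / det B\<close>.\<close>

lemma shape5:
  assumes "twist_pair 5 X Y \<delta>" and \<alpha>: "\<alpha> \<noteq> 0"
    and cX0: "X *\<^sub>v cvec [1,0,0,0,0] = cvec [0,\<alpha>,0,0,0]" and cY0: "Y *\<^sub>v cvec [1,0,0,0,0] = cvec [0,1,0,0,0]"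
    and cY1: "Y *\<^sub>v cvec [0,1,0,0,0] = cvec [0,0,1,0,0]" and cX2: "X *\<^sub>v cvec [0,0,1,0,0] = cvec [0,0,0,1,0]"
    and cY3: "Y *\<^sub>v cvec [0,0,0,1,0] = cvec [0,0,0,0,1]"
    and defl: "lin_prod [p,q,r,s] (braid_mat \<delta> X Y) *\<^sub>v cvec [0,0,0,0,1] = t \<cdot>\<^sub>v cvec [0,1,0,0,0]"
    and g: "g * (\<alpha>*(p*q*r*s)) = \<delta>"
  shows "\<delta> = g^6" "X = X5 \<alpha> (p+q+r+s) (p*q+p*r+p*s+q*r+q*s+r*s) (p*q*r+p*q*s+p*r*s+q*r*s) (p*q*r*s) g"
    "Y = Y5 \<alpha> (p+q+r+s) (p*q*r+p*q*s+p*r*s+q*r*s) g"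
proof -
  interpret twist_pair 5 X Y \<delta> by fact
  let ?e1 = "p+q+r+s" and ?e2 = "p*q+p*r+p*s+q*r+q*s+r*s" and ?e3 = "p*q*r+p*q*s+p*r*s+q*r*s"
    and ?e4 = "p*q*r*s"
  have g0: "g \<noteq> 0" using g \<delta> by auto
  obtain x0 x1 x2 x3 x4 where cX4: "X *\<^sub>v cvec [0,0,0,0,1] = cvec [x0,x1,x2,x3,x4]"
    using carrier_vec_cases(4)[OF XV[of "cvec [0,0,0,0,1]"]] by auto
  obtain y0 y1 y2 y3 y4 where cY4: "Y *\<^sub>v cvec [0,0,0,0,1] = cvec [y0,y1,y2,y3,y4]"
    using carrier_vec_cases(4)[OF YV[of "cvec [0,0,0,0,1]"]] by auto
  obtain b0 b1 b2 b3 b4 where B3: "B *\<^sub>v cvec [0,0,0,1,0] = cvec [b0,b1,b2,b3,b4]"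
    using carrier_vec_cases(4)[OF BV[of "cvec [0,0,0,1,0]"]] by auto
  note rel = orbit_relations[of "cvec [1,0,0,0,0]" \<alpha>, simplified, simplified cX0 cY0 cY1 cX2, simplified]
  have cY2: "Y *\<^sub>v cvec [0,0,1,0,0] = cvec [\<delta>,0,0,0,0]" using YYY[of "cvec [1,0,0,0,0]"] by (simp add: cY0 cY1)
  have cX3: "X *\<^sub>v cvec [0,0,0,1,0] = cvec [0,0,\<delta>,0,0]" using XX[of "cvec [0,0,1,0,0]", unfolded cX2] by simp
  have B4: "B *\<^sub>v cvec [0,0,0,0,1] = cvec [0,0,\<delta>,0,0]" using BY[of "cvec [0,0,0,1,0]"] by (simp add: cY3 cX3)
  have Xm: "X = cmat 5 [[0,\<alpha>,0,0,0], [\<delta>/\<alpha>,0,0,0,0], [0,0,0,1,0], [0,0,\<delta>,0,0], [x0,x1,x2,x3,x4]]"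
    by (rule cmat_eqI[OF X]) (auto simp: less_numeral_cases cX0 rel cX2 cX3 cX4 \<alpha>)
  have Ym: "Y = cmat 5 [[0,1,0,0,0], [0,0,1,0,0], [\<delta>,0,0,0,0], [0,0,0,0,1], [y0,y1,y2,y3,y4]]"
    by (rule cmat_eqI[OF Y]) (auto simp: less_numeral_cases cY0 cY1 cY2 cY3 cY4)
  have Bm: "B = B5 \<alpha> \<delta> [b0,b1,b2,b3,b4]" unfolding B5_def
    by (rule cmat_eqI[OF B]) (auto simp: less_numeral_cases rel B3 B4 \<alpha> divide_inverse)
  note b = B5_deflated(1-4)[OF \<alpha> \<delta> defl[unfolded Bm]]
  have b4: "b4 = - 1 / g" using b(4) g0 \<delta> by (simp add: field_simps flip: g)
  have y: "y2*\<delta> + y4*y0 = 0" "y0 + y4*y1 = 0" "y1 + y4*y2 = 0" "y4*y3 = \<delta>" "y3 + y4*y4 = 0"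
    using YYY[of "cvec [0,0,0,1,0]"] by (simp_all add: Ym algebra_simps)
  have x: "x1*\<delta>/\<alpha> + x4*x0 = 0" "\<alpha>*x0 + x4*x1 = 0" "\<delta>*x3 + x4*x2 = 0" "x2 + x4*x3 = 0" "x4*x4 = \<delta>"
    using XX[of "cvec [0,0,0,0,1]"] by (simp_all add: Xm algebra_simps)
  have xy: "y2*\<delta>/\<alpha> + y3*b0 = x0" "\<alpha>*y1 + y3*b1 = x1" "y3*b2 + y4*\<delta> = x2" "y0/\<delta> + y3*b3 = x3" "y3*b4 = x4"
    using BY[of "cvec [0,0,0,0,1]"] by (simp_all add: Bm B5_def cY4 cX4 algebra_simps)
  have y3: "y3 = - (y4*y4)" using y(5) by (simp add: eq_neg_iff_add_eq_0)
  have \<delta>y: "\<delta> = - (y4*y4*y4)" using y(4) y3 by (simp add: mult.assoc)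
  have y40: "y4 \<noteq> 0" using \<delta>y \<delta> by auto
  have x4: "x4 = y4*y4/g" using xy(5) by (simp add: y3 b4)
  have "(y4*y4/g)*(y4*y4/g) = - (y4*y4*y4)" using x(5) \<delta>y x4 by simp
  then have "y4*y4*y4*(y4 + g*g) = 0" using g0 by (simp add: field_simps)
  then have y4: "y4 = - (g^2)" using y40 by (simp add: eq_neg_iff_add_eq_0 power2_eq_square)
  show \<delta>g: "\<delta> = g^6" by (simp add: \<delta>y y4 eval_nat_numeral)
  have y3: "y3 = - (g^4)" by (simp add: y3 y4 eval_nat_numeral)
  have x4: "x4 = g^3" using g0 by (simp add: x4 y4 eval_nat_numeral)
  have x2: "x2 = - (g^3) * (?e3*\<alpha>*g + g^5)"
    using xy(3) b(2) by (simp add: y3 y4 \<delta>g eval_nat_numeral algebra_simps)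
  have "g^3 * x3 = g^3 * (?e3*\<alpha>*g + g^5)" using x(4) x4 x2 by (simp add: eq_neg_iff_add_eq_0 algebra_simps)
  then have x3: "x3 = ?e3*\<alpha>*g + g^5" using g0 by simp
  define k where "k = g^6*?e1 + g^3*?e3*\<alpha> + g^7"
  have "y0 / g^6 = g^4*?e1 + x3" using xy(4) by (simp add: \<delta>g y3 b(3) algebra_simps)
  then have y0: "y0 = g^4*k" using g0 by (simp add: x3 k_def field_simps) (simp add: eval_nat_numeral algebra_simps)
  have "g^2 * y1 = g^2 * (g^2*k)" using y(2) by (auto simp: y0 y4 eval_nat_numeral algebra_simps)
  then have y1: "y1 = g^2*k" unfolding mult_cancel_left using g0 by simp
  have "g^2 * y2 = g^2 * k" using y(3) by (auto simp: y1 y4 eval_nat_numeral algebra_simps)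
  then have y2: "y2 = k" using g0 by simp
  define s1 where "s1 = - (g^3*?e1 + ?e3*\<alpha> + g^4)*g*?e4 - ?e2*g^7"
  have "\<delta> / \<alpha> = g*?e4" using \<alpha> by (simp flip: g)
  moreover have "x0 = k*(\<delta>/\<alpha>) + g^4*?e2*g^6" using xy(1)[symmetric] by (simp add: y2 y3 b(1) \<delta>g algebra_simps)
  ultimately have x0: "x0 = - (g^3)*s1" unfolding s1_def k_def
    by (simp add: eval_nat_numeral algebra_simps)
  have "g^3*x1 = g^3*(\<alpha>*s1)" using x(2) by (simp add: x0 x4 algebra_simps)
  then have x1: "x1 = \<alpha>*s1" using g0 by simp
  show "X = X5 \<alpha> ?e1 ?e2 ?e3 ?e4 g"
    unfolding Xm X5_def Let_def by (simp add: x0 x1 x2 x3 x4 \<delta>g s1_def)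
  show "Y = Y5 \<alpha> ?e1 ?e3 g"
    unfolding Ym Y5_def Let_def by (simp add: y0 y1 y2 y3 y4 \<delta>g k_def)
qed

definition X4 :: "'k::field \<Rightarrow> 'k \<Rightarrow> 'k mat" where
  "X4 \<alpha> g = cmat 4 [[0,\<alpha>,0,0], [- (g^3)/\<alpha>,0,0,0], [0,0,0,1], [0,0,- (g^3),0]]"

definition Y4 :: "'k::field \<Rightarrow> 'k \<Rightarrow> 'k \<Rightarrow> 'k \<Rightarrow> 'k mat" where
  "Y4 \<alpha> e1 e2 g = cmat 4 [[0,1,0,0], [0,0,1,0], [- (g^3),0,0,0],
     [- (g^4*e1), - (g^3*e1) - g^2*\<alpha>*e2, - (g*\<alpha>*e2), - g]]"

lemma shape4:
  assumes "twist_pair 4 X Y \<delta>" and \<alpha>: "\<alpha> \<noteq> 0"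
    and cX0: "X *\<^sub>v cvec [1,0,0,0] = cvec [0,\<alpha>,0,0]" and cY0: "Y *\<^sub>v cvec [1,0,0,0] = cvec [0,1,0,0]"
    and cY1: "Y *\<^sub>v cvec [0,1,0,0] = cvec [0,0,1,0]" and cX2: "X *\<^sub>v cvec [0,0,1,0] = cvec [0,0,0,1]"
    and defl: "lin_prod [p,q,r] (braid_mat \<delta> X Y) *\<^sub>v cvec [0,0,1,0] = t \<cdot>\<^sub>v cvec [0,1,0,0]"
    and g: "g * (\<alpha>*(p*q*r)) = - \<delta>"
  shows "\<delta> = - (g^3)" "X = X4 \<alpha> g" "Y = Y4 \<alpha> (p+q+r) (p*q+p*r+q*r) g"
proof -
  interpret twist_pair 4 X Y \<delta> by fact
  let ?e1 = "p+q+r" and ?e2 = "p*q+p*r+q*r" and ?e3 = "p*q*r"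
  have g0: "g \<noteq> 0" using g \<delta> by auto
  obtain y0 y1 y2 y3 where cY3: "Y *\<^sub>v cvec [0,0,0,1] = cvec [y0,y1,y2,y3]"
    using carrier_vec_cases(3)[OF YV[of "cvec [0,0,0,1]"]] by auto
  obtain b0 b1 b2 b3 where cB3: "B *\<^sub>v cvec [0,0,0,1] = cvec [b0,b1,b2,b3]"
    using carrier_vec_cases(3)[OF BV[of "cvec [0,0,0,1]"]] by auto
  note rel = orbit_relations[of "cvec [1,0,0,0]" \<alpha>, simplified, simplified cX0 cY0 cY1 cX2, simplified]
  have cY2: "Y *\<^sub>v cvec [0,0,1,0] = cvec [\<delta>,0,0,0]" using YYY[of "cvec [1,0,0,0]"] by (simp add: cY0 cY1)
  have cX3: "X *\<^sub>v cvec [0,0,0,1] = cvec [0,0,\<delta>,0]" using XX[of "cvec [0,0,1,0]", unfolded cX2] by simp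
  have Ym: "Y = cmat 4 [[0,1,0,0], [0,0,1,0], [\<delta>,0,0,0], [y0,y1,y2,y3]]"
    by (rule cmat_eqI[OF Y]) (auto simp: less_numeral_cases cY0 cY1 cY2 cY3)
  have Xm: "X = cmat 4 [[0,\<alpha>,0,0], [\<delta>/\<alpha>,0,0,0], [0,0,0,1], [0,0,\<delta>,0]]"
    by (rule cmat_eqI[OF X]) (auto simp: less_numeral_cases cX0 rel cX2 cX3 \<alpha>)
  have Bm: "B = B4 \<alpha> \<delta> [b0,b1,b2,b3]" unfolding B4_def
    by (rule cmat_eqI[OF B]) (auto simp: less_numeral_cases rel cB3 \<alpha> divide_inverse)
  note b = B4_deflated(1-3)[OF \<alpha> \<delta> defl[unfolded Bm]]
  have y: "y0 + y3*y1 + y3*y3*y2 = 0" "y3*y3*y3 = \<delta>"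
    using YYY[of "cvec [0,0,0,1]"] by (simp_all add: Ym algebra_simps)
  have xy: "y2*\<delta>/\<alpha> + y3*b0 = 0" "y3*b2 = \<delta>" "y0/\<delta> + y3*b3 = 0"
    using BY[of "cvec [0,0,0,1]"] by (simp_all add: Bm B4_def cY3 cX3 algebra_simps)
  have "?e3 * \<alpha> * y3 = ?e3 * \<alpha> * (- g)" using xy(2) b(2) g by (simp add: algebra_simps)
  moreover have "?e3 * \<alpha> \<noteq> 0" using g \<delta> by auto
  ultimately have y3: "y3 = - g" unfolding mult_cancel_left by simp
  show \<delta>g: "\<delta> = - (g^3)" using y(2)[symmetric] by (simp add: y3 eval_nat_numeral mult.assoc)
  have y0: "y0 = - (g^4*?e1)" using xy(3) g0 by (simp add: \<delta>g y3 b(3) field_simps) (simp add: eval_nat_numeral algebra_simps)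
  have "- (g^3*y2) = - (g^3*(- (g*\<alpha>*?e2)))" using xy(1) g0 \<alpha> by (simp add: \<delta>g y3 b(1) field_simps eval_nat_numeral)
  then have y2: "y2 = - (g*\<alpha>*?e2)" unfolding neg_equal_iff_equal mult_cancel_left using g0 by simp
  have "- (g*y1) = - (g*(- (g^3*?e1) - g^2*\<alpha>*?e2))" using y(1) by (simp add: y0 y2 y3 eval_nat_numeral algebra_simps)
  then have y1: "y1 = - (g^3*?e1) - g^2*\<alpha>*?e2" unfolding neg_equal_iff_equal mult_cancel_left using g0 by simp
  show "X = X4 \<alpha> g" unfolding Xm X4_def by (simp add: \<delta>g)
  show "Y = Y4 \<alpha> ?e1 ?e2 g" unfolding Ym Y4_def by (simp add: \<delta>g y0 y1 y2 y3)
qed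

definition X3 :: "'k::field \<Rightarrow> 'k \<Rightarrow> 'k \<Rightarrow> 'k mat" where
  "X3 \<alpha> e1 e2 = cmat 3 [[0,\<alpha>,0], [\<alpha>*e2^2,0,0], [(\<alpha>*e2)^2*e1, \<alpha>^2*e2*e1, - (\<alpha>*e2)]]"

definition Y3 :: "'k::field \<Rightarrow> 'k \<Rightarrow> 'k mat" where
  "Y3 \<alpha> e2 = cmat 3 [[0,1,0], [0,0,1], [(\<alpha>*e2)^2,0,0]]"

lemma shape3:
  assumes "twist_pair 3 X Y \<delta>" and \<alpha>: "\<alpha> \<noteq> 0"
    and cX0: "X *\<^sub>v cvec [1,0,0] = cvec [0,\<alpha>,0]" and cY0: "Y *\<^sub>v cvec [1,0,0] = cvec [0,1,0]"
    and cY1: "Y *\<^sub>v cvec [0,1,0] = cvec [0,0,1]"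
    and defl: "lin_prod [p,q] (braid_mat \<delta> X Y) *\<^sub>v cvec [0,0,1] = t \<cdot>\<^sub>v cvec [0,1,0]"
  shows "\<delta> = (\<alpha>*(p*q))^2" "X = X3 \<alpha> (p+q) (p*q)" "Y = Y3 \<alpha> (p*q)"
proof -
  interpret twist_pair 3 X Y \<delta> by fact
  obtain x0 x1 x2 where cX2: "X *\<^sub>v cvec [0,0,1] = cvec [x0,x1,x2]"
    using carrier_vec_cases(2)[OF XV[of "cvec [0,0,1]"]] by auto
  obtain b0 b1 b2 where cB0: "B *\<^sub>v cvec [1,0,0] = cvec [b0,b1,b2]"
    using carrier_vec_cases(2)[OF BV[of "cvec [1,0,0]"]] by auto
  note rel = orbit_relations[of "cvec [1,0,0]" \<alpha>, simplified, simplified cX0 cY0 cY1, simplified]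
  have cY2: "Y *\<^sub>v cvec [0,0,1] = cvec [\<delta>,0,0]" using YYY[of "cvec [1,0,0]"] by (simp add: cY0 cY1)
  have Ym: "Y = cmat 3 [[0,1,0], [0,0,1], [\<delta>,0,0]]"
    by (rule cmat_eqI[OF Y]) (auto simp: less_numeral_cases cY0 cY1 cY2)
  have Xm: "X = cmat 3 [[0,\<alpha>,0], [\<delta>/\<alpha>,0,0], [x0,x1,x2]]"
    by (rule cmat_eqI[OF X]) (auto simp: less_numeral_cases cX0 rel cX2 \<alpha>)
  have Bm: "B = B3mat \<alpha> \<delta> [b0,b1,b2]" unfolding B3mat_def
    by (rule cmat_eqI[OF B]) (auto simp: less_numeral_cases rel cB0 \<alpha>)
  note b = B3mat_deflated(1-2)[OF \<alpha> \<delta> defl[unfolded Bm]]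
  have x: "\<alpha>*x0 + x2*x1 = 0" "x2*x2 = \<delta>"
    using XX[of "cvec [0,0,1]"] by (simp_all add: Xm algebra_simps)
  have "\<delta>*b0 = x0" "\<delta>*b2 = x2"
    using BY[of "cvec [0,1,0]"] cB0 by (simp_all add: cY1 rel cX2) (auto simp: B_vec cY0 cY1 cX2)
  then have x0: "x0 = \<delta>*(p+q)" and x2: "x2 = - (\<alpha>*(p*q))" using b \<delta> by (auto simp: field_simps)
  show \<delta>D: "\<delta> = (\<alpha>*(p*q))^2" using x(2) by (simp add: x2 power2_eq_square)
  have "\<alpha>*(p*q) \<noteq> 0" using \<delta> \<delta>D by auto
  moreover have "\<alpha>*(p*q)*x1 = \<alpha>*(p*q)*(\<alpha>^2*(p*q)*(p+q))"
    using x(1) by (simp add: x0 x2 \<delta>D power2_eq_square algebra_simps)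
  ultimately have x1: "x1 = \<alpha>^2*(p*q)*(p+q)" unfolding mult_cancel_left by simp
  show "X = X3 \<alpha> (p+q) (p*q)" unfolding Xm X3_def using \<alpha>
    by (simp add: x0 x1 x2 \<delta>D power2_eq_square ac_simps)
  show "Y = Y3 \<alpha> (p*q)" unfolding Ym Y3_def by (simp add: \<delta>D)
qed

definition X2 :: "'k::field \<Rightarrow> 'k \<Rightarrow> 'k mat" where
  "X2 \<alpha> \<mu> = cmat 2 [[0,\<alpha>], [- (\<alpha>^2*\<mu>^3),0]]"

definition Y2 :: "'k::field \<Rightarrow> 'k \<Rightarrow> 'k mat" where
  "Y2 \<alpha> \<mu> = cmat 2 [[0,1], [- ((\<alpha>*\<mu>)^2), \<alpha>*\<mu>]]"

lemma shape2:
  assumes "twist_pair 2 X Y \<delta>" and \<alpha>: "\<alpha> \<noteq> 0"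
    and cX0: "X *\<^sub>v cvec [1,0] = cvec [0,\<alpha>]" and cY0: "Y *\<^sub>v cvec [1,0] = cvec [0,1]"
    and defl: "lin_prod [p] (braid_mat \<delta> X Y) *\<^sub>v cvec [1,0] = t \<cdot>\<^sub>v cvec [0,1]"
  shows "\<delta> = - ((\<alpha>*p)^3)" "X = X2 \<alpha> p" "Y = Y2 \<alpha> p"
proof -
  interpret twist_pair 2 X Y \<delta> by fact
  obtain y0 y1 where cY1: "Y *\<^sub>v cvec [0,1] = cvec [y0,y1]"
    using carrier_vec_cases(1)[OF YV[of "cvec [0,1]"]] by auto
  obtain b0 b1 where cB0: "B *\<^sub>v cvec [1,0] = cvec [b0,b1]"
    using carrier_vec_cases(1)[OF BV[of "cvec [1,0]"]] by auto
  note rel = orbit_relations[of "cvec [1,0]" \<alpha>, simplified, simplified cX0 cY0, simplified]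
  have Ym: "Y = cmat 2 [[0,1], [y0,y1]]"
    by (rule cmat_eqI[OF Y]) (auto simp: less_numeral_cases cY0 cY1)
  have Xm: "X = cmat 2 [[0,\<alpha>], [\<delta>/\<alpha>,0]]"
    by (rule cmat_eqI[OF X]) (auto simp: less_numeral_cases cX0 rel \<alpha>)
  have Bm: "B = B2 \<alpha> [b0,b1]" unfolding B2_def
    by (rule cmat_eqI[OF B]) (auto simp: less_numeral_cases rel cB0 \<alpha>)
  note b = B2_deflated(1)[OF defl[unfolded Bm]]
  have y: "y1*y0 = \<delta>" "y0 + y1*y1 = 0"
    using YYY[of "cvec [1,0]"] by (simp_all add: Ym)
  have "y0*p = \<delta>/\<alpha>"
    using BY[of "cvec [0,1]"] by (simp add: Bm B2_def cY1 rel b \<alpha>)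
  then have "y0*(\<alpha>*p) = y0*y1" using y(1) \<alpha> by (simp add: field_simps)
  then have y1: "y1 = \<alpha>*p" unfolding mult_cancel_left using y(1) \<delta> by auto
  have y0: "y0 = - ((\<alpha>*p)^2)" using y(2) by (simp add: y1 eq_neg_iff_add_eq_0 power2_eq_square)
  show \<delta>: "\<delta> = - ((\<alpha>*p)^3)" using y(1) by (simp add: y0 y1 eval_nat_numeral)
  show "X = X2 \<alpha> p" unfolding Xm X2_def using \<alpha> by (simp add: \<delta> power2_eq_square power3_eq_cube ac_simps)
  show "Y = Y2 \<alpha> p" unfolding Ym Y2_def by (simp add: y0 y1)
qed

subsection \<open>The normal forms satisfy the relations\<close>

lemma (in twist_pair) braid_mat_eqI:
  assumes "M \<in> carrier_mat d d" "\<And>w. w \<in> carrier_vec d \<Longrightarrow> M *\<^sub>v (Y *\<^sub>v w) = X *\<^sub>v w"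
  shows "B = M"
proof (rule eq_mat_on_vecI[of _ d d])
  fix u :: "'k vec" assume u: "u \<in> carrier_vec d"
  let ?w = "inverse \<delta> \<cdot>\<^sub>v (Y *\<^sub>v (Y *\<^sub>v u))"
  have w: "?w \<in> carrier_vec d" and Yw: "Y *\<^sub>v ?w = u" using u by (simp_all add: smult_smult_assoc)
  show "B *\<^sub>v u = M *\<^sub>v u" using assms(2)[OF w] BY[OF w] unfolding Yw by simp
qed (use assms in auto)

lemma twist_pairI:
  assumes "X \<in> carrier_mat d d" "Y \<in> carrier_mat d d" "\<delta> \<noteq> (0 :: 'k::field)"
    and "\<And>u. u \<in> carrier_vec d \<Longrightarrow> X *\<^sub>v (X *\<^sub>v u) = \<delta> \<cdot>\<^sub>v u"
    and "\<And>u. u \<in> carrier_vec d \<Longrightarrow> Y *\<^sub>v (Y *\<^sub>v (Y *\<^sub>v u)) = \<delta> \<cdot>\<^sub>v u"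
  shows "twist_pair d X Y \<delta>"
proof
  have YY: "Y * Y \<in> carrier_mat d d" using assms(2) by simp
  show "X * X = \<delta> \<cdot>\<^sub>m 1\<^sub>m d"
    by (rule eq_mat_on_vecI[of _ d d])
      (use assms in \<open>simp_all add: smult_mult_mat_vec[of _ d d] assoc_mult_mat_vec[OF assms(1,1)]\<close>)
  show "Y * (Y * Y) = \<delta> \<cdot>\<^sub>m 1\<^sub>m d"
    by (rule eq_mat_on_vecI[of _ d d])
      (use assms YY in \<open>simp_all add: smult_mult_mat_vec[of _ d d] assoc_mult_mat_vec[OF assms(2) YY]
        assoc_mult_mat_vec[OF assms(2,2)] mult_carrier_mat[OF assms(2) YY]\<close>)
qed (use assms in auto)

lemma nf5_pair:
  fixes \<alpha> e1 e2 e3 e4 g :: "'a::field"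
  assumes "\<alpha> \<noteq> 0" "g \<noteq> 0" and e4: "\<alpha> * e4 = g^5"
  defines "k \<equiv> g^6*e1 + g^3*e3*\<alpha> + g^7" and "s1 \<equiv> - (g^3*e1 + e3*\<alpha> + g^4)*g*e4 - e2*g^7"
  shows "twist_pair 5 (X5 \<alpha> e1 e2 e3 e4 g) (Y5 \<alpha> e1 e3 g) (g^6)"
    and "braid_mat (g^6) (X5 \<alpha> e1 e2 e3 e4 g) (Y5 \<alpha> e1 e3 g) =
      B5 \<alpha> (g^6) [- e2*g^6, \<alpha>*(g^2*k - s1)/g^4, e3*\<alpha>, e1, - 1/g]"
proof -
  have ga: "g^6/\<alpha> = g*e4" using assms by (simp add: field_simps) (simp add: eval_nat_numeral algebra_simps)
  let ?X = "X5 \<alpha> e1 e2 e3 e4 g" and ?Y = "Y5 \<alpha> e1 e3 g"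
  have eX: "?X = cmat 5 [[0,\<alpha>,0,0,0], [g^6/\<alpha>,0,0,0,0], [0,0,0,1,0], [0,0,g^6,0,0],
    [- (g^3*s1), \<alpha>*s1, - (g^3*(e3*\<alpha>*g + g^5)), e3*\<alpha>*g + g^5, g^3]]"
    by (simp add: X5_def s1_def Let_def)
  have eY: "?Y = cmat 5 [[0,1,0,0,0], [0,0,1,0,0], [g^6,0,0,0,0], [0,0,0,0,1], [g^4*k, g^2*k, k, - (g^4), - (g^2)]]"
    by (simp add: Y5_def k_def Let_def)
  show P: "twist_pair 5 ?X ?Y (g^6)"
  proof (rule twist_pairI)
    fix u :: "'a vec" assume "u \<in> carrier_vec 5"
    then obtain a b c d f where u: "u = cvec [a,b,c,d,f]" using carrier_vec_cases(4) by blast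
    show "?X *\<^sub>v (?X *\<^sub>v u) = g^6 \<cdot>\<^sub>v u" using assms(1,2) unfolding eX
      by (simp add: u field_simps)
    show "?Y *\<^sub>v (?Y *\<^sub>v (?Y *\<^sub>v u)) = g^6 \<cdot>\<^sub>v u" unfolding eY
      by (simp add: u algebra_simps eval_nat_numeral)
  qed (use assms in \<open>auto simp: eX eY\<close>)
  interpret twist_pair 5 ?X ?Y "g^6" by (rule P)
  show "B = B5 \<alpha> (g^6) [- e2*g^6, \<alpha>*(g^2*k - s1)/g^4, e3*\<alpha>, e1, - 1/g]"
  proof (rule braid_mat_eqI)
    fix w :: "'a vec" assume "w \<in> carrier_vec 5"
    then obtain a b c d f where w: "w = cvec [a,b,c,d,f]" using carrier_vec_cases(4) by blast
    have key: "B5 \<alpha> \<delta> [b0,b1,b2,b3,b4] *\<^sub>v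
        (cmat 5 [[0,1,0,0,0], [0,0,1,0,0], [\<delta>,0,0,0,0], [0,0,0,0,1], [y0,y1,y2,y3,y4]] *\<^sub>v w) =
      cmat 5 [[0,\<alpha>,0,0,0], [\<delta>/\<alpha>,0,0,0,0], [0,0,0,1,0], [0,0,\<delta>,0,0], [x0,x1,x2,x3,x4]] *\<^sub>v w"
      if "x0 = (\<delta>/\<alpha>)*y2 + y3*b0" "x1 = \<alpha>*y1 + y3*b1" "x2 = y3*b2 + y4*\<delta>" "x3 = y0/\<delta> + y3*b3"
        "x4 = y3*b4" "\<delta> \<noteq> 0" for b0 b1 b2 b3 b4 x0 x1 x2 x3 x4 y0 y1 y2 y3 y4 \<delta>
      using that(6) unfolding w B5_def that(1-5) by (simp add: algebra_simps)
    show "B5 \<alpha> (g^6) [- e2*g^6, \<alpha>*(g^2*k - s1)/g^4, e3*\<alpha>, e1, - 1/g] *\<^sub>v (?Y *\<^sub>v w) = ?X *\<^sub>v w"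
      unfolding eX eY
    proof (rule key)
      show "- (g^3*s1) = g^6/\<alpha> * k + - (g^4) * (- e2*g^6)"
        unfolding ga k_def s1_def by (simp add: eval_nat_numeral algebra_simps)
      show "\<alpha>*s1 = \<alpha>*(g^2*k) + - (g^4) * (\<alpha>*(g^2*k - s1)/g^4)"
        using assms(2) by (simp add: algebra_simps diff_divide_distrib) (simp add: eval_nat_numeral)
      show "- (g^3*(e3*\<alpha>*g + g^5)) = - (g^4) * (e3*\<alpha>) + - (g^2) * g^6"
        by (simp add: eval_nat_numeral algebra_simps)
      show "e3*\<alpha>*g + g^5 = g^4*k/g^6 + - (g^4) * e1"
        using assms(2) by (simp add: k_def field_simps) (simp add: eval_nat_numeral algebra_simps)
      show "g^3 = - (g^4) * (- 1/g)" using assms(2) by (simp add: eval_nat_numeral)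
    qed (use assms(2) in simp)
  qed (simp add: B5_def)
qed

lemma nf4_pair:
  assumes "\<alpha> \<noteq> 0" "g \<noteq> 0" and e3: "\<alpha> * e3 = g^2"
  shows "twist_pair 4 (X4 \<alpha> g) (Y4 \<alpha> e1 e2 g) (- (g^3))"
    and "braid_mat (- (g^3)) (X4 \<alpha> g) (Y4 \<alpha> e1 e2 g) =
      B4 \<alpha> (- (g^3)) [e2*g^3, - (\<alpha>*(g^2*e1 + g*\<alpha>*e2)), g^2, e1]"
proof -
  let ?X = "X4 \<alpha> g" and ?Y = "Y4 \<alpha> e1 e2 g"
  show P: "twist_pair 4 ?X ?Y (- (g^3))"
  proof (rule twist_pairI)
    fix u :: "'a vec" assume "u \<in> carrier_vec 4"
    then obtain a b c d where u: "u = cvec [a,b,c,d]" using carrier_vec_cases(3) by blast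
    show "?X *\<^sub>v (?X *\<^sub>v u) = - (g^3) \<cdot>\<^sub>v u" using assms(1,2) unfolding X4_def
      by (simp add: u)
    show "?Y *\<^sub>v (?Y *\<^sub>v (?Y *\<^sub>v u)) = - (g^3) \<cdot>\<^sub>v u" unfolding Y4_def
      by (simp add: u algebra_simps eval_nat_numeral)
  qed (use assms in \<open>auto simp: X4_def Y4_def\<close>)
  interpret twist_pair 4 ?X ?Y "- (g^3)" by (rule P)
  show "B = B4 \<alpha> (- (g^3)) [e2*g^3, - (\<alpha>*(g^2*e1 + g*\<alpha>*e2)), g^2, e1]"
  proof (rule braid_mat_eqI)
    fix w :: "'a vec" assume "w \<in> carrier_vec 4"
    then obtain a b c d where w: "w = cvec [a,b,c,d]" using carrier_vec_cases(3) by blast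
    show "B4 \<alpha> (- (g^3)) [e2*g^3, - (\<alpha>*(g^2*e1 + g*\<alpha>*e2)), g^2, e1] *\<^sub>v (?Y *\<^sub>v w) = ?X *\<^sub>v w"
      unfolding X4_def Y4_def w B4_def using assms(1,2)
      by (simp add: field_simps) (simp add: eval_nat_numeral algebra_simps)
  qed (simp add: B4_def)
qed

lemma nf3_pair:
  assumes "\<alpha> \<noteq> 0" "e2 \<noteq> 0"
  shows "twist_pair 3 (X3 \<alpha> e1 e2) (Y3 \<alpha> e2) ((\<alpha>*e2)^2)"
    and "braid_mat ((\<alpha>*e2)^2) (X3 \<alpha> e1 e2) (Y3 \<alpha> e2) = B3mat \<alpha> ((\<alpha>*e2)^2) [e1, e1/e2, - 1/(\<alpha>*e2)]"
proof -
  let ?X = "X3 \<alpha> e1 e2" and ?Y = "Y3 \<alpha> e2"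
  show P: "twist_pair 3 ?X ?Y ((\<alpha>*e2)^2)"
  proof (rule twist_pairI)
    fix u :: "'a vec" assume "u \<in> carrier_vec 3"
    then obtain a b c where u: "u = cvec [a,b,c]" using carrier_vec_cases(2) by blast
    show "?X *\<^sub>v (?X *\<^sub>v u) = (\<alpha>*e2)^2 \<cdot>\<^sub>v u" unfolding X3_def
      by (simp add: u algebra_simps eval_nat_numeral)
    show "?Y *\<^sub>v (?Y *\<^sub>v (?Y *\<^sub>v u)) = (\<alpha>*e2)^2 \<cdot>\<^sub>v u" unfolding Y3_def
      by (simp add: u)
  qed (use assms in \<open>auto simp: X3_def Y3_def\<close>)
  interpret twist_pair 3 ?X ?Y "(\<alpha>*e2)^2" by (rule P)
  show "B = B3mat \<alpha> ((\<alpha>*e2)^2) [e1, e1/e2, - 1/(\<alpha>*e2)]"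
  proof (rule braid_mat_eqI)
    fix w :: "'a vec" assume "w \<in> carrier_vec 3"
    then obtain a b c where w: "w = cvec [a,b,c]" using carrier_vec_cases(2) by blast
    show "B3mat \<alpha> ((\<alpha>*e2)^2) [e1, e1/e2, - 1/(\<alpha>*e2)] *\<^sub>v (?Y *\<^sub>v w) = ?X *\<^sub>v w"
      unfolding X3_def Y3_def w B3mat_def using assms(1,2)
      by (simp add: field_simps power2_eq_square)
  qed (simp add: B3mat_def)
qed

lemma nf2_pair:
  assumes "\<alpha> \<noteq> 0" "\<mu> \<noteq> 0"
  shows "twist_pair 2 (X2 \<alpha> \<mu>) (Y2 \<alpha> \<mu>) (- ((\<alpha>*\<mu>)^3))"
    and "braid_mat (- ((\<alpha>*\<mu>)^3)) (X2 \<alpha> \<mu>) (Y2 \<alpha> \<mu>) = B2 \<alpha> [\<mu>, 1/\<mu>]"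
proof -
  let ?X = "X2 \<alpha> \<mu>" and ?Y = "Y2 \<alpha> \<mu>"
  show P: "twist_pair 2 ?X ?Y (- ((\<alpha>*\<mu>)^3))"
  proof (rule twist_pairI)
    fix u :: "'a vec" assume "u \<in> carrier_vec 2"
    then obtain a b where u: "u = cvec [a,b]" using carrier_vec_cases(1) by blast
    show "?X *\<^sub>v (?X *\<^sub>v u) = - ((\<alpha>*\<mu>)^3) \<cdot>\<^sub>v u" unfolding X2_def
      by (simp add: u algebra_simps eval_nat_numeral)
    show "?Y *\<^sub>v (?Y *\<^sub>v (?Y *\<^sub>v u)) = - ((\<alpha>*\<mu>)^3) \<cdot>\<^sub>v u" unfolding Y2_def
      by (simp add: u algebra_simps eval_nat_numeral)
  qed (use assms in \<open>auto simp: X2_def Y2_def\<close>)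
  interpret twist_pair 2 ?X ?Y "- ((\<alpha>*\<mu>)^3)" by (rule P)
  show "B = B2 \<alpha> [\<mu>, 1/\<mu>]"
  proof (rule braid_mat_eqI)
    fix w :: "'a vec" assume "w \<in> carrier_vec 2"
    then obtain a b where w: "w = cvec [a,b]" using carrier_vec_cases(1) by blast
    show "B2 \<alpha> [\<mu>, 1/\<mu>] *\<^sub>v (?Y *\<^sub>v w) = ?X *\<^sub>v w"
      unfolding X2_def Y2_def w B2_def using assms(1,2)
      by (simp add: field_simps) (simp add: eval_nat_numeral algebra_simps)
  qed (simp add: B2_def)
qed

section \<open>Polynomial identities by reflection\<close>

text \<open>Some of the polynomial identities below have too many terms for rewriting with ring laws. They are reflected
  into polynomial expressions, whose verified normalization function is then evaluated by rewriting.
  Hypotheses with a monomial on the left, such as \<open>g * i = 1\<close>, are used as substitution rules for monomials.\<close>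

abbreviation "poly_value \<equiv> cring_class.Ipolex"

lemma reify:
  "a = poly_value l P \<Longrightarrow> b = poly_value l Q \<Longrightarrow> a + b = poly_value l (Add P Q)"
  "a = poly_value l P \<Longrightarrow> b = poly_value l Q \<Longrightarrow> a - b = poly_value l (Sub P Q)"
  "a = poly_value l P \<Longrightarrow> b = poly_value l Q \<Longrightarrow> a * b = poly_value l (Mul P Q)"
  "a = poly_value l P \<Longrightarrow> - a = poly_value l (Neg P)"
  "a = poly_value l P \<Longrightarrow> a ^ n = poly_value l (Pow P n)"
  "0 = poly_value l (Const 0)" "1 = poly_value l (Const 1)" "numeral w = poly_value l (Const (numeral w))"
  "x0 = poly_value (x0#l) (Var 0)"
  "x1 = poly_value (x0#x1#l) (Var 1)"
  "x2 = poly_value (x0#x1#x2#l) (Var 2)"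
  "x3 = poly_value (x0#x1#x2#x3#l) (Var 3)"
  "x4 = poly_value (x0#x1#x2#x3#x4#l) (Var 4)"
  "x5 = poly_value (x0#x1#x2#x3#x4#x5#l) (Var 5)"
  "x6 = poly_value (x0#x1#x2#x3#x4#x5#x6#l) (Var 6)"
  "x7 = poly_value (x0#x1#x2#x3#x4#x5#x6#x7#l) (Var 7)"
  "x8 = poly_value (x0#x1#x2#x3#x4#x5#x6#x7#x8#l) (Var 8)"
  "x9 = poly_value (x0#x1#x2#x3#x4#x5#x6#x7#x8#x9#l) (Var 9)"
  "x10 = poly_value (x0#x1#x2#x3#x4#x5#x6#x7#x8#x9#x10#l) (Var 10)"
  "x11 = poly_value (x0#x1#x2#x3#x4#x5#x6#x7#x8#x9#x10#x11#l) (Var 11)"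
  "x12 = poly_value (x0#x1#x2#x3#x4#x5#x6#x7#x8#x9#x10#x11#x12#l) (Var 12)"
  "x13 = poly_value (x0#x1#x2#x3#x4#x5#x6#x7#x8#x9#x10#x11#x12#x13#l) (Var 13)"
  "x14 = poly_value (x0#x1#x2#x3#x4#x5#x6#x7#x8#x9#x10#x11#x12#x13#x14#l) (Var 14)"
  "x15 = poly_value (x0#x1#x2#x3#x4#x5#x6#x7#x8#x9#x10#x11#x12#x13#x14#x15#l) (Var 15)"
  by simp_all

lemma pow_numeral:
  "pow 1 P = P \<langle>*\<rangle> Pc 1"
  "pow (numeral (num.Bit0 n)) P = pow (numeral n) (sqr P)"
  "pow (numeral (num.Bit1 n)) P = P \<langle>*\<rangle> pow (numeral n) (sqr P)"
proof -
  show "pow 1 P = P \<langle>*\<rangle> Pc 1" using pow_simps(3)[of 0 P] by simp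
  have "numeral (num.Bit0 n) = 2 * (numeral n :: nat)" "numeral (num.Bit1 n) = Suc (2 * (numeral n :: nat))"
    by (metis mult_2 numeral_Bit0) (metis mult_2 Suc_eq_plus1 numeral_Bit1)
  then show "pow (numeral (num.Bit0 n)) P = pow (numeral n) (sqr P)"
    "pow (numeral (num.Bit1 n)) P = P \<langle>*\<rangle> pow (numeral n) (sqr P)"
    by (simp_all only: pow_simps)
qed

lemma nat_numeral_arith: "numeral v - (1::nat) = pred_numeral v" "(1::nat) - 1 = 0" "nat 1 = 1"
  by simp_all

lemmas normalize =
  norm.simps add.simps mul.simps neg.simps sqr.simps sub_def mkPX_def mkPinj_def pow_numeral
  mk_monpol_list.simps mon_of_pol.simps mkMX.simps mkMinj_def Minj_pred_def mfactor.simps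
  ponesubst_def pnsubst1.simps pnsubst_def psubstl1.simps psubstl.simps pnsubstl.simps
  pol.case pol.inject pol.distinct option.case option.inject option.distinct
  mon.case mon.inject mon.distinct prod.case Let_def if_True if_False HOL.simp_thms
  arith_simps rel_simps nat_numeral_arith diff_nat_numeral nat_numeral nat_0 pred_numeral_simps
  BitM.simps inc.simps num.inject num.distinct numeral_One numeral_eq_one_iff one_eq_numeral_iff
  dbl_simps dbl_inc_simps dbl_dec_simps sub_num_simps le_num_simps less_num_simps
  one_add_one add_numeral_special add_neg_numeral_special diff_numeral_special
  mult_minus_left mult_minus_right minus_minus minus_zero add_0_left add_0_right
  mult_zero_left mult_zero_right mult_1_left mult_1_right
  zero_neq_one one_neq_zero neg_equal_zero neg_equal_0_iff_equal

text \<open>Congruence rules that keep the branches of conditionals and case distinctions unevaluated until the branch is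
  chosen. Without them the recursion of the substitution functions would be unfolded forever.\<close>

lemmas lazy = if_weak_cong let_weak_cong option.case_cong_weak pol.case_cong_weak mon.case_cong_weak
  prod.case_cong_weak

text \<open>The number 1000 bounds the rounds of substitution; it is large enough for every use.\<close>

lemma polynomial_eqI:
  assumes "a = poly_value l P" "b = poly_value l Q" "cring_class.Ipolex_polex_list l eqs"
    and "pnsubstl (norm (Sub P Q)) (mk_monpol_list eqs) 1000 1000 = Pc 0"
  shows "a = (b :: 'a::comm_ring_1)"
proof -
  have "poly_value l (Sub P Q) = 0"
    using cring_class.norm_subst_correct[OF in_carrier_trivial assms(3), of "Sub P Q" 1000 1000] assms(4) by simp
  then show ?thesis using assms(1,2) by simp
qed

lemma Q5_polynomial:
  fixes \<alpha> \<mu> f1 f2 f3 g :: "'a::field"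
  assumes f3: "\<alpha> * \<mu> * f3 = g^5"
    and "S = (f1 + \<mu>)*(\<mu>*f3) + g^2*(f3 + \<mu>*f2) + g*(\<mu>*f3) + g^3*(f2 + \<mu>*f1)"
    and "U = g^4*(f1 + \<mu>) + g*(\<alpha>*(f3 + \<mu>*f2) + g^4) + S"
    and "n = \<mu> - \<alpha>" and "c = - n * (\<alpha>^3 - f1*\<alpha>^2 + f2*\<alpha> - f3)"
  shows "g^2*(\<alpha>^3*U*\<mu>*(U*\<mu> - S*n) - g^3*c*\<alpha>*n*\<mu>*(\<mu>*f1*g^3 - S)
      + g^3*\<alpha>*U*n*\<mu>*(\<mu>*g^3 + \<alpha>*(f3 + \<mu>*f2) + g^4) - g^4*\<alpha>^4*U*n*(g+\<mu>) - g^8*U*n*\<mu>)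
    = (g^2 + \<alpha>*g + \<alpha>^2) * (g^2 + \<mu>*g + \<mu>^2) *
      (g^6 + g^4*\<alpha>*f1 + g^2*\<alpha>^2*f2 + \<alpha>^3*f3) * (g^6 + g^4*\<mu>*f1 + g^2*\<mu>^2*f2 + \<mu>^3*f3) * \<alpha>"
  unfolding assms(2-5) 
  by (rule polynomial_eqI[where l="[\<alpha>,\<mu>,f1,f2,f3,g]" and eqs="[(Mul (Mul (Var 0) (Var 1)) (Var 4), Pow (Var 5) 5)]"], (rule reify)+, simp add: f3, simp only: normalize cong: lazy)

text \<open>The left-hand side is the scalar that the matrix product in dimension five yields. Multiplication by
  \<open>g\<^sup>8\<close> clears the denominators and leaves the polynomial identity above.\<close>

lemma Q5_algebra:
  fixes \<alpha> \<mu> f1 f2 g :: "'a::field"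
  assumes [simp]: "\<alpha> \<noteq> 0" "\<mu> \<noteq> 0" "g \<noteq> 0" and f3: "\<alpha> * \<mu> * f3 = g^5"
    and e: "e1 = f1 + \<mu>" "e2 = f2 + \<mu>*f1" "e3 = f3 + \<mu>*f2" "e4 = \<mu>*f3"
    and S: "S = e1*e4 + g^2*e3 + g*e4 + g^3*e2" and w: "w = \<alpha>*e3 + g^4" and U: "U = g^4*e1 + g*w + S"
    and n: "n = \<mu> - \<alpha>" and c: "c = - n * (\<alpha>^3 - f1*\<alpha>^2 + f2*\<alpha> - f3)"
  shows "\<alpha>^3*U/g^6*(U*\<mu>^2 - S*n*\<mu>) + c*(\<alpha>*S*n*\<mu>/g^3 - \<alpha>*\<mu>^2*f1*n) + \<alpha>*U*(n*\<mu>^2 + w*n*\<mu>/g^3)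
      + \<alpha>^4*U*(n*(e3*\<alpha>*\<mu>/g^6 - 1/g) - w*n*\<mu>/g^6) - U*g^2*n*\<mu>
    = inverse (g^8) * (g^2 + \<alpha>*g + \<alpha>^2) * (g^2 + \<mu>*g + \<mu>^2) *
      (g^6 + g^4*\<alpha>*f1 + g^2*\<alpha>^2*f2 + \<alpha>^3*f3) * (g^6 + g^4*\<mu>*f1 + g^2*\<mu>^2*f2 + \<mu>^3*f3) * \<alpha>"
    (is "?t1 + ?t2 + ?t3 + ?t4 - ?t5 = ?r")
proof -
  define h where "h = inverse g"
  have h: "g * h = 1" by (simp add: h_def)
  have d: "x / g = x * h" "x / g^3 = x * h^3" "x / g^6 = x * h^6" "inverse (g^8) = h^8" for x
    by (simp_all add: h_def divide_inverse power_inverse)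
  have "(?t1 + ?t2 + ?t3 + ?t4 - ?t5)*g^8 = g^2*(\<alpha>^3*U*\<mu>*(U*\<mu> - S*n) - g^3*c*\<alpha>*n*\<mu>*(\<mu>*f1*g^3 - S)
      + g^3*\<alpha>*U*n*\<mu>*(\<mu>*g^3 + \<alpha>*e3 + g^4) - g^4*\<alpha>^4*U*n*(g+\<mu>) - g^8*U*n*\<mu>)"
    unfolding d w
    by (rule polynomial_eqI[where l="[g,h,U,n,\<alpha>,\<mu>,f1,S,c,e3]" and eqs="[(Mul (Var 0) (Var 1), Const 1)]"], (rule reify)+, simp add: h, simp only: normalize cong: lazy)
  also have "\<dots> = (g^2 + \<alpha>*g + \<alpha>^2) * (g^2 + \<mu>*g + \<mu>^2) *
      (g^6 + g^4*\<alpha>*f1 + g^2*\<alpha>^2*f2 + \<alpha>^3*f3) * (g^6 + g^4*\<mu>*f1 + g^2*\<mu>^2*f2 + \<mu>^3*f3) * \<alpha>"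
    unfolding e by (rule Q5_polynomial[OF f3 _ _ n c]) (simp_all add: S U w e)
  also have "\<dots> = ?r*g^8" unfolding d
    by (rule polynomial_eqI[where l="[g,h,\<alpha>,\<mu>,f1,f2,f3]" and eqs="[(Mul (Var 0) (Var 1), Const 1)]"], (rule reify)+, simp add: h, simp only: normalize cong: lazy)
  finally show ?thesis by simp
qed

lemma Q4_algebra:
  fixes \<alpha> \<mu> k l g :: "'a::field"
  assumes [simp]: "\<alpha> \<noteq> 0" "\<mu> \<noteq> 0" "g \<noteq> 0" and h: "\<alpha> * \<mu> * k * l = g^2"
    and e: "e1 = k + l + \<mu>" "e2 = k*l + \<mu>*k + \<mu>*l"
    and t: "t = - (g^2*e1 + g*\<alpha>*e2)" and n: "n = \<mu> - \<alpha>" and c: "c = - n * (\<alpha> - k) * (\<alpha> - l)"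
  shows "\<alpha>*t*(- (\<alpha>*t*\<mu>/g^3)) + c*(- (\<alpha>*\<mu>*(k+l)*n)) + t*n*\<mu> - \<alpha>^3*t*(g^2*n/g^3)
    = - inverse g * (\<alpha>^2 + g) * (\<mu>^2 + g) * (g + \<alpha>*k + \<mu>*l) * (g + \<alpha>*l + \<mu>*k) * \<alpha>"
    (is "?l = ?r")
proof -
  define i where "i = inverse g"
  have i: "g * i = 1" by (simp add: i_def)
  have d: "x / g = x * i" "x / g^3 = x * i^3" "inverse g = i" for x
    by (simp_all add: i_def divide_inverse power_inverse)
  have "?l*g = ?r*g" unfolding d t c n e
    by (rule polynomial_eqI[where l="[g,i,\<alpha>,\<mu>,k,l]" and eqs="[(Mul (Var 0) (Var 1), Const 1), (Mul (Mul (Mul (Var 2) (Var 3)) (Var 4)) (Var 5), Pow (Var 0) 2)]"], (rule reify)+, simp add: i h, simp only: normalize cong: lazy)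
  then show ?thesis unfolding mult_cancel_right by simp
qed

section \<open>The polynomials Q as matrix coefficients\<close>

text \<open>The quantity \<open>Q\<^sub>r\<^sub>s\<close> in terms of the eigenvalues \<open>\<alpha> = \<lambda>\<^sub>r\<close>, \<open>\<mu> = \<lambda>\<^sub>s\<close> and the list \<open>ks\<close> of the others.
  Lists of eigenvalues suit arguments in which an eigenvalue is found in a module rather than given by an
  index.\<close>

definition Q_value :: "nat \<Rightarrow> 'k::field \<Rightarrow> 'k \<Rightarrow> 'k \<Rightarrow> 'k list \<Rightarrow> 'k" where
  "Q_value d g \<alpha> \<mu> ks =
    (if d = 2 then - (\<alpha>^2) + \<alpha>*\<mu> - \<mu>^2
     else if d = 3 then (\<alpha>^2 + \<mu>*(ks!0)) * (\<mu>^2 + \<alpha>*(ks!0))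
     else if d = 4 then - inverse g * (\<alpha>^2 + g) * (\<mu>^2 + g) * (g + \<alpha>*(ks!0) + \<mu>*(ks!1)) * (g + \<alpha>*(ks!1) + \<mu>*(ks!0))
     else inverse (g^8) * (g^2 + \<alpha>*g + \<alpha>^2) * (g^2 + \<mu>*g + \<mu>^2) * (\<Prod>k\<leftarrow>ks. (g^2 + \<alpha>*k) * (g^2 + \<mu>*k)))"

lemma collapsed_matrix:
  assumes C: "C \<in> carrier_mat n n"
    and "\<And>j. j < n \<Longrightarrow> \<exists>t. C *\<^sub>v unit_vec n j = t \<cdot>\<^sub>v cvec z" and "length z = n"
  shows "\<exists>c. length c = n \<and> C = cmat n (map (\<lambda>t. map ((*) t) z) c)"
proof -
  obtain t where t: "\<And>j. j < n \<Longrightarrow> C *\<^sub>v unit_vec n j = t j \<cdot>\<^sub>v cvec z" using assms(2) by metis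
  show ?thesis
    by (intro exI[of _ "map t [0..<n]"] conjI cmat_eqI[OF C]) (auto simp: t)
qed

text \<open>By deflation, every column of \<open>C\<close>, the product over \<open>\<mu>, a, b, c\<close>, is a multiple of the second basis
  vector. The five multiples follow without computing the product: one from deflation, one from the
  eigenvector of \<open>B\<close>, and the others from \<open>C B = B C\<close>. This leaves one
  matrix-vector product with \<open>X\<close> and a scalar identity.\<close>

lemma Q5_identity:
  fixes \<alpha> \<mu> a b c g :: "'k::field"
  defines "e1 \<equiv> a+b+c+\<mu>" and "e2 \<equiv> a*b+a*c+b*c+\<mu>*(a+b+c)" and "e3 \<equiv> a*b*c+\<mu>*(a*b+a*c+b*c)"
    and "e4 \<equiv> \<mu>*(a*b*c)"
  defines "Bm \<equiv> braid_mat (g^6) (X5 \<alpha> e1 e2 e3 e4 g) (Y5 \<alpha> e1 e3 g)"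
  assumes nz: "\<alpha> \<noteq> 0" "\<mu> \<noteq> 0" "g \<noteq> 0" and g5: "\<alpha> * e4 = g^5"
    and coll: "\<And>u. u \<in> carrier_vec 5 \<Longrightarrow> \<exists>t. lin_prod [\<mu>,a,b,c] Bm *\<^sub>v u = t \<cdot>\<^sub>v cvec [0,1,0,0,0]"
  shows "lin_prod [\<mu>,a,b,c] Bm *\<^sub>v (X5 \<alpha> e1 e2 e3 e4 g *\<^sub>v (lin_prod [\<alpha>,a,b,c] Bm *\<^sub>v cvec [1,0,0,0,0]))
    = (Q_value 5 g \<alpha> \<mu> [a,b,c] * \<alpha>) \<cdot>\<^sub>v cvec [0,1,0,0,0]"
proof -
  define f1 f2 f3 where "f1 = a+b+c" and "f2 = a*b+a*c+b*c" and "f3 = a*b*c"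
  note f = this
  have e: "e1 = f1 + \<mu>" "e2 = f2 + \<mu>*f1" "e3 = f3 + \<mu>*f2" "e4 = \<mu>*f3"
    by (simp_all add: e1_def e2_def e3_def e4_def f)
  have h: "\<alpha> * \<mu> * f3 = g^5" using g5 by (simp add: e mult.assoc)
  define S w U n where "S = e1*e4 + g^2*e3 + g*e4 + g^3*e2" and "w = \<alpha>*e3 + g^4" and "U = g^4*e1 + g*w + S"
    and "n = \<mu> - \<alpha>"
  define \<delta> where "\<delta> = g^6"
  have \<delta>0: "\<delta> \<noteq> 0" using nz by (simp add: \<delta>_def)
  have s1: "- (g^3*e1 + e3*\<alpha> + g^4)*g*e4 - e2*g^7 = - (g^4*S)"
    unfolding S_def e
    by (rule polynomial_eqI[where l="[\<alpha>,\<mu>,f1,f2,f3,g]" and eqs="[(Mul (Mul (Var 0) (Var 1)) (Var 4), Pow (Var 5) 5)]"], (rule reify)+, simp add: h, simp only: normalize cong: lazy)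
  have k: "g^2*(g^6*e1 + g^3*e3*\<alpha> + g^7) + g^4*S = g^4*U"
    unfolding U_def w_def
    by (rule polynomial_eqI[where l="[g,e1,e3,\<alpha>,S]" and eqs="[]"], (rule reify)+, simp, simp only: normalize cong: lazy)
  have Bm: "Bm = B5 \<alpha> \<delta> [- e2*\<delta>, \<alpha>*U, e3*\<alpha>, e1, - 1/g]"
    unfolding Bm_def nf5_pair(2)[OF nz(1,3) g5] s1 using nz(3) by (simp add: k \<delta>_def)
  have Xm: "X5 \<alpha> e1 e2 e3 e4 g = cmat 5 [[0,\<alpha>,0,0,0], [\<delta>/\<alpha>,0,0,0,0], [0,0,0,1,0], [0,0,\<delta>,0,0],
      [g^7*S, - (\<alpha>*g^4*S), - (g^4*w), g*w, g^3]]"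
  proof -
    have *: "- (g^3*(- (g^4*S))) = g^7*S" "\<alpha>*(- (g^4*S)) = - (\<alpha>*g^4*S)" "e3*\<alpha>*g + g^5 = g*w" "g^3*(g*w) = g^4*w"
      unfolding w_def
      by (rule polynomial_eqI[where l="[g,\<alpha>,e3,S]" and eqs="[]"], (rule reify)+, simp, simp only: normalize cong: lazy)+
    show ?thesis unfolding X5_def Let_def s1 * \<delta>_def ..
  qed
  define C where "C = lin_prod [\<mu>,a,b,c] Bm"
  have Bc: "Bm \<in> carrier_mat 5 5" unfolding Bm B5_def by simp
  have Cc: "C \<in> carrier_mat 5 5" unfolding C_def by (rule lin_prod_carrier[OF Bc])
  have "\<exists>x. length x = 5 \<and> C = cmat 5 (map (\<lambda>t. map ((*) t) [0,1,0,0,0]) x)"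
  proof (rule collapsed_matrix[OF Cc])
    show "\<exists>t. C *\<^sub>v unit_vec 5 j = t \<cdot>\<^sub>v cvec [0,1,0,0,0]" for j
      unfolding C_def by (rule coll) simp
  qed simp
  then obtain x0 x1 x2 x3 x4 where
    Cm: "C = cmat 5 [[0,x0,0,0,0],[0,x1,0,0,0],[0,x2,0,0,0],[0,x3,0,0,0],[0,x4,0,0,0]]"
    by (auto simp: numeral_eq_Suc length_Suc_conv)
  have comm: "C *\<^sub>v (Bm *\<^sub>v u) = Bm *\<^sub>v (C *\<^sub>v u)" if "u \<in> carrier_vec 5" for u
    using lin_prod_commute[OF Bc, of "[\<mu>,a,b,c]"] assoc_mult_mat_vec[OF Cc Bc that]
      assoc_mult_mat_vec[OF Bc Cc that] unfolding C_def by simp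
  have x4: "x4 = \<delta>*U"
  proof -
    have "lin_prod [\<mu>,a,b,c] (B5 \<alpha> \<delta> [- e2*\<delta>, \<alpha>*U, e3*\<alpha>, e1, - 1/g]) *\<^sub>v cvec [0,0,0,0,1] = x4 \<cdot>\<^sub>v cvec [0,1,0,0,0]"
      using Cm unfolding C_def Bm by simp
    from B5_deflated(5)[OF nz(1) \<delta>0 this] show ?thesis using nz by simp
  qed
  have "\<delta>*x2 = \<alpha>*x4" using comm[of "cvec [0,0,0,0,1]"] by (simp add: Cm Bm B5_def)
  then have x2: "x2 = \<alpha>*U" using \<delta>0 by (simp add: x4)
  have "(\<delta>/\<alpha>)*x0 = \<alpha>*x2" using comm[of "cvec [0,0,1,0,0]"] by (simp add: Cm Bm B5_def)
  then have x0: "x0 = \<alpha>^3*U/\<delta>" using \<delta>0 nz by (simp add: x2 field_simps eval_nat_numeral)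
  have "x3/\<delta> = \<alpha>*x0" using comm[of "cvec [1,0,0,0,0]"] by (simp add: Cm Bm B5_def)
  then have x3: "x3 = \<alpha>^4*U" using \<delta>0 by (simp add: x0 field_simps eval_nat_numeral)
  have "Bm *\<^sub>v cvec [0,1,0,0,0] = \<alpha> \<cdot>\<^sub>v cvec [0,1,0,0,0]" by (simp add: Bm B5_def)
  from lin_prod_eigenvector[OF Bc _ this, of "[\<mu>,a,b,c]"]
  have "x1 = (\<alpha>-\<mu>)*((\<alpha>-a)*((\<alpha>-b)*(\<alpha>-c)))" unfolding C_def[symmetric] by (simp add: Cm)
  then have x1: "x1 = - n * (\<alpha>^3 - f1*\<alpha>^2 + f2*\<alpha> - f3)" unfolding n_def f
    by (rule HOL.trans) (rule polynomial_eqI[where l="[\<alpha>,\<mu>,a,b,c]" and eqs="[]"], (rule reify)+, simp, simp only: normalize cong: lazy)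
  define ia ig id where "ia = inverse \<alpha>" and "ig = inverse g" and "id = inverse \<delta>"
  have inv: "x / \<alpha> = x * ia" "x / g = x * ig" "x / \<delta> = x * id" "x / (g*\<delta>) = x * ig * id"
    "x / g^6 = x * ig^6" "x / g^3 = x * ig^3" for x
    by (simp_all add: ia_def ig_def id_def divide_inverse power_inverse)
  have i: "\<alpha>*ia = 1" "g*ig = 1" "\<delta>*id = 1" "\<delta>*ia*ig = \<mu>*f3"
  proof -
    have "\<mu>*f3 = g^5*ia" using h nz by (simp add: ia_def field_simps)
    also have "g^5 = \<delta>*ig" using nz by (simp add: \<delta>_def ig_def eval_nat_numeral)
    finally show "\<delta>*ia*ig = \<mu>*f3" by simp
  qed (use nz \<delta>0 in \<open>simp_all add: ia_def ig_def id_def\<close>)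
  have idg: "id = ig^6" by (simp add: id_def ig_def \<delta>_def power_inverse)
  have r: "lin_prod [a,b,c] Bm *\<^sub>v cvec [1,0,0,0,0] =
      cvec [- (\<mu>^2*f1), \<alpha>*U*(\<alpha>+\<mu>)/\<delta>, \<mu>*e3*\<alpha>/\<delta> - 1/g, \<mu>^2/\<delta>, - (\<mu>/(g*\<delta>))]"
    unfolding Bm B5_def
    apply (simp add: inv del: mult_cancel_left mult_cancel_right)
    apply ((intro conjI)?, unfold e f)
    apply (rule polynomial_eqI[where l="[\<alpha>,ia,g,ig,\<delta>,id,\<mu>,a,b,c,U]" and eqs="[(Mul (Var 0) (Var 1), Const 1), (Mul (Var 2) (Var 3), Const 1), (Mul (Var 4) (Var 5), Const 1)]"], (rule reify)+, simp add: i(1-3), simp only: normalize cong: lazy)+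
    done
  have x: "lin_prod [\<alpha>,a,b,c] Bm *\<^sub>v cvec [1,0,0,0,0] =
      cvec [\<mu>^2*f1*(-n), \<alpha>*U*\<mu>^2/\<delta>, n*(e3*\<alpha>*\<mu>/\<delta> - 1/g), n*\<mu>^2/\<delta>, - (n*\<mu>/(g*\<delta>))]"
  proof -
    have "lin_prod [\<alpha>,a,b,c] Bm *\<^sub>v cvec [1,0,0,0,0] = Bm *\<^sub>v (lin_prod [a,b,c] Bm *\<^sub>v cvec [1,0,0,0,0])
        - \<alpha> \<cdot>\<^sub>v (lin_prod [a,b,c] Bm *\<^sub>v cvec [1,0,0,0,0])"
      by (rule lin_prod_Cons_vec[OF Bc]) simp
    also have "\<dots> = cvec [\<mu>^2*f1*(-n), \<alpha>*U*\<mu>^2/\<delta>, n*(e3*\<alpha>*\<mu>/\<delta> - 1/g), n*\<mu>^2/\<delta>, - (n*\<mu>/(g*\<delta>))]"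
      unfolding r unfolding Bm B5_def
      apply (simp add: inv del: mult_cancel_left mult_cancel_right)
      apply ((intro conjI)?, unfold e n_def)
      apply (rule polynomial_eqI[where l="[\<alpha>,ia,g,ig,\<delta>,id,\<mu>,f1,f2,f3,U]" and eqs="[(Mul (Var 0) (Var 1), Const 1), (Mul (Var 2) (Var 3), Const 1), (Mul (Var 4) (Var 5), Const 1), (Mul (Mul (Var 4) (Var 1)) (Var 3), Mul (Var 6) (Var 9))]"], (rule reify)+, simp add: i, simp only: normalize cong: lazy)+
      done
    finally show ?thesis .
  qed
  have "C *\<^sub>v (X5 \<alpha> e1 e2 e3 e4 g *\<^sub>v (lin_prod [\<alpha>,a,b,c] Bm *\<^sub>v cvec [1,0,0,0,0])) =
    cvec [0, \<alpha>^3*U/g^6*(U*\<mu>^2 - S*n*\<mu>) + x1*(\<alpha>*S*n*\<mu>/g^3 - \<alpha>*\<mu>^2*f1*n) + \<alpha>*U*(n*\<mu>^2 + w*n*\<mu>/g^3)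
      + \<alpha>^4*U*(n*(e3*\<alpha>*\<mu>/g^6 - 1/g) - w*n*\<mu>/g^6) - U*g^2*n*\<mu>, 0, 0, 0]"
    unfolding x Xm Cm x0 x2 x3 x4
    apply (simp add: inv del: mult_cancel_left mult_cancel_right)
    apply (unfold idg \<delta>_def)
    apply (rule polynomial_eqI[where l="[\<alpha>,ia,g,ig,\<mu>,f1,e3,U,S,n,w,x1]" and eqs="[(Mul (Var 0) (Var 1), Const 1), (Mul (Var 2) (Var 3), Const 1)]"], (rule reify)+, simp add: i(1,2), simp only: normalize cong: lazy)+
    done
  also have "\<dots> = cvec [0, Q_value 5 g \<alpha> \<mu> [a,b,c] * \<alpha>, 0, 0, 0]"
  proof -
    have "g^6 + g^4*\<alpha>*f1 + g^2*\<alpha>^2*f2 + \<alpha>^3*f3 = (g^2+\<alpha>*a)*((g^2+\<alpha>*b)*(g^2+\<alpha>*c))" for \<alpha>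
      unfolding f
      by (rule polynomial_eqI[where l="[g,\<alpha>,a,b,c]" and eqs="[]"], (rule reify)+, simp, simp only: normalize cong: lazy)
    then show ?thesis
      unfolding Q5_algebra[OF nz h e S_def w_def U_def n_def x1] by (simp add: Q_value_def mult_ac)
  qed
  finally show ?thesis by (simp add: C_def)
qed

lemma Q4_identity:
  fixes \<alpha> \<mu> k l g :: "'k::field"
  defines "e1 \<equiv> k+l+\<mu>" and "e2 \<equiv> k*l+\<mu>*k+\<mu>*l"
  defines "Bm \<equiv> braid_mat (- (g^3)) (X4 \<alpha> g) (Y4 \<alpha> e1 e2 g)"
  assumes nz: "\<alpha> \<noteq> 0" "\<mu> \<noteq> 0" "g \<noteq> 0" and h: "\<alpha> * \<mu> * k * l = g^2"
    and coll: "\<And>u. u \<in> carrier_vec 4 \<Longrightarrow> \<exists>t. lin_prod [\<mu>,k,l] Bm *\<^sub>v u = t \<cdot>\<^sub>v cvec [0,1,0,0]"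
  shows "lin_prod [\<mu>,k,l] Bm *\<^sub>v (X4 \<alpha> g *\<^sub>v (lin_prod [\<alpha>,k,l] Bm *\<^sub>v cvec [1,0,0,0]))
    = (Q_value 4 g \<alpha> \<mu> [k,l] * \<alpha>) \<cdot>\<^sub>v cvec [0,1,0,0]"
proof -
  define t n where "t = - (g^2*e1 + g*\<alpha>*e2)" and "n = \<mu> - \<alpha>"
  define \<delta> where "\<delta> = - (g^3)"
  have \<delta>0: "\<delta> \<noteq> 0" using nz by (simp add: \<delta>_def)
  have "\<alpha> * (\<mu>*k*l) = g^2" using h by (simp add: mult_ac)
  from nf4_pair(2)[OF nz(1,3) this, of e1 e2]
  have Bm: "Bm = B4 \<alpha> \<delta> [- (e2*\<delta>), \<alpha>*t, g^2, e1]"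
    unfolding Bm_def by (simp add: \<delta>_def t_def algebra_simps)
  have Xm: "X4 \<alpha> g = cmat 4 [[0,\<alpha>,0,0], [\<delta>/\<alpha>,0,0,0], [0,0,0,1], [0,0,\<delta>,0]]"
    by (simp add: X4_def \<delta>_def)
  define C where "C = lin_prod [\<mu>,k,l] Bm"
  have Bc: "Bm \<in> carrier_mat 4 4" unfolding Bm B4_def by simp
  have Cc: "C \<in> carrier_mat 4 4" unfolding C_def by (rule lin_prod_carrier[OF Bc])
  have "\<exists>x. length x = 4 \<and> C = cmat 4 (map (\<lambda>t. map ((*) t) [0,1,0,0]) x)"
  proof (rule collapsed_matrix[OF Cc])
    show "\<exists>t. C *\<^sub>v unit_vec 4 j = t \<cdot>\<^sub>v cvec [0,1,0,0]" for j
      unfolding C_def by (rule coll) simp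
  qed simp
  then obtain x0 x1 x2 x3 where Cm: "C = cmat 4 [[0,x0,0,0],[0,x1,0,0],[0,x2,0,0],[0,x3,0,0]]"
    by (auto simp: numeral_eq_Suc length_Suc_conv)
  have comm: "C *\<^sub>v (Bm *\<^sub>v u) = Bm *\<^sub>v (C *\<^sub>v u)" if "u \<in> carrier_vec 4" for u
    using lin_prod_commute[OF Bc, of "[\<mu>,k,l]"] assoc_mult_mat_vec[OF Cc Bc that]
      assoc_mult_mat_vec[OF Bc Cc that] unfolding C_def by simp
  have x2: "x2 = t"
  proof -
    have "lin_prod [\<mu>,k,l] (B4 \<alpha> \<delta> [- (e2*\<delta>), \<alpha>*t, g^2, e1]) *\<^sub>v cvec [0,0,1,0] = x2 \<cdot>\<^sub>v cvec [0,1,0,0]"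
      using Cm unfolding C_def Bm by simp
    from B4_deflated(4)[OF nz(1) \<delta>0 this] show ?thesis using nz by simp
  qed
  have "(\<delta>/\<alpha>)*x0 = \<alpha>*x2" using comm[of "cvec [0,0,1,0]"] by (simp add: Cm Bm B4_def)
  then have x0: "x0 = \<alpha>^2*t/\<delta>" using \<delta>0 nz by (simp add: x2 field_simps eval_nat_numeral)
  have "x3/\<delta> = \<alpha>*x0" using comm[of "cvec [1,0,0,0]"] by (simp add: Cm Bm B4_def)
  then have x3: "x3 = \<alpha>^3*t" using \<delta>0 by (simp add: x0 field_simps eval_nat_numeral)
  have "Bm *\<^sub>v cvec [0,1,0,0] = \<alpha> \<cdot>\<^sub>v cvec [0,1,0,0]" by (simp add: Bm B4_def)
  from lin_prod_eigenvector[OF Bc _ this, of "[\<mu>,k,l]"]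
  have "x1 = (\<alpha>-\<mu>)*((\<alpha>-k)*(\<alpha>-l))" unfolding C_def[symmetric] by (simp add: Cm)
  then have x1: "x1 = - n * (\<alpha> - k) * (\<alpha> - l)" by (simp add: n_def)
  define ia ig id where "ia = inverse \<alpha>" and "ig = inverse g" and "id = inverse \<delta>"
  have inv: "x / \<alpha> = x * ia" "x / g = x * ig" "x / \<delta> = x * id" "x / g^3 = x * ig^3" for x
    by (simp_all add: ia_def ig_def id_def divide_inverse power_inverse)
  have i: "\<alpha>*ia = 1" "g*ig = 1" "\<delta>*id = 1" "g^2*ia = \<mu>*k*l"
    using nz \<delta>0 by (simp_all add: ia_def ig_def id_def h[symmetric])
  have idg: "id = - (ig^3)" by (simp add: id_def ig_def \<delta>_def power_inverse)
  have r: "lin_prod [k,l] Bm *\<^sub>v cvec [1,0,0,0] = cvec [- (\<mu>*(k+l)), \<alpha>*t/\<delta>, g^2/\<delta>, \<mu>/\<delta>]"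
    unfolding Bm B4_def
    apply (simp add: inv del: mult_cancel_left mult_cancel_right)
    apply ((intro conjI)?, unfold e1_def e2_def)
    apply (rule polynomial_eqI[where l="[\<alpha>,ia,g,ig,\<delta>,id,\<mu>,k,l,t]" and eqs="[(Mul (Var 0) (Var 1), Const 1), (Mul (Var 2) (Var 3), Const 1), (Mul (Var 4) (Var 5), Const 1)]"], (rule reify)+, simp add: i(1-3), simp only: normalize cong: lazy)+
    done
  have x: "lin_prod [\<alpha>,k,l] Bm *\<^sub>v cvec [1,0,0,0] = cvec [- (\<mu>*(k+l)*n), \<alpha>*t*\<mu>/\<delta>, g^2*n/\<delta>, \<mu>*n/\<delta>]"
  proof -
    have "lin_prod [\<alpha>,k,l] Bm *\<^sub>v cvec [1,0,0,0] = Bm *\<^sub>v (lin_prod [k,l] Bm *\<^sub>v cvec [1,0,0,0])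
        - \<alpha> \<cdot>\<^sub>v (lin_prod [k,l] Bm *\<^sub>v cvec [1,0,0,0])"
      by (rule lin_prod_Cons_vec[OF Bc]) simp
    also have "\<dots> = cvec [- (\<mu>*(k+l)*n), \<alpha>*t*\<mu>/\<delta>, g^2*n/\<delta>, \<mu>*n/\<delta>]"
      unfolding r unfolding Bm B4_def
      apply (simp add: inv del: mult_cancel_left mult_cancel_right)
      apply ((intro conjI)?, unfold e1_def e2_def n_def)
      apply (rule polynomial_eqI[where l="[\<alpha>,ia,g,ig,\<delta>,id,\<mu>,k,l,t]" and eqs="[(Mul (Var 0) (Var 1), Const 1), (Mul (Var 2) (Var 3), Const 1), (Mul (Var 4) (Var 5), Const 1), (Mul (Pow (Var 2) 2) (Var 1), Mul (Mul (Var 6) (Var 7)) (Var 8))]"], (rule reify)+, simp add: i, simp only: normalize cong: lazy)+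
      done
    finally show ?thesis .
  qed
  have "C *\<^sub>v (X4 \<alpha> g *\<^sub>v (lin_prod [\<alpha>,k,l] Bm *\<^sub>v cvec [1,0,0,0])) =
    cvec [0, \<alpha>*t*(- (\<alpha>*t*\<mu>/g^3)) + x1*(- (\<alpha>*\<mu>*(k+l)*n)) + t*n*\<mu> - \<alpha>^3*t*(g^2*n/g^3), 0, 0]"
    unfolding x Xm Cm x0 x2 x3
    apply (simp add: inv del: mult_cancel_left mult_cancel_right)
    apply (unfold idg \<delta>_def)
    apply (rule polynomial_eqI[where l="[\<alpha>,ia,g,ig,\<mu>,k,l,t,n,x1]" and eqs="[(Mul (Var 0) (Var 1), Const 1), (Mul (Var 2) (Var 3), Const 1)]"], (rule reify)+, simp add: i(1,2), simp only: normalize cong: lazy)+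
    done
  also have "\<dots> = cvec [0, Q_value 4 g \<alpha> \<mu> [k,l] * \<alpha>, 0, 0]"
    unfolding Q4_algebra[OF nz h e1_def[THEN meta_eq_to_obj_eq] e2_def[THEN meta_eq_to_obj_eq] t_def n_def x1]
    by (simp add: Q_value_def mult_ac)
  finally show ?thesis by (simp add: C_def)
qed

lemma Q3_identity:
  fixes \<alpha> \<mu> k :: "'k::field"
  defines "Bm \<equiv> braid_mat ((\<alpha>*(\<mu>*k))^2) (X3 \<alpha> (\<mu>+k) (\<mu>*k)) (Y3 \<alpha> (\<mu>*k))"
  assumes nz: "\<alpha> \<noteq> 0" "\<mu> \<noteq> 0" "k \<noteq> 0"
  shows "lin_prod [\<mu>,k] Bm *\<^sub>v (X3 \<alpha> (\<mu>+k) (\<mu>*k) *\<^sub>v (lin_prod [\<alpha>,k] Bm *\<^sub>v cvec [1,0,0]))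
    = (Q_value 3 g \<alpha> \<mu> [k] * \<alpha>) \<cdot>\<^sub>v cvec [0,1,0]"
proof -
  define ia im ik where "ia = inverse \<alpha>" and "im = inverse \<mu>" and "ik = inverse k"
  have inv: "x / \<alpha> = x * ia" "x / (\<mu>*k) = x * im * ik" "x / (\<alpha>*(\<mu>*k)) = x * ia * im * ik" for x
    by (simp_all add: ia_def im_def ik_def divide_inverse)
  have i: "\<alpha>*ia = 1" "\<mu>*im = 1" "k*ik = 1"
    using nz by (simp_all add: ia_def im_def ik_def)
  have e2: "\<mu>*k \<noteq> 0" using nz by simp
  have Bm: "Bm = B3mat \<alpha> ((\<alpha>*(\<mu>*k))^2) [\<mu>+k, (\<mu>+k)/(\<mu>*k), - 1/(\<alpha>*(\<mu>*k))]"
    unfolding Bm_def by (rule nf3_pair(2)[OF nz(1) e2])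
  show ?thesis
    unfolding Bm B3mat_def X3_def
    apply (simp add: inv Q_value_def del: mult_cancel_left mult_cancel_right)
    apply ((intro conjI)?)
    apply (rule polynomial_eqI[where l="[\<alpha>,ia,\<mu>,im,k,ik]" and eqs="[(Mul (Var 0) (Var 1), Const 1), (Mul (Var 2) (Var 3), Const 1), (Mul (Var 4) (Var 5), Const 1)]"], (rule reify)+, simp add: i, simp only: normalize cong: lazy)+
    done
qed

lemma Q2_identity:
  fixes \<alpha> \<mu> :: "'k::field"
  defines "Bm \<equiv> braid_mat (- ((\<alpha>*\<mu>)^3)) (X2 \<alpha> \<mu>) (Y2 \<alpha> \<mu>)"
  assumes nz: "\<alpha> \<noteq> 0" "\<mu> \<noteq> 0"
  shows "lin_prod [\<mu>] Bm *\<^sub>v (X2 \<alpha> \<mu> *\<^sub>v (lin_prod [\<alpha>] Bm *\<^sub>v cvec [1,0]))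
    = (Q_value 2 g \<alpha> \<mu> [] * \<alpha>) \<cdot>\<^sub>v cvec [0,1]"
proof -
  define im where "im = inverse \<mu>"
  have inv: "x / \<mu> = x * im" for x by (simp add: im_def divide_inverse)
  have i: "\<mu>*im = 1" using nz by (simp add: im_def)
  have Bm: "Bm = B2 \<alpha> [\<mu>, 1/\<mu>]" unfolding Bm_def by (rule nf2_pair(2)[OF nz])
  show ?thesis
    unfolding Bm B2_def X2_def
    apply (simp add: inv Q_value_def del: mult_cancel_left mult_cancel_right)
    apply (rule polynomial_eqI[where l="[\<mu>,im,\<alpha>]" and eqs="[(Mul (Var 0) (Var 1), Const 1)]"], (rule reify)+, simp add: i, simp only: normalize cong: lazy)
    done
qed

section \<open>The normal forms in all dimensions\<close>

text \<open>The elementary symmetric functions, taken from the coefficients of the polynomial with the given roots, which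
  makes their invariance under permutations immediate.\<close>

definition esym :: "'k::field list \<Rightarrow> nat \<Rightarrow> 'k" where
  "esym es i = (-1)^i * coeff (\<Prod>e\<leftarrow>es. [:-e, 1:]) (length es - i)"

lemma esym_simps:
  "esym [p] (Suc 0) = p"
  "esym [p,q] (Suc 0) = p+q" "esym [p,q] 2 = p*q"
  "esym [p,q,r] (Suc 0) = p+q+r" "esym [p,q,r] 2 = p*q+p*r+q*r" "esym [p,q,r] 3 = p*q*r"
  "esym [p,q,r,s] (Suc 0) = p+q+r+s" "esym [p,q,r,s] 2 = p*q+p*r+p*s+q*r+q*s+r*s"
  "esym [p,q,r,s] 3 = p*q*r+p*q*s+p*r*s+q*r*s" "esym [p,q,r,s] 4 = p*q*r*s"
  by (simp_all add: esym_def eval_nat_numeral algebra_simps)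

lemma linear_factors_mset_cong:
  "mset es = mset fs \<Longrightarrow> (\<Prod>e\<leftarrow>es. [:-e, 1:]) = (\<Prod>e\<leftarrow>fs. [:-e, 1:])"
  by (metis mset_map prod_mset_prod_list)

lemma esym_mset_cong: "mset es = mset fs \<Longrightarrow> esym es = esym fs"
  using linear_factors_mset_cong[of es fs] mset_eq_length[of es fs] by (auto simp: esym_def fun_eq_iff)

definition nf_X :: "nat \<Rightarrow> 'k::field \<Rightarrow> 'k list \<Rightarrow> 'k \<Rightarrow> 'k mat" where
  "nf_X d \<alpha> es g =
    (if d = 2 then X2 \<alpha> (esym es 1)
     else if d = 3 then X3 \<alpha> (esym es 1) (esym es 2)
     else if d = 4 then X4 \<alpha> g
     else X5 \<alpha> (esym es 1) (esym es 2) (esym es 3) (esym es 4) g)"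

definition nf_Y :: "nat \<Rightarrow> 'k::field \<Rightarrow> 'k list \<Rightarrow> 'k \<Rightarrow> 'k mat" where
  "nf_Y d \<alpha> es g =
    (if d = 2 then Y2 \<alpha> (esym es 1)
     else if d = 3 then Y3 \<alpha> (esym es 2)
     else if d = 4 then Y4 \<alpha> (esym es 1) (esym es 2) g
     else Y5 \<alpha> (esym es 1) (esym es 3) g)"

definition nf_delta :: "nat \<Rightarrow> 'k::field \<Rightarrow> 'k list \<Rightarrow> 'k \<Rightarrow> 'k" where
  "nf_delta d \<alpha> es g =
    (if d = 2 then - ((\<alpha>*esym es 1)^3)
     else if d = 3 then (\<alpha>*esym es 2)^2
     else if d = 4 then - (g^3)
     else g^6)"

lemma length_minus_one_cases:
  assumes "2 \<le> d" "d \<le> 5" "length es = d - 1"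
  obtains (d2) p where "d = 2" "es = [p]" | (d3) p q where "d = 3" "es = [p,q]"
    | (d4) p q r where "d = 4" "es = [p,q,r]" | (d5) p q r s where "d = 5" "es = [p,q,r,s]"
proof -
  have "d = 2 \<or> d = 3 \<or> d = 4 \<or> d = 5" using assms(1,2) by auto
  then show ?thesis using assms(3) that by (auto simp: numeral_eq_Suc length_Suc_conv)
qed

text \<open>The normal form is reached as soon as the orbit is the standard basis: deflation supplies the hypothesis of
  the lemma for each dimension.\<close>

lemma nf_shape:
  assumes d: "2 \<le> d" "d \<le> 5" "length es = d - 1" and pair: "twist_pair d X Y \<delta>" and \<alpha>: "\<alpha> \<noteq> 0"
    and orb: "\<And>j. j < d \<Longrightarrow> orbit X Y (unit_vec d 0) ! j = unit_vec d j"
    and eig: "X *\<^sub>v unit_vec d 0 = \<alpha> \<cdot>\<^sub>v (Y *\<^sub>v unit_vec d 0)"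
    and cp: "char_poly (braid_mat \<delta> X Y) = (\<Prod>e\<leftarrow>\<alpha> # es. [:-e, 1:])"
    and g: "d = 4 \<Longrightarrow> g * (\<alpha> * prod_list es) = - \<delta>" "d = 5 \<Longrightarrow> g * (\<alpha> * prod_list es) = \<delta>"
  shows "\<delta> = nf_delta d \<alpha> es g \<and> X = nf_X d \<alpha> es g \<and> Y = nf_Y d \<alpha> es g"
proof -
  interpret twist_pair d X Y \<delta> by (rule pair)
  have Y0: "Y *\<^sub>v unit_vec d 0 = unit_vec d 1" using orb[of 1] d by simp
  have ne: "unit_vec d 1 \<noteq> (0\<^sub>v d :: 'a vec)" using d by (auto dest!: arg_cong[of _ _ "\<lambda>v. v $ 1"])
  have B1: "B *\<^sub>v unit_vec d 1 = \<alpha> \<cdot>\<^sub>v unit_vec d 1" using BY[of "unit_vec d 0"] eig by (simp add: Y0)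
  have defl: "\<exists>t. lin_prod es B *\<^sub>v u = t \<cdot>\<^sub>v unit_vec d 1" if "u \<in> carrier_vec d" for u
    by (rule deflation[OF B cp _ ne B1 that]) simp
  from d show ?thesis
  proof (cases rule: length_minus_one_cases)
    case (d2 p)
    obtain t where "lin_prod [p] B *\<^sub>v cvec [1,0] = t \<cdot>\<^sub>v cvec [0,1]" using defl[of "cvec [1,0]"] d2 by auto
    from shape2[OF pair[unfolded d2(1)] \<alpha> _ _ this] show ?thesis
      using orb[of 1] eig by (simp add: d2 nf_delta_def nf_X_def nf_Y_def esym_simps)
  next
    case (d3 p q)
    obtain t where "lin_prod [p,q] B *\<^sub>v cvec [0,0,1] = t \<cdot>\<^sub>v cvec [0,1,0]" using defl[of "cvec [0,0,1]"] d3 by auto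
    from shape3[OF pair[unfolded d3(1)] \<alpha> _ _ _ this] show ?thesis
      using orb[of 1] orb[of 2] eig by (simp add: d3 nf_delta_def nf_X_def nf_Y_def esym_simps)
  next
    case (d4 p q r)
    obtain t where "lin_prod [p,q,r] B *\<^sub>v cvec [0,0,1,0] = t \<cdot>\<^sub>v cvec [0,1,0,0]"
      using defl[of "cvec [0,0,1,0]"] d4 by auto
    from shape4[OF pair[unfolded d4(1)] \<alpha> _ _ _ _ this] show ?thesis
      using orb[of 1] orb[of 2] orb[of 3] eig g(1)
      by (simp add: d4 nf_delta_def nf_X_def nf_Y_def esym_simps mult.assoc)
  next
    case (d5 p q r s)
    obtain t where "lin_prod [p,q,r,s] B *\<^sub>v cvec [0,0,0,0,1] = t \<cdot>\<^sub>v cvec [0,1,0,0,0]"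
      using defl[of "cvec [0,0,0,0,1]"] d5 by auto
    from shape5[OF pair[unfolded d5(1)] \<alpha> _ _ _ _ _ this] show ?thesis
      using orb[of 1] orb[of 2] orb[of 3] orb[of 4] eig g(2)
      by (simp add: d5 nf_delta_def nf_X_def nf_Y_def esym_simps mult.assoc)
  qed
qed

locale normal_form =
  fixes d :: nat and \<alpha> :: "'k::alg_closed_field" and es :: "'k list" and g :: 'k
  assumes d: "2 \<le> d" "d \<le> 5" and len: "length es = d - 1" and \<alpha>: "\<alpha> \<noteq> 0" and es: "0 \<notin> set es"
    and g4: "d = 4 \<Longrightarrow> g^2 = \<alpha> * prod_list es" and g5: "d = 5 \<Longrightarrow> g^5 = \<alpha> * prod_list es"
begin

abbreviation "NX \<equiv> nf_X d \<alpha> es g"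
abbreviation "NY \<equiv> nf_Y d \<alpha> es g"
abbreviation "N\<delta> \<equiv> nf_delta d \<alpha> es g"
abbreviation "NB \<equiv> braid_mat N\<delta> NX NY"

lemma cases_d:
  obtains (d2) p where "d = 2" "es = [p]" "p \<noteq> 0" | (d3) p q where "d = 3" "es = [p,q]" "p*q \<noteq> 0"
    | (d4) p q r where "d = 4" "es = [p,q,r]" "p*q*r \<noteq> 0" "g \<noteq> 0" "\<alpha>*(p*q*r) = g^2"
    | (d5) p q r s where "d = 5" "es = [p,q,r,s]" "p*q*r*s \<noteq> 0" "g \<noteq> 0" "\<alpha>*(p*q*r*s) = g^5"
  using d len
proof (cases rule: length_minus_one_cases)
  case (d2 p)
  then show ?thesis using that(1) es by simp
next
  case (d3 p q)
  then show ?thesis using that(2) es by simp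
next
  case (d4 p q r)
  then have *: "p*q*r \<noteq> 0" "\<alpha>*(p*q*r) = g^2" using es g4 by (simp_all add: mult.assoc)
  then have "g \<noteq> 0" using \<alpha> by auto
  with * show ?thesis using that(3) d4 by blast
next
  case (d5 p q r s)
  then have *: "p*q*r*s \<noteq> 0" "\<alpha>*(p*q*r*s) = g^5" using es g5 by (simp_all add: mult.assoc)
  then have "g \<noteq> 0" using \<alpha> by auto
  with * show ?thesis using that(4) d5 by blast
qed

sublocale twist_pair d NX NY N\<delta>
proof (cases rule: cases_d)
  case (d2 p)
  then show "twist_pair d NX NY N\<delta>" using nf2_pair(1)[OF \<alpha>, of p] by (simp add: nf_X_def nf_Y_def nf_delta_def esym_simps)
next
  case (d3 p q)
  then show "twist_pair d NX NY N\<delta>" using nf3_pair(1)[OF \<alpha>, of "p*q"] by (simp add: nf_X_def nf_Y_def nf_delta_def esym_simps)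
next
  case (d4 p q r)
  then show "twist_pair d NX NY N\<delta>" using nf4_pair(1)[OF \<alpha>, of g "p*q*r"] by (simp add: nf_X_def nf_Y_def nf_delta_def esym_simps)
next
  case (d5 p q r s)
  then show "twist_pair d NX NY N\<delta>" using nf5_pair(1)[OF \<alpha>, of g "p*q*r*s"] by (simp add: nf_X_def nf_Y_def nf_delta_def esym_simps)
qed

lemma orbit_unit_vec: "j < d \<Longrightarrow> orbit NX NY (unit_vec d 0) ! j = unit_vec d j"
  by (cases rule: cases_d)
    (auto simp: less_numeral_cases nf_X_def nf_Y_def X2_def Y2_def X3_def Y3_def X4_def Y4_def X5_def Y5_def Let_def)

lemma NY_unit_vec: "NY *\<^sub>v unit_vec d 0 = unit_vec d 1"
  using orbit_unit_vec[of 1] d by simp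

lemma eigen: "NX *\<^sub>v unit_vec d 0 = \<alpha> \<cdot>\<^sub>v (NY *\<^sub>v unit_vec d 0)"
  by (cases rule: cases_d)
    (auto simp: nf_X_def nf_Y_def X2_def Y2_def X3_def Y3_def X4_def Y4_def X5_def Y5_def Let_def)

lemma NB_unit_vec: "NB *\<^sub>v unit_vec d 1 = \<alpha> \<cdot>\<^sub>v unit_vec d 1"
  using BY[of "unit_vec d 0"] eigen by (simp add: NY_unit_vec)

lemma unit_vec_nonzero: "j < d \<Longrightarrow> unit_vec d j \<noteq> (0\<^sub>v d :: 'k vec)"
  by (auto dest!: arg_cong[of _ _ "\<lambda>v. v $ j"])

lemma char_poly_NB: "char_poly NB = (\<Prod>e\<leftarrow>\<alpha> # es. [:-e, 1:])"
proof -
  note deg = degree_monic_char_poly[OF B]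
  have "char_poly NB \<noteq> 0" using deg by auto
  then obtain A where "size A = d" "char_poly NB = (\<Prod>x\<in>#A. [:-x, 1:])"
    using alg_closed_imp_factorization[of "char_poly NB"] deg by auto
  moreover obtain rs where "mset rs = A" by (metis ex_mset)
  ultimately have rs: "char_poly NB = (\<Prod>e\<leftarrow>rs. [:-e, 1:])" "length rs = d"
    by (auto simp flip: prod_mset_prod_list)
  have "eigenvalue NB \<alpha>"
    unfolding eigenvalue_def eigenvector_def
    using NB_unit_vec unit_vec_nonzero[of 1] d carrier_matD[OF B] by (intro exI[of _ "unit_vec d 1"]) simp
  then have "poly (\<Prod>e\<leftarrow>rs. [:-e, 1:]) \<alpha> = 0" using eigenvalue_root_char_poly[OF B] rs by simp
  then have "\<alpha> \<in> set rs" by (induction rs) auto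
  then obtain fs where fs: "mset rs = mset (\<alpha> # fs)"
    by (metis insert_DiffM mset_remove1 mset.simps(2) set_mset_mset)
  then have cp: "char_poly NB = (\<Prod>e\<leftarrow>\<alpha> # fs. [:-e, 1:])" using rs linear_factors_mset_cong by metis
  have len_fs: "length fs = d - 1" using fs rs(2) by (metis diff_Suc_1 length_Cons mset_eq_length)
  have defl: "\<exists>t. lin_prod fs NB *\<^sub>v u = t \<cdot>\<^sub>v unit_vec d 1" if "u \<in> carrier_vec d" for u
    by (rule deflation[OF B cp _ unit_vec_nonzero NB_unit_vec that]) (use d in simp_all)
  have "(\<Prod>e\<leftarrow>fs. [:-e, 1:]) = (\<Prod>e\<leftarrow>es. [:-e, 1:])"
  proof (cases rule: cases_d)
    case (d2 p)
    then obtain p' where fs: "fs = [p']" using len_fs by (auto simp: numeral_eq_Suc length_Suc_conv)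
    obtain t where "lin_prod fs NB *\<^sub>v cvec [1,0] = t \<cdot>\<^sub>v cvec [0,1]" using defl[of "cvec [1,0]"] d2 by auto
    then have "lin_prod [p'] (B2 \<alpha> [p, 1/p]) *\<^sub>v cvec [1,0] = t \<cdot>\<^sub>v cvec [0,1]"
      using nf2_pair(2)[OF \<alpha>, of p] d2 fs by (simp add: nf_X_def nf_Y_def nf_delta_def esym_simps)
    from B2_deflated(1)[OF this] show ?thesis by (simp add: fs d2)
  next
    case (d3 p q)
    then obtain p' q' where fs: "fs = [p',q']" using len_fs by (auto simp: numeral_eq_Suc length_Suc_conv)
    let ?D = "(\<alpha>*(p*q))^2"
    have D: "?D \<noteq> 0" using d3 \<alpha> by simp
    obtain t where "lin_prod fs NB *\<^sub>v cvec [0,0,1] = t \<cdot>\<^sub>v cvec [0,1,0]" using defl[of "cvec [0,0,1]"] d3 by auto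
    then have "lin_prod [p',q'] (B3mat \<alpha> ?D [p+q, (p+q)/(p*q), - 1/(\<alpha>*(p*q))]) *\<^sub>v cvec [0,0,1] = t \<cdot>\<^sub>v cvec [0,1,0]"
      using nf3_pair(2)[OF \<alpha>, of "p*q"] d3 fs by (simp add: nf_X_def nf_Y_def nf_delta_def esym_simps)
    note * = B3mat_deflated[OF \<alpha> D this]
    have "p' * q' = p * q" using *(2) D \<alpha> d3(3) by (simp add: field_simps power2_eq_square)
    then show ?thesis using *(1) by (simp add: fs d3 algebra_simps)
  next
    case (d4 p q r)
    then obtain p' q' r' where fs: "fs = [p',q',r']" using len_fs by (auto simp: numeral_eq_Suc length_Suc_conv)
    have D: "- (g^3) \<noteq> 0" using d4 by simp
    obtain t where "lin_prod fs NB *\<^sub>v cvec [0,0,1,0] = t \<cdot>\<^sub>v cvec [0,1,0,0]" using defl[of "cvec [0,0,1,0]"] d4 by auto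
    then have "lin_prod [p',q',r'] (B4 \<alpha> (- (g^3)) [(p*q+p*r+q*r)*g^3, - (\<alpha>*(g^2*(p+q+r) + g*\<alpha>*(p*q+p*r+q*r))), g^2, p+q+r])
        *\<^sub>v cvec [0,0,1,0] = t \<cdot>\<^sub>v cvec [0,1,0,0]"
      using nf4_pair(2)[OF \<alpha> d4(4,5)] d4 fs by (simp add: nf_X_def nf_Y_def nf_delta_def esym_simps)
    note * = B4_deflated[OF \<alpha> D this]
    have "p'*q'*r' = p*q*r" using *(2) \<alpha> by (auto simp: mult.assoc simp flip: d4(5))
    moreover have "(p'*q'+p'*r'+q'*r') * g^3 = (p*q+p*r+q*r) * g^3" using *(1) by (simp add: algebra_simps)
    then have "p'*q'+p'*r'+q'*r' = p*q+p*r+q*r" unfolding mult_cancel_right using d4(4) by simp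
    ultimately show ?thesis using *(3) by (simp add: fs d4 algebra_simps)
  next
    case (d5 p q r s)
    then obtain p' q' r' s' where fs: "fs = [p',q',r',s']" using len_fs by (auto simp: numeral_eq_Suc length_Suc_conv)
    let ?e1 = "p+q+r+s" and ?e2 = "p*q+p*r+p*s+q*r+q*s+r*s" and ?e3 = "p*q*r+p*q*s+p*r*s+q*r*s"
      and ?e4 = "p*q*r*s"
    have D: "g^6 \<noteq> 0" using d5 by simp
    obtain t where t: "lin_prod fs NB *\<^sub>v cvec [0,0,0,0,1] = t \<cdot>\<^sub>v cvec [0,1,0,0,0]" using defl[of "cvec [0,0,0,0,1]"] d5 by auto
    have "\<exists>b. NB = B5 \<alpha> (g^6) [- ?e2*g^6, b, ?e3*\<alpha>, ?e1, - 1/g]"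
      using nf5_pair(2)[OF \<alpha> d5(4,5), of ?e1 ?e2 ?e3] d5 by (auto simp: nf_X_def nf_Y_def nf_delta_def esym_simps)
    then obtain b where "NB = B5 \<alpha> (g^6) [- ?e2*g^6, b, ?e3*\<alpha>, ?e1, - 1/g]" ..
    note * = B5_deflated[OF \<alpha> D t[unfolded this fs]]
    have "g^6 = g*(\<alpha>*(p*q*r*s))" unfolding d5(5) by (simp add: eval_nat_numeral)
    then have "p'*q'*r'*s' = ?e4" using *(4) \<alpha> d5(3,4) by (simp add: field_simps)
    moreover have "p'*q'+p'*r'+p'*s'+q'*r'+q'*s'+r'*s' = ?e2"
      using *(1) D unfolding mult_cancel_right neg_equal_iff_equal by metis
    moreover have "p'*q'*r'+p'*q'*s'+p'*r'*s'+q'*r'*s' = ?e3" using *(2) \<alpha> by simp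
    ultimately show ?thesis using *(3) by (simp add: fs d5 algebra_simps)
  qed
  then show ?thesis by (simp add: cp)
qed

lemma NB_collapses:
  assumes "mset es = mset fs" "u \<in> carrier_vec d"
  shows "\<exists>t. lin_prod fs NB *\<^sub>v u = t \<cdot>\<^sub>v unit_vec d 1"
proof -
  have "char_poly NB = (\<Prod>e\<leftarrow>\<alpha> # fs. [:-e, 1:])"
    unfolding char_poly_NB using assms(1) by (intro linear_factors_mset_cong) simp
  then show ?thesis by (rule deflation[OF B _ _ unit_vec_nonzero NB_unit_vec assms(2)]) (use d in simp_all)
qed

lemma Q_identity:
  assumes perm: "mset es = mset (\<mu> # ks)"
  shows "lin_prod (\<mu> # ks) NB *\<^sub>v (NX *\<^sub>v (lin_prod (\<alpha> # ks) NB *\<^sub>v unit_vec d 0))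
    = (Q_value d g \<alpha> \<mu> ks * \<alpha>) \<cdot>\<^sub>v unit_vec d 1"
proof -
  have e: "esym es = esym (\<mu> # ks)" by (rule esym_mset_cong[OF perm])
  have nz: "\<mu> \<noteq> 0" "0 \<notin> set ks" using es mset_eq_setD[OF perm] by auto
  have ln: "length (\<mu> # ks) = d - 1" using len mset_eq_length[OF perm] by simp
  have pr: "prod_list es = prod_list (\<mu> # ks)" using perm by (metis prod_mset_prod_list)
  note coll = NB_collapses[OF perm]
  from d ln show ?thesis
  proof (cases rule: length_minus_one_cases)
    case (d2 p)
    then show ?thesis
      using Q2_identity[OF \<alpha> nz(1), of g] by (simp add: nf_X_def nf_Y_def nf_delta_def e esym_simps)
  next
    case (d3 p q)
    then show ?thesis
      using Q3_identity[OF \<alpha> nz(1), of q g] nz by (simp add: nf_X_def nf_Y_def nf_delta_def e esym_simps)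
  next
    case (d4 p q r)
    have g: "\<alpha>*\<mu>*q*r = g^2" using g4 d4 pr by (simp add: mult.assoc)
    have "g \<noteq> 0" using g \<alpha> nz d4 by auto
    have eq: "esym es (Suc 0) = q+r+\<mu>" "esym es 2 = q*r+\<mu>*q+\<mu>*r" using d4 by (simp_all add: e esym_simps)
    have NBe: "NB = braid_mat (- (g^3)) (X4 \<alpha> g) (Y4 \<alpha> (q+r+\<mu>) (q*r+\<mu>*q+\<mu>*r) g)"
      by (simp add: nf_X_def nf_Y_def nf_delta_def d4 eq)
    have "\<exists>t. lin_prod [\<mu>,q,r] (braid_mat (- (g^3)) (X4 \<alpha> g) (Y4 \<alpha> (q+r+\<mu>) (q*r+\<mu>*q+\<mu>*r) g)) *\<^sub>v u = t \<cdot>\<^sub>v cvec [0,1,0,0]"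
      if "u \<in> carrier_vec 4" for u
      using coll[of u] that d4 unfolding NBe by simp
    from Q4_identity[OF \<alpha> nz(1) \<open>g \<noteq> 0\<close> g this] show ?thesis
      using d4 unfolding NBe by (simp add: nf_X_def)
  next
    case (d5 p q r s)
    have g: "\<alpha>*(\<mu>*(q*r*s)) = g^5" using g5 d5 pr by (simp add: mult.assoc)
    have "g \<noteq> 0" using g \<alpha> nz d5 by auto
    have eq: "esym es (Suc 0) = q+r+s+\<mu>" "esym es 2 = q*r+q*s+r*s+\<mu>*(q+r+s)"
      "esym es 3 = q*r*s+\<mu>*(q*r+q*s+r*s)" "esym es 4 = \<mu>*(q*r*s)"
      using d5 by (simp_all add: e esym_simps algebra_simps)
    have NBe: "NB = braid_mat (g^6) (X5 \<alpha> (q+r+s+\<mu>) (q*r+q*s+r*s+\<mu>*(q+r+s)) (q*r*s+\<mu>*(q*r+q*s+r*s)) (\<mu>*(q*r*s)) g)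
        (Y5 \<alpha> (q+r+s+\<mu>) (q*r*s+\<mu>*(q*r+q*s+r*s)) g)"
      by (simp add: nf_X_def nf_Y_def nf_delta_def d5 eq)
    have "\<exists>t. lin_prod [\<mu>,q,r,s] (braid_mat (g^6) (X5 \<alpha> (q+r+s+\<mu>) (q*r+q*s+r*s+\<mu>*(q+r+s)) (q*r*s+\<mu>*(q*r+q*s+r*s)) (\<mu>*(q*r*s)) g)
        (Y5 \<alpha> (q+r+s+\<mu>) (q*r*s+\<mu>*(q*r+q*s+r*s)) g)) *\<^sub>v u = t \<cdot>\<^sub>v cvec [0,1,0,0,0]"
      if "u \<in> carrier_vec 5" for u
      using coll[of u] that d5 unfolding NBe by simp
    from Q5_identity[OF \<alpha> nz(1) \<open>g \<noteq> 0\<close> g this] show ?thesis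
      using d5 unfolding NBe by (simp add: nf_X_def eq)
  qed
qed

text \<open>Together with deflation this shows that \<open>d - 1\<close> is the least degree of a polynomial in \<open>NB\<close> whose image
  lies in the eigenline of \<open>\<alpha>\<close>; an explicit basis vector is the witness.\<close>

lemma nonderogatory:
  assumes fs: "length fs = d - 2"
  shows "\<exists>u\<in>carrier_vec d. \<forall>t. lin_prod fs NB *\<^sub>v u \<noteq> t \<cdot>\<^sub>v unit_vec d 1"
proof (cases rule: cases_d)
  case (d2 p)
  then have "lin_prod fs NB *\<^sub>v cvec [1,0] = cvec [1,0]" using fs lin_prod_Nil_vec[OF B] by simp
  then show ?thesis using d2 by (intro bexI[of _ "cvec [1,0]"]) simp_all
next
  case (d3 p q)
  then obtain a where f: "fs = [a]" using fs by (auto simp: numeral_eq_Suc length_Suc_conv)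
  have "NB = B3mat \<alpha> ((\<alpha>*(p*q))^2) [p+q, (p+q)/(p*q), - 1/(\<alpha>*(p*q))]"
    using nf3_pair(2)[OF \<alpha>, of "p*q"] d3 by (simp add: nf_X_def nf_Y_def nf_delta_def esym_simps)
  then show ?thesis using d3 \<alpha> by (intro bexI[of _ "cvec [0,0,1]"]) (auto simp: f B3mat_def)
next
  case (d4 p q r)
  then obtain a b where f: "fs = [a,b]" using fs by (auto simp: numeral_eq_Suc length_Suc_conv)
  have "\<exists>b0 b1 b2 b3. NB = B4 \<alpha> (- (g^3)) [b0,b1,b2,b3]"
    using nf4_pair(2)[OF \<alpha> d4(4,5)] d4 by (auto simp: nf_X_def nf_Y_def nf_delta_def esym_simps)
  then obtain b0 b1 b2 b3 where "NB = B4 \<alpha> (- (g^3)) [b0,b1,b2,b3]" by blast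
  then show ?thesis using d4 \<alpha> by (intro bexI[of _ "cvec [0,0,1,0]"]) (auto simp: f B4_def)
next
  case (d5 p q r s)
  then obtain a b c where f: "fs = [a,b,c]" using fs by (auto simp: numeral_eq_Suc length_Suc_conv)
  have "\<exists>b0 b1 b2 b3 b4. NB = B5 \<alpha> (g^6) [b0,b1,b2,b3,b4]"
    using nf5_pair(2)[OF \<alpha> d5(4,5)] d5 by (simp add: nf_X_def nf_Y_def nf_delta_def esym_simps) blast
  then obtain b0 b1 b2 b3 b4 where "NB = B5 \<alpha> (g^6) [b0,b1,b2,b3,b4]" by blast
  then show ?thesis using d5 \<alpha> by (intro bexI[of _ "cvec [0,0,0,0,1]"]) (auto simp: f B5_def)
qed

end

section \<open>Classification of irreducible pairs\<close>

lemma zero_mult_vec [simp]: "u \<in> carrier_vec m \<Longrightarrow> 0\<^sub>m n m *\<^sub>v u = (0\<^sub>v n :: 'k::field vec)"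
  by (intro eq_vecI) auto

lemma vec_diff_eq_zero:
  fixes v w :: "'k::field vec"
  assumes "v - w = 0\<^sub>v d" "v \<in> carrier_vec d" "w \<in> carrier_vec d"
  shows "v = w"
proof (rule eq_vecI)
  fix i assume "i < dim_vec w"
  then have "(v - w) $ i = v $ i - w $ i" "i < d" using assms(3) by auto
  then show "v $ i = w $ i" using assms(1) by simp
qed (use assms in auto)

lemma smult_vec_eq_zero:
  fixes v :: "'k::field vec"
  assumes "c \<cdot>\<^sub>v v = 0\<^sub>v d" "v \<in> carrier_vec d" "v \<noteq> 0\<^sub>v d"
  shows "c = 0"
proof (rule ccontr)
  assume "c \<noteq> 0"
  then have "v = inverse c \<cdot>\<^sub>v (c \<cdot>\<^sub>v v)" by (simp add: smult_smult_assoc)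
  with assms show False by simp
qed

subsection \<open>Every irreducible pair has a normal form\<close>

lemma (in twist_pair) eigenvalue_nonzero:
  assumes "poly (char_poly B) e = 0"
  shows "e \<noteq> 0"
proof
  assume "e = 0"
  then obtain y where y: "y \<in> carrier_vec d" "y \<noteq> 0\<^sub>v d" "B *\<^sub>v y = 0 \<cdot>\<^sub>v y"
    using assms eigenvalue_root_char_poly[OF B, of e] carrier_matD[OF B]
    unfolding eigenvalue_def eigenvector_def by auto
  then have "inverse \<delta> \<cdot>\<^sub>v (X *\<^sub>v (Y *\<^sub>v (Y *\<^sub>v y))) = 0 \<cdot>\<^sub>v y" using B_vec by simp
  then have "\<delta> \<cdot>\<^sub>v (inverse \<delta> \<cdot>\<^sub>v (X *\<^sub>v (Y *\<^sub>v (Y *\<^sub>v y)))) = 0\<^sub>v d"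
    using y(1) by (simp add: vec_rearrange(5))
  then have "X *\<^sub>v (Y *\<^sub>v (Y *\<^sub>v y)) = 0\<^sub>v d" by (simp add: smult_smult_assoc)
  then have "Y *\<^sub>v (X *\<^sub>v (X *\<^sub>v (Y *\<^sub>v (Y *\<^sub>v y)))) = 0\<^sub>v d" by (simp add: mult_zero_vec_right[of _ d d])
  then have "(inverse \<delta> * inverse \<delta>) \<cdot>\<^sub>v (\<delta> \<cdot>\<^sub>v (\<delta> \<cdot>\<^sub>v y)) = 0\<^sub>v d" using y(1) by simp
  moreover have "inverse \<delta> * inverse \<delta> * (\<delta> * \<delta>) = 1" by (simp add: field_simps)
  ultimately show False using y by (simp add: smult_smult_assoc)
qed

text \<open>Since \<open>B = X Y\<^sup>-\<^sup>1\<close>, the vector \<open>z = Y\<^sup>-\<^sup>1 y\<close> starts an orbit as soon as \<open>y\<close> is an eigenvector.\<close>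

lemma (in twist_pair) pull_back_eigenvector:
  assumes y: "y \<in> carrier_vec d" "B *\<^sub>v y = \<mu> \<cdot>\<^sub>v y"
  defines "z \<equiv> inverse \<delta> \<cdot>\<^sub>v (Y *\<^sub>v (Y *\<^sub>v y))"
  shows "z \<in> carrier_vec d" "Y *\<^sub>v z = y" "X *\<^sub>v z = \<mu> \<cdot>\<^sub>v (Y *\<^sub>v z)"
proof -
  show z: "z \<in> carrier_vec d" and Yz: "Y *\<^sub>v z = y" using y(1) by (simp_all add: z_def smult_smult_assoc)
  show "X *\<^sub>v z = \<mu> \<cdot>\<^sub>v (Y *\<^sub>v z)" using BY[OF z] Yz y(2) by simp
qed

lemma poly_linear_factors: "poly (\<Prod>e\<leftarrow>es. [:-e, 1:]) x = 0 \<longleftrightarrow> x \<in> set (es :: 'k::field list)"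
  by (induction es) (auto simp: algebra_simps simp del: mult_pCons_left)

text \<open>With the determinant \<open>D\<close>, this is \<open>g = \<gamma>\<^sup>2 = - \<delta> / D\<close> in dimension four and \<open>g = \<gamma> = \<delta> / D\<close> in dimension
  five.\<close>

definition root_condition :: "nat \<Rightarrow> 'k::field \<Rightarrow> 'k \<Rightarrow> 'k \<Rightarrow> bool" where
  "root_condition d g D \<delta> \<longleftrightarrow> (d = 4 \<longrightarrow> g * D = - \<delta>) \<and> (d = 5 \<longrightarrow> g * D = \<delta>)"

text \<open>The uniqueness half of the classification: the right-hand sides mention nothing but the eigenvalues and the
  associated root. The matrix \<open>P\<close> has the orbit of \<open>v\<close> as its columns.\<close>

lemma normal_form_exists:
  fixes X Y :: "'k::alg_closed_field mat"
  assumes irr: "irreducible_twist_pair d X Y \<delta>" and d: "2 \<le> d" "d \<le> 5"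
    and cp: "char_poly (braid_mat \<delta> X Y) = (\<Prod>e\<leftarrow>\<alpha> # es. [:-e, 1:])"
    and g: "root_condition d g (\<alpha> * prod_list es) \<delta>"
    and v: "v \<in> carrier_vec d" "v \<noteq> 0\<^sub>v d" "X *\<^sub>v v = \<alpha> \<cdot>\<^sub>v (Y *\<^sub>v v)"
  shows "normal_form d \<alpha> es g" "\<delta> = nf_delta d \<alpha> es g"
    "\<exists>P Q. base_change d P Q \<and> X * P = P * nf_X d \<alpha> es g \<and> Y * P = P * nf_Y d \<alpha> es g \<and> P *\<^sub>v unit_vec d 0 = v"
proof -
  interpret irreducible_twist_pair d X Y \<delta> by (rule irr)
  have len: "length es = d - 1"
    using degree_monic_char_poly[OF B] degree_linear_factors[of uminus "\<alpha> # es"] unfolding cp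
    by (simp del: mult_pCons_left)
  have nz: "\<alpha> \<noteq> 0" "0 \<notin> set es"
  proof -
    have "poly (char_poly B) e = 0" if "e \<in> set (\<alpha> # es)" for e
      unfolding cp poly_linear_factors using that .
    then show "\<alpha> \<noteq> 0" "0 \<notin> set es" using eigenvalue_nonzero[of \<alpha>] eigenvalue_nonzero[of 0] by auto
  qed
  obtain P Q where PQ: "P \<in> carrier_mat d d" "Q \<in> carrier_mat d d" "P * Q = 1\<^sub>m d" "Q * P = 1\<^sub>m d"
    and Pj: "\<And>j. j < d \<Longrightarrow> P *\<^sub>v unit_vec d j = orbit X Y v ! j"
    using orbit_basis[OF v nz(1) d(2)] by metis
  interpret twist_pair_base_change d X Y \<delta> P Q by unfold_locales (rule PQ)+
  let ?X = "Q * X * P" and ?Y = "Q * Y * P"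
  have P0: "P *\<^sub>v unit_vec d 0 = v" using Pj[of 0] d by simp
  have Q0: "Q *\<^sub>v v = unit_vec d 0" using QPV[of "unit_vec d 0"] unfolding P0 by simp
  have conj: "?X *\<^sub>v (Q *\<^sub>v u) = Q *\<^sub>v (X *\<^sub>v u)" "?Y *\<^sub>v (Q *\<^sub>v u) = Q *\<^sub>v (Y *\<^sub>v u)"
    if "u \<in> carrier_vec d" for u
    using that conjugate(3)[OF X, of "Q *\<^sub>v u"] conjugate(3)[OF Y, of "Q *\<^sub>v u"] by simp_all
  have orb: "orbit ?X ?Y (unit_vec d 0) ! j = unit_vec d j" if "j < d" for j
  proof -
    have "j < 5" using that d by simp
    then have "orbit ?X ?Y (Q *\<^sub>v v) ! j = Q *\<^sub>v (orbit X Y v ! j)"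
      using v(1) by (auto simp: less_numeral_cases conj)
    then show ?thesis using Pj[OF that] QPV[of "unit_vec d j"] by (simp add: Q0)
  qed
  have eig: "?X *\<^sub>v unit_vec d 0 = \<alpha> \<cdot>\<^sub>v (?Y *\<^sub>v unit_vec d 0)"
    unfolding Q0[symmetric] using v by (simp add: conj)
  have cp': "char_poly (braid_mat \<delta> ?X ?Y) = (\<Prod>e\<leftarrow>\<alpha> # es. [:-e, 1:])"
    unfolding conjugate_braid_mat conjugate(4)[OF B] by (rule cp)
  have shape: "\<delta> = nf_delta d \<alpha> es g \<and> ?X = nf_X d \<alpha> es g \<and> ?Y = nf_Y d \<alpha> es g"
    by (rule nf_shape[OF d len conjugate_pair nz(1) orb eig cp']) (use g in \<open>simp_all add: root_condition_def\<close>)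
  then show D: "\<delta> = nf_delta d \<alpha> es g" by blast
  show "normal_form d \<alpha> es g"
  proof
    show "g^2 = \<alpha> * prod_list es" if "d = 4"
    proof -
      have "g * (\<alpha> * prod_list es) = g * g^2" using g D that by (simp add: root_condition_def nf_delta_def eval_nat_numeral)
      moreover have "g \<noteq> 0" using \<delta> D that by (auto simp: nf_delta_def)
      ultimately show ?thesis by simp
    qed
    show "g^5 = \<alpha> * prod_list es" if "d = 5"
    proof -
      have "g * (\<alpha> * prod_list es) = g * g^5" using g D that by (simp add: root_condition_def nf_delta_def eval_nat_numeral)
      moreover have "g \<noteq> 0" using \<delta> D that by (auto simp: nf_delta_def)
      ultimately show ?thesis by simp
    qed
  qed (use d len nz in auto)
  have "base_change d P Q" by unfold_locales
  then show "\<exists>P Q. base_change d P Q \<and> X * P = P * nf_X d \<alpha> es g \<and> Y * P = P * nf_Y d \<alpha> es g \<and> P *\<^sub>v unit_vec d 0 = v"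
    using conjugate(2)[OF X] conjugate(2)[OF Y] shape P0 by metis
qed

lemma intertwined_braid_mat:
  fixes X Y :: "'k::field mat"
  assumes "twist_pair d X Y \<delta>" "twist_pair d X' Y' \<delta>" and P: "P \<in> carrier_mat d d"
    and XP: "X * P = P * X'" and YP: "Y * P = P * Y'"
  shows "braid_mat \<delta> X Y * P = P * braid_mat \<delta> X' Y'"
proof (rule eq_mat_on_vecI[of _ d d])
  interpret a: twist_pair d X Y \<delta> by fact
  interpret b: twist_pair d X' Y' \<delta> by fact
  have PV [simp]: "P *\<^sub>v u \<in> carrier_vec d" if "u \<in> carrier_vec d" for u
    using that P by (rule mult_mat_vec_carrier[rotated])
  have X: "X *\<^sub>v (P *\<^sub>v u) = P *\<^sub>v (X' *\<^sub>v u)" and Y: "Y *\<^sub>v (P *\<^sub>v u) = P *\<^sub>v (Y' *\<^sub>v u)"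
    if "u \<in> carrier_vec d" for u
    using XP YP assoc_mult_mat_vec[OF a.X P that] assoc_mult_mat_vec[OF P b.X that]
      assoc_mult_mat_vec[OF a.Y P that] assoc_mult_mat_vec[OF P b.Y that] by simp_all
  fix u :: "'k vec" assume u: "u \<in> carrier_vec d"
  show "a.B * P *\<^sub>v u = P * b.B *\<^sub>v u"
    using u by (simp add: assoc_mult_mat_vec[OF a.B P u] assoc_mult_mat_vec[OF P b.B u] a.B_vec b.B_vec X Y
        mult_mat_vec[OF P])
qed (use assms in \<open>auto intro!: mult_carrier_mat[of _ d d] twist_pair.B\<close>)

text \<open>Two eigenvectors for \<open>\<alpha>\<close> give two bases, in which \<open>X\<close> and \<open>Y\<close> have the same normal form. The matrix that
  maps one basis to the other thus commutes with \<open>X\<close> and \<open>Y\<close>, and is a scalar by Schur's lemma.\<close>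

lemma eigenvector_unique:
  fixes X Y :: "'k::alg_closed_field mat"
  assumes irr: "irreducible_twist_pair d X Y \<delta>" and d: "2 \<le> d" "d \<le> 5"
    and cp: "char_poly (braid_mat \<delta> X Y) = (\<Prod>e\<leftarrow>\<alpha> # es. [:-e, 1:])"
    and g: "root_condition d g (\<alpha> * prod_list es) \<delta>"
    and v: "v \<in> carrier_vec d" "v \<noteq> 0\<^sub>v d" "X *\<^sub>v v = \<alpha> \<cdot>\<^sub>v (Y *\<^sub>v v)"
    and y: "y \<in> carrier_vec d" "braid_mat \<delta> X Y *\<^sub>v y = \<alpha> \<cdot>\<^sub>v y"
  shows "\<exists>t. y = t \<cdot>\<^sub>v (Y *\<^sub>v v)"
proof (cases "y = 0\<^sub>v d")
  interpret irreducible_twist_pair d X Y \<delta> by (rule irr)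
  case True
  then show ?thesis using vec_rearrange(5)[OF YV[OF v(1)]] by (intro exI[of _ 0]) simp
next
  case False
  interpret irreducible_twist_pair d X Y \<delta> by (rule irr)
  define z where "z = inverse \<delta> \<cdot>\<^sub>v (Y *\<^sub>v (Y *\<^sub>v y))"
  note z = pull_back_eigenvector[OF y, folded z_def]
  have z0: "z \<noteq> 0\<^sub>v d" using z(2) False mult_zero_vec_right[OF Y] by auto
  obtain P Q where P: "base_change d P Q" and XP: "X * P = P * nf_X d \<alpha> es g" and YP: "Y * P = P * nf_Y d \<alpha> es g"
    and P0: "P *\<^sub>v unit_vec d 0 = v"
    using normal_form_exists(3)[OF irr d cp g v] by blast
  obtain P' Q' where P': "base_change d P' Q'" and XP': "X * P' = P' * nf_X d \<alpha> es g" and YP': "Y * P' = P' * nf_Y d \<alpha> es g"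
    and P0': "P' *\<^sub>v unit_vec d 0 = z"
    using normal_form_exists(3)[OF irr d cp g z(1) z0 z(3)] by blast
  interpret P: base_change d P Q by (rule P)
  interpret P': base_change d P' Q' by (rule P')
  let ?R = "P' * Q"
  have R: "?R \<in> carrier_mat d d" by (rule mult_carrier_mat[OF P'.P P.Q])
  have comm: "?R * M = M * ?R"
    if M: "M \<in> carrier_mat d d" and N: "N \<in> carrier_mat d d" and "M * P = P * N" "M * P' = P' * N" for M N
  proof -
    have QM: "Q * M = N * Q"
    proof -
      have "Q * M * P * Q = N * Q" using P.intertwined_eq[OF M N that(3)] by simp
      moreover have "Q * M * P * Q = Q * M * (P * Q)" by (rule assoc_mult_mat[OF mult_carrier_mat[OF P.Q M] P.P P.Q])
      ultimately show ?thesis using P.PQ right_mult_one_mat[OF mult_carrier_mat[OF P.Q M]] by simp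
    qed
    have "?R * M = P' * (Q * M)" by (rule assoc_mult_mat[OF P'.P P.Q M])
    also have "\<dots> = P' * N * Q" unfolding QM by (rule assoc_mult_mat[symmetric, OF P'.P N P.Q])
    also have "\<dots> = M * P' * Q" using that(4) by simp
    also have "\<dots> = M * ?R" by (rule assoc_mult_mat[OF M P'.P P.Q])
    finally show ?thesis .
  qed
  interpret N: normal_form d \<alpha> es g by (rule normal_form_exists(1)[OF irr d cp g v])
  have "d \<noteq> 0" using d by simp
  from schur[OF irreducible X Y R comm[OF X N.X XP XP'] comm[OF Y N.Y YP YP'] this]
  obtain \<theta> where \<theta>: "\<And>w. w \<in> carrier_vec d \<Longrightarrow> ?R *\<^sub>v w = \<theta> \<cdot>\<^sub>v w" by blast
  have "?R *\<^sub>v v = z"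
    using P.QPV[of "unit_vec d 0"] v(1) unfolding P0 by (simp add: assoc_mult_mat_vec[OF P'.P P.Q] P0')
  then have "z = \<theta> \<cdot>\<^sub>v v" using \<theta>[OF v(1)] by simp
  then have "y = \<theta> \<cdot>\<^sub>v (Y *\<^sub>v v)" using z(2) v(1) by simp
  then show ?thesis by blast
qed

subsection \<open>Irreducibility forces the polynomials to be nonzero\<close>

text \<open>If the product were zero, then all vectors in the image of the product over \<open>fs\<close> would be eigenvectors for
  \<open>\<alpha>\<close>. These form a line, which contradicts the explicit witness in the normal form.\<close>

lemma not_annihilated:
  fixes X Y :: "'k::alg_closed_field mat"
  assumes irr: "irreducible_twist_pair d X Y \<delta>" and d: "2 \<le> d" "d \<le> 5"
    and cp: "char_poly (braid_mat \<delta> X Y) = (\<Prod>e\<leftarrow>\<alpha> # es. [:-e, 1:])"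
    and g: "root_condition d g (\<alpha> * prod_list es) \<delta>"
    and fs: "length fs = d - 2"
  shows "lin_prod (\<alpha> # fs) (braid_mat \<delta> X Y) \<noteq> 0\<^sub>m d d"
proof
  interpret irreducible_twist_pair d X Y \<delta> by (rule irr)
  assume 0: "lin_prod (\<alpha> # fs) B = 0\<^sub>m d d"
  have "poly (char_poly B) \<alpha> = 0" unfolding cp poly_linear_factors by simp
  then obtain y where y: "y \<in> carrier_vec d" "y \<noteq> 0\<^sub>v d" "B *\<^sub>v y = \<alpha> \<cdot>\<^sub>v y"
    using eigenvalue_root_char_poly[OF B, of \<alpha>] carrier_matD[OF B]
    unfolding eigenvalue_def eigenvector_def by auto
  define v where "v = inverse \<delta> \<cdot>\<^sub>v (Y *\<^sub>v (Y *\<^sub>v y))"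
  note v = pull_back_eigenvector[OF y(1,3), folded v_def]
  have v0: "v \<noteq> 0\<^sub>v d" using v(2) y(2) mult_zero_vec_right[OF Y] by auto
  obtain P Q where PQ: "base_change d P Q" and XP: "X * P = P * nf_X d \<alpha> es g" and YP: "Y * P = P * nf_Y d \<alpha> es g"
    and P0: "P *\<^sub>v unit_vec d 0 = v"
    using normal_form_exists(3)[OF irr d cp g v(1) v0 v(3)] by blast
  have D: "\<delta> = nf_delta d \<alpha> es g" by (rule normal_form_exists(2)[OF irr d cp g v(1) v0 v(3)])
  interpret P: base_change d P Q by (rule PQ)
  interpret N: normal_form d \<alpha> es g by (rule normal_form_exists(1)[OF irr d cp g v(1) v0 v(3)])
  have BP: "B * P = P * N.NB"
    unfolding D by (rule intertwined_braid_mat[OF _ _ P.P XP YP]) (use twist_pair_axioms N.twist_pair_axioms D in auto)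
  obtain u where u: "u \<in> carrier_vec d" and ne: "\<And>t. lin_prod fs N.NB *\<^sub>v u \<noteq> t \<cdot>\<^sub>v unit_vec d 1"
    using N.nonderogatory[OF fs] by blast
  let ?w = "lin_prod fs B *\<^sub>v (P *\<^sub>v u)"
  have w: "?w \<in> carrier_vec d" by (rule lin_prod_vec_carrier[OF B P.PV[OF u]])
  have "B *\<^sub>v ?w - \<alpha> \<cdot>\<^sub>v ?w = 0\<^sub>v d"
    using lin_prod_Cons_vec[OF B P.PV[OF u], of \<alpha> fs] P.PV[OF u] by (simp add: 0)
  then have "B *\<^sub>v ?w = \<alpha> \<cdot>\<^sub>v ?w"
    by (rule vec_diff_eq_zero) (simp_all only: BV[OF w] w smult_carrier_vec)
  from eigenvector_unique[OF irr d cp g v(1) v0 v(3) w this] obtain t where "?w = t \<cdot>\<^sub>v y"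
    unfolding v(2) by blast
  moreover have "P *\<^sub>v unit_vec d 1 = y"
    using arg_cong[OF YP, of "\<lambda>M. M *\<^sub>v unit_vec d 0"] v(2)
    by (simp add: assoc_mult_mat_vec[OF Y P.P] assoc_mult_mat_vec[OF P.P N.Y] P0 N.NY_unit_vec)
  moreover have "?w = P *\<^sub>v (lin_prod fs N.NB *\<^sub>v u)"
    using lin_prod_intertwine[OF B N.B P.P BP, of fs] assoc_mult_mat_vec[OF lin_prod_carrier[OF B] P.P u, of fs]
      assoc_mult_mat_vec[OF P.P lin_prod_carrier[OF N.B] u, of fs] by simp
  ultimately have "P *\<^sub>v (lin_prod fs N.NB *\<^sub>v u) = P *\<^sub>v (t \<cdot>\<^sub>v unit_vec d 1)" by simp
  then have "Q *\<^sub>v (P *\<^sub>v (lin_prod fs N.NB *\<^sub>v u)) = Q *\<^sub>v (P *\<^sub>v (t \<cdot>\<^sub>v unit_vec d 1))" by simp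
  then have "lin_prod fs N.NB *\<^sub>v u = t \<cdot>\<^sub>v unit_vec d 1"
    using lin_prod_vec_carrier[OF N.B u, of fs] by (subst (asm) (1 2) P.QPV) auto
  with ne show False by blast
qed

text \<open>Suppose that \<open>Q = 0\<close>. Then \<open>F = C X D\<close> kills \<open>v\<close> by the identity for \<open>Q\<close>, and \<open>Y v\<close> because \<open>D\<close> has the
  factor \<open>B - \<alpha>\<close>; hence \<open>F = 0\<close>. Since \<open>D \<noteq> 0\<close>, its image contains an eigenvector \<open>x = Y z\<close> for \<open>\<mu>\<close>, and
  \<open>C X x = 0\<close>. Now \<open>C\<close> kills \<open>z\<close>, a multiple of \<open>X x\<close>, and \<open>Y z\<close>, so \<open>C = 0\<close> by the same argument with
  the roles of \<open>\<alpha>\<close> and \<open>\<mu>\<close> exchanged. Applied to an eigenvector for \<open>\<alpha>\<close>, this shows that \<open>\<alpha>\<close> is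
  also a root of \<open>C\<close>, and then \<open>C \<noteq> 0\<close> for the same reason as \<open>D \<noteq> 0\<close>.\<close>

lemma Q_value_nonzero:
  fixes X Y :: "'k::alg_closed_field mat"
  assumes irr: "irreducible_twist_pair d X Y \<delta>" and d: "2 \<le> d" "d \<le> 5"
    and cp: "char_poly (braid_mat \<delta> X Y) = (\<Prod>e\<leftarrow>\<alpha> # \<mu> # ks. [:-e, 1:])"
    and g: "root_condition d g (\<alpha> * prod_list (\<mu> # ks)) \<delta>"
  shows "Q_value d g \<alpha> \<mu> ks \<noteq> 0"
proof
  assume Q0: "Q_value d g \<alpha> \<mu> ks = 0"
  interpret irreducible_twist_pair d X Y \<delta> by (rule irr)
  have "poly (char_poly B) \<alpha> = 0" unfolding cp poly_linear_factors by simp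
  then obtain y where y: "y \<in> carrier_vec d" "y \<noteq> 0\<^sub>v d" "B *\<^sub>v y = \<alpha> \<cdot>\<^sub>v y"
    using eigenvalue_root_char_poly[OF B, of \<alpha>] carrier_matD[OF B]
    unfolding eigenvalue_def eigenvector_def by auto
  define v where "v = inverse \<delta> \<cdot>\<^sub>v (Y *\<^sub>v (Y *\<^sub>v y))"
  note v = pull_back_eigenvector[OF y(1,3), folded v_def]
  have v0: "v \<noteq> 0\<^sub>v d" using v(2) y(2) mult_zero_vec_right[OF Y] by auto
  let ?es = "\<mu> # ks"
  obtain P Q where PQ: "base_change d P Q" and XP: "X * P = P * nf_X d \<alpha> ?es g" and YP: "Y * P = P * nf_Y d \<alpha> ?es g"
    and P0: "P *\<^sub>v unit_vec d 0 = v"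
    using normal_form_exists(3)[OF irr d cp g v(1) v0 v(3)] by blast
  have D: "\<delta> = nf_delta d \<alpha> ?es g" by (rule normal_form_exists(2)[OF irr d cp g v(1) v0 v(3)])
  interpret P: base_change d P Q by (rule PQ)
  interpret N: normal_form d \<alpha> ?es g by (rule normal_form_exists(1)[OF irr d cp g v(1) v0 v(3)])
  have BP: "B * P = P * N.NB"
    unfolding D by (rule intertwined_braid_mat[OF _ _ P.P XP YP]) (use twist_pair_axioms N.twist_pair_axioms D in auto)
  have lp: "lin_prod fs B *\<^sub>v (P *\<^sub>v u) = P *\<^sub>v (lin_prod fs N.NB *\<^sub>v u)" if u: "u \<in> carrier_vec d" for u fs
    using lin_prod_intertwine[OF B N.B P.P BP, of fs] assoc_mult_mat_vec[OF lin_prod_carrier[OF B] P.P u, of fs]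
      assoc_mult_mat_vec[OF P.P lin_prod_carrier[OF N.B] u, of fs] by simp
  have Xp: "X *\<^sub>v (P *\<^sub>v u) = P *\<^sub>v (N.NX *\<^sub>v u)" if u: "u \<in> carrier_vec d" for u
    using XP assoc_mult_mat_vec[OF X P.P u] assoc_mult_mat_vec[OF P.P N.X u] by simp
  define C D' where "C = lin_prod ?es B" and "D' = lin_prod (\<alpha> # ks) B"
  have C: "C \<in> carrier_mat d d" and D': "D' \<in> carrier_mat d d"
    unfolding C_def D'_def by (rule lin_prod_carrier[OF B])+
  have [simp]: "C *\<^sub>v u \<in> carrier_vec d" "D' *\<^sub>v u \<in> carrier_vec d" if "u \<in> carrier_vec d" for u
    using that C D' by (auto intro: mult_mat_vec_carrier)
  have lin: "lin_prod fs B *\<^sub>v (B *\<^sub>v u) = e \<cdot>\<^sub>v (lin_prod fs B *\<^sub>v u)"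
    if u: "u \<in> carrier_vec d" and m: "mset (e # fs) = mset (\<alpha> # ?es)" for u fs e
  proof -
    let ?w = "lin_prod fs B *\<^sub>v u"
    have w: "?w \<in> carrier_vec d" by (rule lin_prod_vec_carrier[OF B u])
    have "lin_prod (e # fs) B = 0\<^sub>m d d"
      unfolding lin_prod_mset_eq[OF B m] by (rule lin_prod_char_poly[OF B cp]) simp
    then have "B *\<^sub>v ?w - e \<cdot>\<^sub>v ?w = 0\<^sub>v d" using lin_prod_Cons_vec[OF B u, of e fs] u by simp
    then have "B *\<^sub>v ?w = e \<cdot>\<^sub>v ?w"
      by (rule vec_diff_eq_zero) (simp_all only: BV[OF w] w smult_carrier_vec)
    moreover have "lin_prod fs B *\<^sub>v (B *\<^sub>v u) = B *\<^sub>v ?w"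
      using lin_prod_commute[OF B, of fs] assoc_mult_mat_vec[OF lin_prod_carrier[OF B] B u, of fs]
        assoc_mult_mat_vec[OF B lin_prod_carrier[OF B] u, of fs] by simp
    ultimately show ?thesis by simp
  qed
  have CB: "C *\<^sub>v (B *\<^sub>v u) = \<alpha> \<cdot>\<^sub>v (C *\<^sub>v u)" if "u \<in> carrier_vec d" for u
    unfolding C_def by (rule lin[OF that]) simp
  have DB: "D' *\<^sub>v (B *\<^sub>v u) = \<mu> \<cdot>\<^sub>v (D' *\<^sub>v u)" if "u \<in> carrier_vec d" for u
    unfolding D'_def by (rule lin[OF that]) simp
  have \<alpha>\<mu>: "\<alpha> \<noteq> 0" "\<mu> \<noteq> 0" using N.\<alpha> N.es by auto
  define F where "F = C * (X * D')"
  have F: "F \<in> carrier_mat d d" unfolding F_def using C D' by (intro mult_carrier_mat[of _ d d]) auto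
  have Fu: "F *\<^sub>v u = C *\<^sub>v (X *\<^sub>v (D' *\<^sub>v u))" if "u \<in> carrier_vec d" for u
    unfolding F_def by (simp add: assoc_mult_mat_vec[OF C mult_carrier_mat[OF X D'] that] assoc_mult_mat_vec[OF X D' that])
  have F0: "F = 0\<^sub>m d d"
  proof (rule annihilates_orbit[OF v(1) v0 v(3) \<alpha>\<mu>(1) d(2) F _ \<alpha>\<mu>(2)])
    show "F *\<^sub>v (B *\<^sub>v u) = \<mu> \<cdot>\<^sub>v (F *\<^sub>v u)" if "u \<in> carrier_vec d" for u
      using that by (simp add: Fu DB mult_mat_vec[OF C])
    have "F *\<^sub>v v = P *\<^sub>v (lin_prod ?es N.NB *\<^sub>v (N.NX *\<^sub>v (lin_prod (\<alpha> # ks) N.NB *\<^sub>v unit_vec d 0)))"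
      unfolding Fu[OF v(1)] unfolding P0[symmetric] C_def D'_def
      by (simp add: lp Xp lin_prod_vec_carrier[OF N.B])
    also have "\<dots> = 0\<^sub>v d"
      unfolding N.Q_identity[OF HOL.refl] Q0 by (simp add: vec_rearrange(5)[of _ d] mult_zero_vec_right[OF P.P])
    finally show "F *\<^sub>v v = 0\<^sub>v d" .
    have "D' *\<^sub>v y = 0\<^sub>v d"
      unfolding D'_def lin_prod_eigenvector[OF B y(1,3)] using y(1) by (simp add: vec_rearrange(5)[of _ d])
    then show "F *\<^sub>v (Y *\<^sub>v v) = 0\<^sub>v d"
      using y(1) by (simp add: v(2) Fu mult_zero_vec_right[OF X] mult_zero_vec_right[OF C])
  qed
  have len: "length ks = d - 2" using N.len by simp
  have "D' \<noteq> 0\<^sub>m d d" unfolding D'_def by (rule not_annihilated[OF irr d cp g len])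
  then obtain u where u: "u \<in> carrier_vec d" "D' *\<^sub>v u \<noteq> 0\<^sub>v d"
    using eq_mat_on_vecI[OF D' zero_carrier_mat] by auto
  define x where "x = D' *\<^sub>v u"
  have x: "x \<in> carrier_vec d" "x \<noteq> 0\<^sub>v d" using u by (simp_all add: x_def)
  have "D' *\<^sub>v (B *\<^sub>v u) = B *\<^sub>v x"
    unfolding x_def D'_def using lin_prod_commute[OF B, of "\<alpha> # ks"] assoc_mult_mat_vec[OF lin_prod_carrier[OF B] B u(1), of "\<alpha> # ks"]
        assoc_mult_mat_vec[OF B lin_prod_carrier[OF B] u(1), of "\<alpha> # ks"] by simp
  then have Bx: "B *\<^sub>v x = \<mu> \<cdot>\<^sub>v x" using DB[OF u(1)] by (simp add: x_def)
  define z where "z = inverse \<delta> \<cdot>\<^sub>v (Y *\<^sub>v (Y *\<^sub>v x))"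
  note z = pull_back_eigenvector[OF x(1) Bx, folded z_def]
  have z0: "z \<noteq> 0\<^sub>v d" using z(2) x(2) mult_zero_vec_right[OF Y] by auto
  have "C = 0\<^sub>m d d"
  proof (rule annihilates_orbit[OF z(1) z0 z(3) \<alpha>\<mu>(2) d(2) C _ \<alpha>\<mu>(1)])
    show "C *\<^sub>v (B *\<^sub>v u) = \<alpha> \<cdot>\<^sub>v (C *\<^sub>v u)" if "u \<in> carrier_vec d" for u by (rule CB[OF that])
    have "\<delta> \<cdot>\<^sub>v z = \<mu> \<cdot>\<^sub>v (X *\<^sub>v x)" using arg_cong[OF z(3), of "\<lambda>w. X *\<^sub>v w"] z(1) x(1) by (simp add: z(2))
    then have "C *\<^sub>v (\<delta> \<cdot>\<^sub>v z) = C *\<^sub>v (\<mu> \<cdot>\<^sub>v (X *\<^sub>v x))" by simp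
    moreover have "C *\<^sub>v (X *\<^sub>v x) = 0\<^sub>v d" using Fu[OF u(1)] F0 u(1) by (simp add: x_def)
    ultimately have "\<delta> \<cdot>\<^sub>v (C *\<^sub>v z) = 0\<^sub>v d" using z(1) x(1) by (simp add: mult_mat_vec[OF C])
    then have "inverse \<delta> \<cdot>\<^sub>v (\<delta> \<cdot>\<^sub>v (C *\<^sub>v z)) = 0\<^sub>v d" by simp
    then show "C *\<^sub>v z = 0\<^sub>v d" by (simp add: smult_smult_assoc)
    have "C *\<^sub>v x = 0\<^sub>v d"
      unfolding C_def lin_prod_eigenvector[OF B x(1) Bx] using x(1) by (simp add: vec_rearrange(5)[of _ d])
    then show "C *\<^sub>v (Y *\<^sub>v z) = 0\<^sub>v d" by (simp add: z(2))
  qed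
  have "C *\<^sub>v y = (\<Prod>e\<leftarrow>?es. \<alpha> - e) \<cdot>\<^sub>v y" unfolding C_def by (rule lin_prod_eigenvector[OF B y(1,3)])
  then have "(\<Prod>e\<leftarrow>?es. \<alpha> - e) \<cdot>\<^sub>v y = 0\<^sub>v d" using \<open>C = 0\<^sub>m d d\<close> y(1) by simp
  then have "(\<Prod>e\<leftarrow>?es. \<alpha> - e) = 0" using y(1,2) by (rule smult_vec_eq_zero)
  then have "\<alpha> \<in> set ?es" by (auto simp: prod_list_zero_iff)
  then obtain fs where fs: "mset ?es = mset (\<alpha> # fs)"
    by (metis insert_DiffM ex_mset mset.simps(2) set_mset_mset)
  then have "C = lin_prod (\<alpha> # fs) B" unfolding C_def by (rule lin_prod_mset_eq[OF B])
  moreover have "length fs = d - 2" using mset_eq_length[OF fs] len by simp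
  ultimately show False using not_annihilated[OF irr d cp g, of fs] \<open>C = 0\<^sub>m d d\<close> by simp
qed

subsection \<open>Nonzero polynomials force irreducibility\<close>

lemma carrier_vec_lin_span: "carrier_vec d \<subseteq> lin_span d (map (unit_vec d) [0..<d] :: 'k::field vec list)"
proof
  fix u :: "'k vec" assume u: "u \<in> carrier_vec d"
  have "mat_of_cols d (map (unit_vec d) [0..<d]) = (1\<^sub>m d :: 'k mat)"
    by (rule eq_matI) (auto simp: mat_of_cols_def)
  then have "lin_comb d (map (unit_vec d) [0..<d]) (list_of_vec u) = u"
    using u mat_of_cols_mult_vec[of "map (unit_vec d) [0..<d]" d "list_of_vec u"] by (force simp: vec_list)
  then show "u \<in> lin_span d (map (unit_vec d) [0..<d])"
    using u by (auto simp: lin_span_def intro!: exI[of _ "list_of_vec u"])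
qed

text \<open>Let \<open>W\<close> be invariant. If it contains the first basis vector, it is everything. Otherwise it does not meet
  the line of the second one, so the product \<open>C\<close> over \<open>es\<close> vanishes on \<open>W\<close>. A nonzero \<open>W\<close> then
  contains an eigenvector for some \<open>\<mu>\<close> in \<open>es\<close>. Deflation by this eigenvector puts the left-hand side of
  the identity for \<open>Q\<close> into \<open>C W = 0\<close>.\<close>

lemma (in normal_form) irreducible_if:
  assumes Q: "\<And>\<mu> ks. mset es = mset (\<mu> # ks) \<Longrightarrow> Q_value d g \<alpha> \<mu> ks \<noteq> 0"
  shows "irreducible_pair d NX NY"
  unfolding irreducible_pair_def
proof (intro allI impI)
  fix W assume sub: "subspace class_ring W (module_vec TYPE('k) d)" and inv: "\<forall>w\<in>W. NX *\<^sub>v w \<in> W \<and> NY *\<^sub>v w \<in> W"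
  note subD = sub[unfolded subspace_module_vec_iff]
  have Wc: "w \<in> carrier_vec d" if "w \<in> W" for w using subD that by blast
  have sm: "c \<cdot>\<^sub>v w \<in> W" if "w \<in> W" for c w using subD that by blast
  have NXW: "NX *\<^sub>v w \<in> W" and NYW: "NY *\<^sub>v w \<in> W" if "w \<in> W" for w using inv that by blast+
  have BW: "NB *\<^sub>v w \<in> W" if "w \<in> W" for w
    unfolding B_vec[OF Wc[OF that]] by (intro sm NXW NYW that)
  have diff: "v - w \<in> W" if "v \<in> W" "w \<in> W" for v w
  proof -
    have "v - w = v + (- 1) \<cdot>\<^sub>v w" using Wc[OF that(1)] Wc[OF that(2)] by (auto intro!: eq_vecI)
    then show ?thesis using subD that sm by auto
  qed
  have LW: "lin_prod fs NB *\<^sub>v w \<in> W" if w: "w \<in> W" for w fs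
  proof (induction fs)
    case Nil
    then show ?case using w Wc[OF w] by (simp add: lin_prod_Nil_vec[OF B])
  next
    case (Cons e fs)
    then show ?case unfolding lin_prod_Cons_vec[OF B Wc[OF w]] by (intro diff sm BW)
  qed
  show "W = {0\<^sub>v d} \<or> W = carrier_vec d"
  proof (cases "unit_vec d 0 \<in> W")
    case True
    have "unit_vec d j \<in> W" if j: "j < d" for j
    proof -
      have "j < 5" using j d by simp
      then have "orbit NX NY (unit_vec d 0) ! j \<in> W" using True NXW NYW by (auto simp: less_numeral_cases)
      then show ?thesis by (simp only: orbit_unit_vec[OF j])
    qed
    then have "lin_span d (map (unit_vec d) [0..<d]) \<subseteq> W" by (intro lin_span_least[OF sub]) auto
    then show ?thesis using carrier_vec_lin_span[of d] Wc by blast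
  next
    case False
    have e1: "t = 0" if "t \<cdot>\<^sub>v unit_vec d 1 \<in> W" for t
    proof (rule ccontr)
      assume "t \<noteq> 0"
      have "inverse t \<cdot>\<^sub>v (t \<cdot>\<^sub>v unit_vec d 1) \<in> W" by (rule sm[OF that])
      then have "unit_vec d 1 \<in> W" using \<open>t \<noteq> 0\<close> by (simp add: smult_smult_assoc)
      then have "inverse N\<delta> \<cdot>\<^sub>v (NY *\<^sub>v (NY *\<^sub>v (NY *\<^sub>v unit_vec d 0))) \<in> W"
        unfolding NY_unit_vec by (intro sm NYW)
      then have "unit_vec d 0 \<in> W" by (simp add: smult_smult_assoc)
      with False show False ..
    qed
    have C0: "lin_prod es NB *\<^sub>v w = 0\<^sub>v d" if w: "w \<in> W" for w
    proof -
      obtain t where t: "lin_prod es NB *\<^sub>v w = t \<cdot>\<^sub>v unit_vec d 1"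
        using NB_collapses[OF HOL.refl Wc[OF w]] by blast
      then have "t = 0" using LW[OF w, of es] e1 by simp
      then show ?thesis using t by (simp add: vec_rearrange(5)[of _ d])
    qed
    have "w = 0\<^sub>v d" if w: "w \<in> W" for w
    proof (rule ccontr)
      assume w0: "w \<noteq> 0\<^sub>v d"
      have "\<exists>y\<in>W. \<exists>e\<in>set fs. y \<noteq> 0\<^sub>v d \<and> NB *\<^sub>v y = e \<cdot>\<^sub>v y" if "lin_prod fs NB *\<^sub>v w = 0\<^sub>v d" for fs
        using that
      proof (induction fs)
        case Nil
        then show ?case using w0 lin_prod_Nil_vec[OF B Wc[OF w]] by simp
      next
        case (Cons e fs)
        let ?y = "lin_prod fs NB *\<^sub>v w"
        show ?case
        proof (cases "?y = 0\<^sub>v d")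
          case True
          then show ?thesis using Cons.IH by auto
        next
          case False
          have y: "?y \<in> W" by (rule LW[OF w])
          have "NB *\<^sub>v ?y - e \<cdot>\<^sub>v ?y = 0\<^sub>v d"
            using Cons.prems lin_prod_Cons_vec[OF B Wc[OF w], of e fs] by simp
          then have "NB *\<^sub>v ?y = e \<cdot>\<^sub>v ?y"
            by (rule vec_diff_eq_zero) (simp_all only: BV[OF Wc[OF y]] Wc[OF y] smult_carrier_vec)
          then show ?thesis using False y by (intro bexI[of _ ?y] bexI[of _ e]) simp_all
        qed
      qed
      from this[OF C0[OF w]] obtain y \<mu> where y: "y \<in> W" "\<mu> \<in> set es" "y \<noteq> 0\<^sub>v d" "NB *\<^sub>v y = \<mu> \<cdot>\<^sub>v y" by blast
      obtain ks where ks: "mset es = mset (\<mu> # ks)"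
        using y(2) by (metis insert_DiffM ex_mset mset.simps(2) set_mset_mset)
      have "char_poly NB = (\<Prod>e\<leftarrow>\<mu> # \<alpha> # ks. [:-e, 1:])"
        unfolding char_poly_NB by (rule linear_factors_mset_cong) (simp add: ks)
      from deflation[OF B this Wc[OF y(1)] y(3,4), of "unit_vec d 0"] obtain t where
        "lin_prod (\<alpha> # ks) NB *\<^sub>v unit_vec d 0 = t \<cdot>\<^sub>v y" by auto
      then have "NX *\<^sub>v (lin_prod (\<alpha> # ks) NB *\<^sub>v unit_vec d 0) \<in> W" using sm[OF y(1)] NXW by simp
      from C0[OF this] have "(Q_value d g \<alpha> \<mu> ks * \<alpha>) \<cdot>\<^sub>v unit_vec d 1 = 0\<^sub>v d"
        using Q_identity[OF ks] lin_prod_mset_eq[OF B ks] by simp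
      then have "Q_value d g \<alpha> \<mu> ks * \<alpha> = 0"
        by (rule smult_vec_eq_zero) (use unit_vec_nonzero[of 1] d in auto)
      then show False using Q[OF ks] \<alpha> by simp
    qed
    then show ?thesis using subD by blast
  qed
qed

section \<open>Modules over the braid group\<close>

lemma carrier_GL: "P \<in> carrier (GL d) \<longleftrightarrow>
    P \<in> carrier_mat d d \<and> (\<exists>Q\<in>carrier_mat d d. P * Q = 1\<^sub>m d \<and> Q * P = (1\<^sub>m d :: 'k::field mat))"
  by (auto simp: GL_def units_of_def Units_def ring_mat_simps)

lemma mult_GL: "x \<otimes>\<^bsub>GL d\<^esub> y = x * (y :: 'k::field mat)"
  by (simp add: GL_def units_of_def ring_mat_simps)

lemma carrier_B3: "carrier B3 = range braid_class"
  by (simp add: B3_def)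

lemma braid_class_in_B3 [simp]: "braid_class w \<in> carrier B3"
  by (simp add: carrier_B3)

lemma B3_cube: "(gen \<sigma>1 \<otimes>\<^bsub>B3\<^esub> gen \<sigma>2) [^]\<^bsub>B3\<^esub> (3::nat) =
    braid_class [(\<sigma>1, True), (\<sigma>2, True), (\<sigma>1, True), (\<sigma>2, True), (\<sigma>1, True), (\<sigma>2, True)]"
proof -
  have one: "\<one>\<^bsub>B3\<^esub> = braid_class []" by (simp add: B3_def)
  interpret group B3 by (rule group_B3)
  show ?thesis by (simp add: numeral_3_eq_3 gen_def mult_braid_class one)
qed

lemma det_linear_factors:
  fixes A :: "'k::field mat"
  assumes A: "A \<in> carrier_mat n n" and cp: "char_poly A = (\<Prod>e\<leftarrow>es. [:-e, 1:])"
  shows "det A = prod_list es"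
proof -
  have len: "length es = n"
    using degree_monic_char_poly[OF A] degree_linear_factors[of uminus es] unfolding cp by simp
  have "char_matrix A 0 = A" using A by (auto simp: char_matrix_def intro!: eq_matI)
  then have "poly (char_poly A) 0 = det (- A)" using char_poly_matrix[OF A, of 0] by simp
  moreover have "- A = (- 1) \<cdot>\<^sub>m A" using A by (auto intro!: eq_matI)
  ultimately have "poly (char_poly A) 0 = (- 1) ^ n * det A" using A by simp
  moreover have "poly (\<Prod>e\<leftarrow>es. [:-e, 1:]) 0 = (- 1) ^ length es * prod_list es" by (induction es) auto
  ultimately show ?thesis using len cp by simp
qed

lemma eigenvalue_mset_linear_factors:
  "char_poly A = (\<Prod>e\<leftarrow>es. [:-e, 1:]) \<Longrightarrow> eigenvalue_mset A = mset (es :: 'k::field list)"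
proof -
  have "proots (\<Prod>e\<leftarrow>es. [:-e, 1:]) = mset es"
  proof (induction es)
    case (Cons e es)
    have "(\<Prod>e\<leftarrow>es. [:-e, 1:]) \<noteq> 0" by (auto simp: prod_list_zero_iff)
    then show ?case using Cons by (simp add: proots_mult del: mult_pCons_left)
  qed simp
  then show "char_poly A = (\<Prod>e\<leftarrow>es. [:-e, 1:]) \<Longrightarrow> eigenvalue_mset A = mset es"
    by (simp add: eigenvalue_mset_def)
qed

lemma char_poly_eigenvalue_mset:
  fixes A :: "'k::alg_closed_field mat"
  assumes A: "A \<in> carrier_mat n n" and es: "eigenvalue_mset A = mset es"
  shows "char_poly A = (\<Prod>e\<leftarrow>es. [:-e, 1:])"
proof -
  note deg = degree_monic_char_poly[OF A]
  have "char_poly A \<noteq> 0" using deg by auto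
  then obtain M where "char_poly A = (\<Prod>x\<in>#M. [:-x, 1:])"
    using alg_closed_imp_factorization[of "char_poly A"] deg by auto
  moreover obtain rs where "mset rs = M" by (metis ex_mset)
  ultimately have rs: "char_poly A = (\<Prod>e\<leftarrow>rs. [:-e, 1:])"
    by (auto simp flip: prod_mset_prod_list)
  have "mset rs = mset es" using eigenvalue_mset_linear_factors[OF rs] es by simp
  then show ?thesis unfolding rs by (rule linear_factors_mset_cong)
qed

subsection \<open>From modules to pairs\<close>

locale braid_module =
  fixes d :: nat and \<rho> :: "braid_word set \<Rightarrow> 'k::field mat"
  assumes module: "B3_module d \<rho>"
begin

abbreviation "a \<equiv> \<rho> (gen \<sigma>1)"
abbreviation "b \<equiv> \<rho> (gen \<sigma>2)"

lemma rho_carrier [simp]: "\<rho> (braid_class w) \<in> carrier_mat d d"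
  using module by (auto simp: B3_module_def hom_def carrier_GL Pi_iff)

lemma rho_append: "\<rho> (braid_class (u @ v)) = \<rho> (braid_class u) * \<rho> (braid_class v)"
  using module by (simp add: B3_module_def hom_def mult_GL flip: mult_braid_class)

lemma rho_Nil: "\<rho> (braid_class []) = 1\<^sub>m d"
proof -
  let ?e = "\<rho> (braid_class [])"
  obtain Q where Q: "Q \<in> carrier_mat d d" "?e * Q = 1\<^sub>m d" "Q * ?e = 1\<^sub>m d"
    using module braid_class_in_B3[of "[]"] unfolding B3_module_def hom_def Pi_iff carrier_GL by blast
  have "?e = (Q * ?e) * ?e" using Q left_mult_one_mat[OF rho_carrier] by simp
  also have "\<dots> = Q * (?e * ?e)" by (rule assoc_mult_mat[OF Q(1) rho_carrier rho_carrier])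
  also have "?e * ?e = ?e" using rho_append[of "[]" "[]"] by simp
  finally show ?thesis using Q by simp
qed

lemma gen_carrier [simp]: "\<rho> (gen s) \<in> carrier_mat d d"
  by (simp add: gen_def)

lemma rho_letters:
  "\<rho> (braid_class [(s, True)]) = \<rho> (gen s)"
  "\<rho> (braid_class [(s, False)]) * \<rho> (gen s) = 1\<^sub>m d" "\<rho> (gen s) * \<rho> (braid_class [(s, False)]) = 1\<^sub>m d"
proof -
  have "braid_class [(s, b), (s, \<not> b)] = braid_class []" for s b
    by (simp add: braid_class_eq_iff braid_eq.cancel)
  from this[of s True] this[of s False]
  show "\<rho> (braid_class [(s, False)]) * \<rho> (gen s) = 1\<^sub>m d" "\<rho> (gen s) * \<rho> (braid_class [(s, False)]) = 1\<^sub>m d"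
    using rho_append[of "[(s, False)]" "[(s, True)]"] rho_append[of "[(s, True)]" "[(s, False)]"]
    by (simp_all add: gen_def rho_Nil)
qed (simp add: gen_def)

lemma braid_relation: "a * (b * a) = b * (a * b)"
proof -
  have "braid_class [(\<sigma>1, True), (\<sigma>2, True), (\<sigma>1, True)] = braid_class [(\<sigma>2, True), (\<sigma>1, True), (\<sigma>2, True)]"
    by (simp add: braid_class_eq_iff braid_eq.braid)
  then show ?thesis
    using rho_append[of "[(\<sigma>1, True)]" "[(\<sigma>2, True), (\<sigma>1, True)]"] rho_append[of "[(\<sigma>2, True)]" "[(\<sigma>1, True)]"]
      rho_append[of "[(\<sigma>2, True)]" "[(\<sigma>1, True), (\<sigma>2, True)]"] rho_append[of "[(\<sigma>1, True)]" "[(\<sigma>2, True)]"]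
    by (simp add: gen_def)
qed

lemma word_induct:
  assumes "Pr (1\<^sub>m d)" "\<And>M N. M \<in> carrier_mat d d \<Longrightarrow> N \<in> carrier_mat d d \<Longrightarrow> Pr M \<Longrightarrow> Pr N \<Longrightarrow> Pr (M * N)"
    and "\<And>s. Pr (\<rho> (gen s))" "\<And>s. Pr (\<rho> (braid_class [(s, False)]))" and g: "g \<in> carrier B3"
  shows "Pr (\<rho> g)"
proof -
  have "Pr (\<rho> (braid_class w))" for w
  proof (induction w)
    case Nil
    then show ?case using assms(1) by (simp add: rho_Nil)
  next
    case (Cons l w)
    obtain s c where l: "l = (s, c)" by (cases l)
    have "Pr (\<rho> (braid_class [l]))" using assms(3,4) by (cases c) (auto simp: l rho_letters(1))
    then show ?case using rho_append[of "[l]" w] assms(2)[OF _ _ _ Cons] by simp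
  qed
  then show ?thesis using g by (auto simp: carrier_B3)
qed

definition "X = a * (b * a)"
definition "Y = a * b"

lemma X_carrier [simp]: "X \<in> carrier_mat d d" and Y_carrier [simp]: "Y \<in> carrier_mat d d"
  unfolding X_def Y_def by (intro mult_carrier_mat[of _ d d] gen_carrier)+

lemma X_eq: "X = Y * a" "X = b * Y"
proof -
  show "X = Y * a" unfolding X_def Y_def by (rule assoc_mult_mat[symmetric, of _ d d _ d _ d]) simp_all
  show "X = b * Y" unfolding X_def Y_def by (rule braid_relation)
qed

lemma rho_cube: "\<rho> ((gen \<sigma>1 \<otimes>\<^bsub>B3\<^esub> gen \<sigma>2) [^]\<^bsub>B3\<^esub> (3::nat)) = Y * (Y * Y)"
proof -
  have "\<rho> (braid_class [(\<sigma>1, True), (\<sigma>2, True)]) = Y"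
    using rho_append[of "[(\<sigma>1, True)]" "[(\<sigma>2, True)]"] by (simp add: Y_def gen_def)
  then show ?thesis
    unfolding B3_cube
    using rho_append[of "[(\<sigma>1, True), (\<sigma>2, True)]" "[(\<sigma>1, True), (\<sigma>2, True), (\<sigma>1, True), (\<sigma>2, True)]"]
      rho_append[of "[(\<sigma>1, True), (\<sigma>2, True)]" "[(\<sigma>1, True), (\<sigma>2, True)]"] by simp
qed

lemma gen_vec [simp]: "u \<in> carrier_vec d \<Longrightarrow> \<rho> (gen s) *\<^sub>v u \<in> carrier_vec d"
  by (rule mult_mat_vec_carrier[OF gen_carrier])

lemma XY_vec:
  assumes "u \<in> carrier_vec d"
  shows "X *\<^sub>v u = a *\<^sub>v (b *\<^sub>v (a *\<^sub>v u))" "X *\<^sub>v u = b *\<^sub>v (a *\<^sub>v (b *\<^sub>v u))" "Y *\<^sub>v u = a *\<^sub>v (b *\<^sub>v u)"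
proof -
  note m = mult_carrier_mat[OF gen_carrier gen_carrier]
  show "X *\<^sub>v u = a *\<^sub>v (b *\<^sub>v (a *\<^sub>v u))"
    using assms by (simp add: X_def assoc_mult_mat_vec[OF gen_carrier m] assoc_mult_mat_vec[OF gen_carrier gen_carrier])
  show "X *\<^sub>v u = b *\<^sub>v (a *\<^sub>v (b *\<^sub>v u))"
    using assms by (simp add: X_def braid_relation assoc_mult_mat_vec[OF gen_carrier m] assoc_mult_mat_vec[OF gen_carrier gen_carrier])
  show "Y *\<^sub>v u = a *\<^sub>v (b *\<^sub>v u)"
    using assms by (simp add: Y_def assoc_mult_mat_vec[OF gen_carrier gen_carrier])
qed

lemma cube_vec:
  assumes u: "u \<in> carrier_vec d"
  shows "X *\<^sub>v (X *\<^sub>v u) = Y *\<^sub>v (Y *\<^sub>v (Y *\<^sub>v u))" "X *\<^sub>v (X *\<^sub>v (\<rho> (gen s) *\<^sub>v u)) = \<rho> (gen s) *\<^sub>v (X *\<^sub>v (X *\<^sub>v u))"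
proof -
  have Xv [simp]: "X *\<^sub>v w \<in> carrier_vec d" if "w \<in> carrier_vec d" for w
    by (rule mult_mat_vec_carrier[OF X_carrier that])
  have "X *\<^sub>v (X *\<^sub>v u) = a *\<^sub>v (b *\<^sub>v (a *\<^sub>v (X *\<^sub>v u)))" using u by (simp add: XY_vec(1)[of "X *\<^sub>v u"])
  also have "\<dots> = a *\<^sub>v (b *\<^sub>v (a *\<^sub>v (b *\<^sub>v (a *\<^sub>v (b *\<^sub>v u)))))" by (simp only: XY_vec(2)[OF u])
  finally show "X *\<^sub>v (X *\<^sub>v u) = Y *\<^sub>v (Y *\<^sub>v (Y *\<^sub>v u))" using u by (simp add: XY_vec(3))
  have 1: "X *\<^sub>v (a *\<^sub>v w) = b *\<^sub>v (X *\<^sub>v w)" and 2: "X *\<^sub>v (b *\<^sub>v w) = a *\<^sub>v (X *\<^sub>v w)"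
    if w: "w \<in> carrier_vec d" for w
  proof -
    show "X *\<^sub>v (a *\<^sub>v w) = b *\<^sub>v (X *\<^sub>v w)" using w by (simp add: XY_vec(2)[of "a *\<^sub>v w"] XY_vec(1)[of w])
    show "X *\<^sub>v (b *\<^sub>v w) = a *\<^sub>v (X *\<^sub>v w)" using w by (simp add: XY_vec(1)[of "b *\<^sub>v w"] XY_vec(2)[of w])
  qed
  show "X *\<^sub>v (X *\<^sub>v (\<rho> (gen s) *\<^sub>v u)) = \<rho> (gen s) *\<^sub>v (X *\<^sub>v (X *\<^sub>v u))"
    using u by (cases s) (simp_all add: 1 2)
qed

lemma central:
  assumes g: "g \<in> carrier B3"
  shows "(X * X) * \<rho> g = \<rho> g * (X * X)"
proof (rule word_induct[OF _ _ _ _ g])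
  let ?C = "X * X"
  have C: "?C \<in> carrier_mat d d" by (rule mult_carrier_mat[OF X_carrier X_carrier])
  show gen: "?C * \<rho> (gen s) = \<rho> (gen s) * ?C" for s
  proof (rule eq_mat_on_vecI[of _ d d])
    fix u :: "'k vec" assume u: "u \<in> carrier_vec d"
    show "?C * \<rho> (gen s) *\<^sub>v u = \<rho> (gen s) * ?C *\<^sub>v u"
      using u cube_vec(2)[OF u, of s]
      by (simp add: assoc_mult_mat_vec[OF C gen_carrier u] assoc_mult_mat_vec[OF gen_carrier C u]
          assoc_mult_mat_vec[OF X_carrier X_carrier])
  qed (rule mult_carrier_mat[OF C gen_carrier] mult_carrier_mat[OF gen_carrier C])+
  show "?C * 1\<^sub>m d = 1\<^sub>m d * ?C" using left_mult_one_mat[OF C] right_mult_one_mat[OF C] by simp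
  fix M N :: "'k mat" assume M: "M \<in> carrier_mat d d" and N: "N \<in> carrier_mat d d"
    and CM: "?C * M = M * ?C" and CN: "?C * N = N * ?C"
  show "?C * (M * N) = M * N * ?C"
    using assoc_mult_mat[OF C M N] assoc_mult_mat[OF M C N] assoc_mult_mat[OF M N C] CM CN by simp
next
  let ?C = "X * X"
  have C: "?C \<in> carrier_mat d d" by (rule mult_carrier_mat[OF X_carrier X_carrier])
  fix s
  let ?i = "\<rho> (braid_class [(s, False)])" and ?g = "\<rho> (gen s)"
  have i: "?i \<in> carrier_mat d d" by simp
  have gen: "?C * ?g = ?g * ?C"
  proof (rule eq_mat_on_vecI[of _ d d])
    fix u :: "'k vec" assume u: "u \<in> carrier_vec d"
    show "?C * \<rho> (gen s) *\<^sub>v u = \<rho> (gen s) * ?C *\<^sub>v u"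
      using u cube_vec(2)[OF u, of s]
      by (simp add: assoc_mult_mat_vec[OF C gen_carrier u] assoc_mult_mat_vec[OF gen_carrier C u]
          assoc_mult_mat_vec[OF X_carrier X_carrier])
  qed (rule mult_carrier_mat[OF C gen_carrier] mult_carrier_mat[OF gen_carrier C])+
  have "?C * ?i = (?i * ?g) * (?C * ?i)" using left_mult_one_mat[OF mult_carrier_mat[OF C i]] by (simp add: rho_letters)
  also have "\<dots> = ?i * (?g * ?C * ?i)"
    using assoc_mult_mat[OF i gen_carrier mult_carrier_mat[OF C i], of s] assoc_mult_mat[OF gen_carrier C i, of s] by simp
  also have "?g * ?C * ?i = ?C"
    using assoc_mult_mat[OF C gen_carrier i, of s] right_mult_one_mat[OF C] by (simp add: rho_letters flip: gen)
  finally show "?C * ?i = ?i * ?C" .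
qed

lemma b_braid_mat:
  assumes "Y * (Y * Y) = \<delta> \<cdot>\<^sub>m 1\<^sub>m d" "\<delta> \<noteq> 0"
  shows "braid_mat \<delta> X Y = b"
proof -
  have "X * (Y * Y) = b * (Y * (Y * Y))"
    unfolding X_eq(2) by (rule assoc_mult_mat[OF gen_carrier Y_carrier mult_carrier_mat[OF Y_carrier Y_carrier]])
  also have "\<dots> = \<delta> \<cdot>\<^sub>m b"
    unfolding assms(1) using mult_smult_distrib[of b d d "1\<^sub>m d" d \<delta>] right_mult_one_mat[OF gen_carrier[of \<sigma>2]] by simp
  finally show ?thesis using assms(2) by (auto simp: braid_mat_def intro!: eq_matI)
qed

end

lemma braid_module_isoI:
  fixes \<rho> \<rho>' :: "braid_word set \<Rightarrow> 'k::field mat"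
  assumes "B3_module d \<rho>" "B3_module d \<rho>'" "base_change d P Q"
    and gen: "\<And>s. P * \<rho> (gen s) = \<rho>' (gen s) * P"
  shows "B3_module_iso d \<rho> \<rho>'"
proof -
  interpret r: braid_module d \<rho> by unfold_locales fact
  interpret s: braid_module d \<rho>' by unfold_locales fact
  interpret base_change d P Q by fact
  have "P * \<rho> (braid_class w) = \<rho>' (braid_class w) * P" for w
  proof (induction w)
    case Nil
    then show ?case using left_mult_one_mat[OF P] right_mult_one_mat[OF P] by (simp add: r.rho_Nil s.rho_Nil)
  next
    case (Cons l w)
    obtain t c where l: "l = (t, c)" by (cases l)
    let ?r = "\<rho> (braid_class [l])" and ?s = "\<rho>' (braid_class [l])"
    have step: "P * ?r = ?s * P"
    proof (cases c)
      case True
      then show ?thesis using gen by (simp add: l r.rho_letters(1) s.rho_letters(1))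
    next
      case False
      then have l: "l = (t, False)" by (simp add: l)
      have rc: "?r \<in> carrier_mat d d" and sc: "?s \<in> carrier_mat d d" by simp_all
      have "P * ?r = (?s * \<rho>' (gen t)) * (P * ?r)"
        using left_mult_one_mat[OF mult_carrier_mat[OF P rc]] by (simp add: l s.rho_letters(2))
      also have "\<dots> = ?s * (\<rho>' (gen t) * P * ?r)"
        using assoc_mult_mat[OF sc s.gen_carrier mult_carrier_mat[OF P rc], of t]
          assoc_mult_mat[OF s.gen_carrier P rc, of t] by simp
      also have "\<rho>' (gen t) * P * ?r = P * (\<rho> (gen t) * ?r)"
        using assoc_mult_mat[OF P r.gen_carrier rc, of t] by (simp add: gen)
      finally show ?thesis using right_mult_one_mat[OF P] by (simp add: l r.rho_letters(3))
    qed
    have w: "\<rho> (braid_class w) \<in> carrier_mat d d" "\<rho>' (braid_class w) \<in> carrier_mat d d"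
      and lc: "?r \<in> carrier_mat d d" "?s \<in> carrier_mat d d" by simp_all
    show ?case
      using r.rho_append[of "[l]" w] s.rho_append[of "[l]" w] assoc_mult_mat[OF P lc(1) w(1)] assoc_mult_mat[OF lc(2) P w(1)]
        assoc_mult_mat[OF lc(2) w(2) P] step Cons.IH by simp
  qed
  moreover have "P \<in> carrier (GL d)" unfolding carrier_GL using P Q PQ QP by blast
  ultimately show ?thesis unfolding B3_module_iso_def carrier_B3 by blast
qed

lemma central_scalar_eq:
  fixes \<rho> :: "braid_word set \<Rightarrow> 'k::field mat"
  assumes "\<rho> ((gen \<sigma>1 \<otimes>\<^bsub>B3\<^esub> gen \<sigma>2) [^]\<^bsub>B3\<^esub> (3::nat)) = \<delta> \<cdot>\<^sub>m 1\<^sub>m d" and d: "d \<noteq> 0"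
  shows "central_scalar d \<rho> = \<delta>"
  unfolding central_scalar_def
proof (rule the_equality)
  fix e assume "\<rho> ((gen \<sigma>1 \<otimes>\<^bsub>B3\<^esub> gen \<sigma>2) [^]\<^bsub>B3\<^esub> (3::nat)) = e \<cdot>\<^sub>m 1\<^sub>m d"
  then have "(e \<cdot>\<^sub>m 1\<^sub>m d) $$ (0, 0) = (\<delta> \<cdot>\<^sub>m 1\<^sub>m d :: 'k mat) $$ (0, 0)" using assms(1) by simp
  then show "e = \<delta>" using d by simp
qed (rule assms(1))

text \<open>The eigenspaces of the central element are submodules, so \<open>X\<^sup>2\<close> is scalar without an appeal to Schur's lemma
  for group representations. Submodules and subspaces invariant under \<open>X\<close> and \<open>Y\<close> agree, because the
  generators and their inverses are, up to powers of \<open>\<delta>\<close>, words in \<open>X\<close> and \<open>Y\<close>.\<close>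

lemma simple_module_pair:
  fixes \<rho> :: "braid_word set \<Rightarrow> 'k::alg_closed_field mat"
  assumes simple: "simple_B3_module d \<rho>"
  shows "irreducible_twist_pair d (braid_module.X \<rho>) (braid_module.Y \<rho>) (central_scalar d \<rho>)"
    and "braid_mat (central_scalar d \<rho>) (braid_module.X \<rho>) (braid_module.Y \<rho>) = \<rho> (gen \<sigma>2)"
    and "char_poly (\<rho> (gen \<sigma>2)) = char_poly (\<rho> (gen \<sigma>1))"
proof -
  have d: "d \<noteq> 0" using simple by (simp add: simple_B3_module_def)
  interpret braid_module d \<rho> by unfold_locales (use simple in \<open>simp add: simple_B3_module_def\<close>)
  have C: "X * X \<in> carrier_mat d d" by (rule mult_carrier_mat[OF X_carrier X_carrier])
  obtain \<delta> v where v: "v \<in> carrier_vec d" "v \<noteq> 0\<^sub>v d" "(X * X) *\<^sub>v v = \<delta> \<cdot>\<^sub>v v"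
    using eigenvector_exists[OF C d] by blast
  let ?W = "{w \<in> carrier_vec d. (X * X) *\<^sub>v w = \<delta> \<cdot>\<^sub>v w}"
  have "\<rho> h *\<^sub>v w \<in> ?W" if h: "h \<in> carrier B3" and w: "w \<in> ?W" for h w
  proof -
    have hc: "\<rho> h \<in> carrier_mat d d" using h by (auto simp: carrier_B3)
    have "(X * X) *\<^sub>v (\<rho> h *\<^sub>v w) = \<rho> h *\<^sub>v ((X * X) *\<^sub>v w)"
      using assoc_mult_mat_vec[OF C hc, of w] assoc_mult_mat_vec[OF hc C, of w] central[OF h] w by simp
    then show ?thesis using w hc mult_mat_vec_carrier[OF hc, of w] by (simp add: mult_mat_vec[OF hc])
  qed
  then have "?W = {0\<^sub>v d} \<or> ?W = carrier_vec d"
    using simple eigenspace_subspace[OF C, of \<delta>] unfolding simple_B3_module_def by blast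
  then have W: "?W = carrier_vec d" using v by blast
  have X2: "X * X = \<delta> \<cdot>\<^sub>m 1\<^sub>m d"
  proof (rule eq_mat_on_vecI[OF C])
    fix u :: "'k vec" assume u: "u \<in> carrier_vec d"
    then have "(X * X) *\<^sub>v u = \<delta> \<cdot>\<^sub>v u" using W by blast
    then show "(X * X) *\<^sub>v u = (\<delta> \<cdot>\<^sub>m 1\<^sub>m d) *\<^sub>v u" using u by (simp add: smult_mult_mat_vec[of _ d d])
  qed simp
  have YY: "Y * Y \<in> carrier_mat d d" by (rule mult_carrier_mat[OF Y_carrier Y_carrier])
  have Y3: "Y * (Y * Y) = \<delta> \<cdot>\<^sub>m 1\<^sub>m d"
    unfolding X2[symmetric]
  proof (rule eq_mat_on_vecI[of _ d d])
    fix u :: "'k vec" assume u: "u \<in> carrier_vec d"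
    show "Y * (Y * Y) *\<^sub>v u = X * X *\<^sub>v u"
      using cube_vec(1)[OF u] assoc_mult_mat_vec[OF Y_carrier YY u] assoc_mult_mat_vec[OF Y_carrier Y_carrier u]
        assoc_mult_mat_vec[OF X_carrier X_carrier u] by simp
  qed (rule C mult_carrier_mat[OF Y_carrier YY])+
  have \<rho>C: "\<rho> ((gen \<sigma>1 \<otimes>\<^bsub>B3\<^esub> gen \<sigma>2) [^]\<^bsub>B3\<^esub> (3::nat)) = \<delta> \<cdot>\<^sub>m 1\<^sub>m d"
    unfolding rho_cube by (rule Y3)
  then have cs: "central_scalar d \<rho> = \<delta>" by (rule central_scalar_eq[OF _ d])
  have \<delta>: "\<delta> \<noteq> 0"
  proof
    assume "\<delta> = 0"
    then have 0: "\<rho> ((gen \<sigma>1 \<otimes>\<^bsub>B3\<^esub> gen \<sigma>2) [^]\<^bsub>B3\<^esub> (3::nat)) = 0\<^sub>m d d" using \<rho>C by (auto intro!: eq_matI)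
    have "\<rho> ((gen \<sigma>1 \<otimes>\<^bsub>B3\<^esub> gen \<sigma>2) [^]\<^bsub>B3\<^esub> (3::nat)) \<in> carrier (GL d)"
      using module by (auto simp: B3_module_def hom_def Pi_iff B3_cube)
    from this[unfolded 0 carrier_GL, THEN conjunct2] obtain Q
      where Q: "Q \<in> carrier_mat d d" "0\<^sub>m d d * Q = (1\<^sub>m d :: 'k mat)" by (elim bexE conjE) (rule that)
    then have "(0\<^sub>m d d :: 'k mat) $$ (0, 0) = 1\<^sub>m d $$ (0, 0)" using left_mult_zero_mat[OF Q(1), of d] by simp
    then show False using d by simp
  qed
  have pair: "twist_pair d X Y \<delta>" by unfold_locales (use X2 Y3 \<delta> in auto)
  show B: "braid_mat (central_scalar d \<rho>) X Y = b" unfolding cs by (rule b_braid_mat[OF Y3 \<delta>])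
  interpret T: twist_pair d X Y \<delta> by (rule pair)
  have "irreducible_pair d X Y"
    unfolding irreducible_pair_def
  proof (intro allI impI)
    fix W assume sub: "subspace class_ring W (module_vec TYPE('k) d)" and inv: "\<forall>w\<in>W. X *\<^sub>v w \<in> W \<and> Y *\<^sub>v w \<in> W"
    note subD = sub[unfolded subspace_module_vec_iff]
    have Wc: "w \<in> carrier_vec d" if "w \<in> W" for w using subD that by blast
    have sm: "c \<cdot>\<^sub>v w \<in> W" if "w \<in> W" for c w using subD that by blast
    have XW: "X *\<^sub>v w \<in> W" and YW: "Y *\<^sub>v w \<in> W" if "w \<in> W" for w using inv that by blast+
    have a_eq: "a *\<^sub>v u = inverse \<delta> \<cdot>\<^sub>v (Y *\<^sub>v (Y *\<^sub>v (X *\<^sub>v u)))" if u: "u \<in> carrier_vec d" for u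
    proof -
      have "X *\<^sub>v u = Y *\<^sub>v (a *\<^sub>v u)" using u assoc_mult_mat_vec[OF Y_carrier gen_carrier u] unfolding X_eq(1) by simp
      then show ?thesis using u by (simp add: smult_smult_assoc)
    qed
    have b_eq: "b *\<^sub>v u = inverse \<delta> \<cdot>\<^sub>v (X *\<^sub>v (Y *\<^sub>v (Y *\<^sub>v u)))" if u: "u \<in> carrier_vec d" for u
      using T.B_vec[OF u] B cs by simp
    have inv_gen: "\<rho> (braid_class [(s, False)]) *\<^sub>v w = z"
      if "z \<in> carrier_vec d" "\<rho> (gen s) *\<^sub>v z = w" for s w z
      using assoc_mult_mat_vec[OF rho_carrier gen_carrier that(1), of "[(s, False)]" s] that
      by (simp add: rho_letters)
    have "\<forall>w\<in>W. \<rho> h *\<^sub>v w \<in> W" if h: "h \<in> carrier B3" for h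
    proof (rule word_induct[OF _ _ _ _ h])
      show "\<forall>w\<in>W. 1\<^sub>m d *\<^sub>v w \<in> W" using Wc by simp
      show "\<forall>w\<in>W. (M * N) *\<^sub>v w \<in> W"
        if "M \<in> carrier_mat d d" "N \<in> carrier_mat d d" "\<forall>w\<in>W. M *\<^sub>v w \<in> W" "\<forall>w\<in>W. N *\<^sub>v w \<in> W" for M N
        using that assoc_mult_mat_vec[OF that(1,2)] Wc by simp
      show "\<forall>w\<in>W. \<rho> (gen s) *\<^sub>v w \<in> W" for s
        using a_eq b_eq Wc sm XW YW by (cases s) auto
      show "\<forall>w\<in>W. \<rho> (braid_class [(s, False)]) *\<^sub>v w \<in> W" for s
      proof
        fix w assume w: "w \<in> W"
        let ?z = "inverse \<delta> \<cdot>\<^sub>v (if s = \<sigma>1 then X *\<^sub>v (Y *\<^sub>v w) else Y *\<^sub>v (X *\<^sub>v w))"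
        have "\<rho> (gen s) *\<^sub>v ?z = w"
          using Wc[OF w] by (cases s) (simp_all add: a_eq b_eq smult_smult_assoc)
        moreover have "?z \<in> carrier_vec d" using Wc[OF w] by simp
        ultimately have "\<rho> (braid_class [(s, False)]) *\<^sub>v w = ?z" by (intro inv_gen)
        then show "\<rho> (braid_class [(s, False)]) *\<^sub>v w \<in> W" using w XW YW sm by simp
      qed
    qed
    then show "W = {0\<^sub>v d} \<or> W = carrier_vec d"
      using simple sub unfolding simple_B3_module_def by blast
  qed
  then show "irreducible_twist_pair d X Y (central_scalar d \<rho>)"
    unfolding cs irreducible_twist_pair_def irreducible_twist_pair_axioms_def using pair by simp
  have Xinv: "X * (inverse \<delta> \<cdot>\<^sub>m X) = 1\<^sub>m d" "(inverse \<delta> \<cdot>\<^sub>m X) * X = 1\<^sub>m d"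
    by (rule scaled_inverse[OF X_carrier X_carrier X2 \<delta>])+
  interpret S: base_change d X "inverse \<delta> \<cdot>\<^sub>m X" by unfold_locales (use Xinv in auto)
  have "b * X = X * a"
  proof (rule eq_mat_on_vecI[of _ d d])
    fix u :: "'k vec" assume u: "u \<in> carrier_vec d"
    show "b * X *\<^sub>v u = X * a *\<^sub>v u"
      using u by (simp add: assoc_mult_mat_vec[OF gen_carrier X_carrier u] assoc_mult_mat_vec[OF X_carrier gen_carrier u]
          XY_vec(1)[of u] XY_vec(2)[of "a *\<^sub>v u"])
  qed (rule mult_carrier_mat[OF X_carrier gen_carrier] mult_carrier_mat[OF gen_carrier X_carrier])+
  from S.intertwined_eq[OF gen_carrier gen_carrier this] show "char_poly b = char_poly a"
    using S.conjugate(4)[OF gen_carrier, of \<sigma>2] by simp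
qed

subsection \<open>From pairs to modules\<close>

context twist_pair
begin

text \<open>The inverses are written without an inverse matrix, by means of \<open>X\<^sup>-\<^sup>1 = \<delta>\<^sup>-\<^sup>1 X\<close> and
  \<open>Y\<^sup>-\<^sup>1 = \<delta>\<^sup>-\<^sup>1 Y\<^sup>2\<close>.\<close>

fun letter :: "braid_gen \<times> bool \<Rightarrow> 'k mat" where
  "letter (\<sigma>1, True) = inverse \<delta> \<cdot>\<^sub>m (Y * (Y * X))"
| "letter (\<sigma>2, True) = B"
| "letter (\<sigma>1, False) = inverse \<delta> \<cdot>\<^sub>m (X * Y)"
| "letter (\<sigma>2, False) = inverse \<delta> \<cdot>\<^sub>m (Y * X)"

definition word_mat :: "braid_word \<Rightarrow> 'k mat" where
  "word_mat w = foldr (\<lambda>l M. letter l * M) w (1\<^sub>m d)"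

definition rep :: "braid_word set \<Rightarrow> 'k mat" where
  "rep h = word_mat (SOME w. braid_class w = h)"

lemma letter_carrier [simp]: "letter l \<in> carrier_mat d d"
  using mult_carrier_mat[OF Y mult_carrier_mat[OF Y X]] mult_carrier_mat[OF X Y] mult_carrier_mat[OF Y X]
    mult_carrier_mat[OF X mult_carrier_mat[OF Y Y]]
  by (induction l rule: letter.induct) (simp_all add: braid_mat_def)

lemma letter_vec:
  assumes "u \<in> carrier_vec d"
  shows "letter (\<sigma>1, True) *\<^sub>v u = inverse \<delta> \<cdot>\<^sub>v (Y *\<^sub>v (Y *\<^sub>v (X *\<^sub>v u)))"
    "letter (\<sigma>2, True) *\<^sub>v u = inverse \<delta> \<cdot>\<^sub>v (X *\<^sub>v (Y *\<^sub>v (Y *\<^sub>v u)))"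
    "letter (\<sigma>1, False) *\<^sub>v u = inverse \<delta> \<cdot>\<^sub>v (X *\<^sub>v (Y *\<^sub>v u))"
    "letter (\<sigma>2, False) *\<^sub>v u = inverse \<delta> \<cdot>\<^sub>v (Y *\<^sub>v (X *\<^sub>v u))"
  using assms smult_mult_mat_vec[OF mult_carrier_mat[OF Y mult_carrier_mat[OF Y X]], of u "inverse \<delta>"]
    smult_mult_mat_vec[OF mult_carrier_mat[OF X Y], of u "inverse \<delta>"]
    smult_mult_mat_vec[OF mult_carrier_mat[OF Y X], of u "inverse \<delta>"]
    assoc_mult_mat_vec[OF Y mult_carrier_mat[OF Y X], of u] assoc_mult_mat_vec[OF X Y, of u]
    assoc_mult_mat_vec[OF Y X, of u]
  by (simp_all add: B_vec)

lemma word_mat_carrier [simp]: "word_mat w \<in> carrier_mat d d"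
  by (induction w) (auto simp: word_mat_def intro!: mult_carrier_mat[of _ d d])

lemma word_mat_Nil [simp]: "word_mat [] = 1\<^sub>m d" and word_mat_Cons [simp]: "word_mat (l # w) = letter l * word_mat w"
  by (simp_all add: word_mat_def)

lemma word_mat_append: "word_mat (u @ v) = word_mat u * word_mat v"
proof (induction u)
  case Nil
  then show ?case using left_mult_one_mat[OF word_mat_carrier] by simp
next
  case (Cons l u)
  then show ?case using assoc_mult_mat[OF letter_carrier word_mat_carrier word_mat_carrier] by simp
qed

lemma letter_vec_carrier [simp]: "u \<in> carrier_vec d \<Longrightarrow> letter l *\<^sub>v u \<in> carrier_vec d"
  by (rule mult_mat_vec_carrier[OF letter_carrier])

lemma word_mat_Cons_vec: "u \<in> carrier_vec d \<Longrightarrow> word_mat (l # w) *\<^sub>v u = letter l *\<^sub>v (word_mat w *\<^sub>v u)"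
  by (simp add: assoc_mult_mat_vec[OF letter_carrier word_mat_carrier])

lemma word_mat_braid_eq: "braid_eq u v \<Longrightarrow> word_mat u = word_mat v"
proof (induction rule: braid_eq.induct)
  case (cancel s c)
  show ?case
  proof (rule eq_mat_on_vecI[of _ d d])
    fix x :: "'k vec" assume x: "x \<in> carrier_vec d"
    have "letter (s, c) *\<^sub>v (letter (s, \<not> c) *\<^sub>v x) = x"
      using x by (cases s; cases c) (simp_all add: letter_vec smult_smult_assoc del: letter.simps)
    then show "word_mat [(s, c), (s, \<not> c)] *\<^sub>v x = word_mat [] *\<^sub>v x"
      using x by (simp add: word_mat_Cons_vec del: word_mat_Cons)
  qed (rule word_mat_carrier)+
next
  case braid
  show ?case
  proof (rule eq_mat_on_vecI[of _ d d])
    fix x :: "'k vec" assume x: "x \<in> carrier_vec d"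
    then show "word_mat [(\<sigma>1, True), (\<sigma>2, True), (\<sigma>1, True)] *\<^sub>v x = word_mat [(\<sigma>2, True), (\<sigma>1, True), (\<sigma>2, True)] *\<^sub>v x"
      by (simp add: word_mat_Cons_vec letter_vec smult_smult_assoc del: word_mat_Cons letter.simps)
  qed (rule word_mat_carrier)+
qed (simp_all add: word_mat_append)

lemma rep_class [simp]: "rep (braid_class w) = word_mat w"
proof -
  have "braid_class (SOME w'. braid_class w' = braid_class w) = braid_class w" by (rule someI) simp
  then show ?thesis unfolding rep_def by (intro word_mat_braid_eq) (simp add: braid_class_eq_iff)
qed

lemma rep_B3: "B3_module d rep"
  unfolding B3_module_def
proof (rule homI)
  fix h assume "h \<in> carrier B3"
  then obtain w where h: "h = braid_class w" by (auto simp: carrier_B3)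
  obtain v where v: "braid_eq (v @ w) []" using braid_left_inverse by blast
  have "word_mat v * word_mat w = 1\<^sub>m d" using word_mat_braid_eq[OF v] by (simp add: word_mat_append)
  moreover from this have "word_mat w * word_mat v = 1\<^sub>m d" by (rule mat_mult_left_right_inverse[OF word_mat_carrier word_mat_carrier])
  ultimately show "rep h \<in> carrier (GL d)" unfolding carrier_GL h by (auto intro!: bexI[of _ "word_mat v"])
next
  fix x y assume "x \<in> carrier B3" "y \<in> carrier B3"
  then show "rep (x \<otimes>\<^bsub>B3\<^esub> y) = rep x \<otimes>\<^bsub>GL d\<^esub> rep y"
    by (auto simp: carrier_B3 mult_braid_class mult_GL word_mat_append)
qed

lemma rep_vec:
  assumes "u \<in> carrier_vec d"
  shows "rep (gen \<sigma>2) *\<^sub>v u = B *\<^sub>v u"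
    "rep (braid_class [(\<sigma>1, True), (\<sigma>2, True)]) *\<^sub>v u = Y *\<^sub>v u"
    "rep (braid_class [(\<sigma>1, True), (\<sigma>2, True), (\<sigma>1, True)]) *\<^sub>v u = X *\<^sub>v u"
    "rep (gen \<sigma>1) *\<^sub>v u = inverse \<delta> \<cdot>\<^sub>v (Y *\<^sub>v (Y *\<^sub>v (X *\<^sub>v u)))"
  using assms by (simp_all add: gen_def word_mat_Cons_vec letter_vec B_vec smult_smult_assoc del: word_mat_Cons letter.simps)

lemma rep_central_scalar: "d \<noteq> 0 \<Longrightarrow> central_scalar d rep = \<delta>"
proof (rule central_scalar_eq)
  show "rep ((gen \<sigma>1 \<otimes>\<^bsub>B3\<^esub> gen \<sigma>2) [^]\<^bsub>B3\<^esub> (3::nat)) = \<delta> \<cdot>\<^sub>m 1\<^sub>m d"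
    unfolding B3_cube rep_class
  proof (rule eq_mat_on_vecI[of _ d d])
    fix u :: "'k vec" assume "u \<in> carrier_vec d"
    moreover have e: "inverse \<delta> * (\<delta> * \<delta>) = \<delta>" by simp
    ultimately show "word_mat [(\<sigma>1, True), (\<sigma>2, True), (\<sigma>1, True), (\<sigma>2, True), (\<sigma>1, True), (\<sigma>2, True)] *\<^sub>v u = (\<delta> \<cdot>\<^sub>m 1\<^sub>m d) *\<^sub>v u"
      by (simp add: word_mat_Cons_vec letter_vec smult_smult_assoc e smult_mult_mat_vec[of _ d d] del: word_mat_Cons letter.simps)
  qed (rule word_mat_carrier, simp)
qed

lemma rep_char_poly: "char_poly (rep (gen \<sigma>1)) = char_poly B"
proof -
  have Xinv: "X * (inverse \<delta> \<cdot>\<^sub>m X) = 1\<^sub>m d" "(inverse \<delta> \<cdot>\<^sub>m X) * X = 1\<^sub>m d"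
    by (rule scaled_inverse[OF X X X2 \<delta>])+
  interpret S: base_change d X "inverse \<delta> \<cdot>\<^sub>m X" by unfold_locales (use Xinv in auto)
  have g: "rep (gen \<sigma>1) \<in> carrier_mat d d" by (simp add: gen_def del: word_mat_Cons)
  have "B * X = X * rep (gen \<sigma>1)"
  proof (rule eq_mat_on_vecI[of _ d d])
    fix u :: "'k vec" assume u: "u \<in> carrier_vec d"
    then show "B * X *\<^sub>v u = X * rep (gen \<sigma>1) *\<^sub>v u"
      by (simp add: assoc_mult_mat_vec[OF B X] assoc_mult_mat_vec[OF X g] rep_vec B_vec)
  qed (rule mult_carrier_mat[OF B X] mult_carrier_mat[OF X g])+
  from S.intertwined_eq[OF B g this] show ?thesis using S.conjugate(4)[OF B] by simp
qed

lemma rep_simple: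
  assumes irr: "irreducible_pair d X Y" and d: "d \<noteq> 0"
  shows "simple_B3_module d rep"
  unfolding simple_B3_module_def
proof (intro conjI allI impI rep_B3 d)
  fix W assume *: "subspace class_ring W (module_vec TYPE('k) d) \<and> (\<forall>h\<in>carrier B3. \<forall>w\<in>W. rep h *\<^sub>v w \<in> W)"
  have "X *\<^sub>v w \<in> W \<and> Y *\<^sub>v w \<in> W" if w: "w \<in> W" for w
  proof -
    have "w \<in> carrier_vec d" using * w by (auto simp: subspace_module_vec_iff)
    then show ?thesis using * w braid_class_in_B3 rep_vec(2,3) by metis
  qed
  then show "W = {0\<^sub>v d} \<or> W = carrier_vec d" using irr * unfolding irreducible_pair_def by blast
qed

end

section \<open>The classification\<close>

lemma (in twist_pair) Y_cancel:
  assumes M: "M \<in> carrier_mat d d" and N: "N \<in> carrier_mat d d" and eq: "Y * M = Y * N"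
  shows "M = N"
proof (rule eq_mat_on_vecI[OF M N])
  fix u :: "'k vec" assume u: "u \<in> carrier_vec d"
  have c: "M *\<^sub>v u \<in> carrier_vec d" "N *\<^sub>v u \<in> carrier_vec d" using u M N mult_mat_vec_carrier by blast+
  have "Y *\<^sub>v (M *\<^sub>v u) = Y *\<^sub>v (N *\<^sub>v u)"
    using assoc_mult_mat_vec[OF Y M u] assoc_mult_mat_vec[OF Y N u] eq by simp
  then have "inverse \<delta> \<cdot>\<^sub>v (Y *\<^sub>v (Y *\<^sub>v (Y *\<^sub>v (M *\<^sub>v u)))) = inverse \<delta> \<cdot>\<^sub>v (Y *\<^sub>v (Y *\<^sub>v (Y *\<^sub>v (N *\<^sub>v u))))"
    by simp
  then show "M *\<^sub>v u = N *\<^sub>v u" using c by (simp add: smult_smult_assoc)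
qed

lemma simple_module_spectrum:
  fixes \<rho> :: "braid_word set \<Rightarrow> 'k::alg_closed_field mat"
  assumes simple: "simple_B3_module d \<rho>" and ev: "eigenvalue_mset (\<rho> (gen \<sigma>1)) = mset es"
    and g: "d = 4 \<longrightarrow> assoc_root4 \<rho> = g" "d = 5 \<longrightarrow> assoc_root5 \<rho> = g"
  shows "char_poly (braid_mat (central_scalar d \<rho>) (braid_module.X \<rho>) (braid_module.Y \<rho>)) = (\<Prod>e\<leftarrow>es. [:-e, 1:])"
    and "root_condition d g (prod_list es) (central_scalar d \<rho>)"
proof -
  interpret braid_module d \<rho> by unfold_locales (use simple in \<open>simp add: simple_B3_module_def\<close>)
  interpret T: irreducible_twist_pair d X Y "central_scalar d \<rho>" by (rule simple_module_pair(1)[OF simple])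
  note cp = char_poly_eigenvalue_mset[OF gen_carrier ev]
  show cpB: "char_poly (braid_mat (central_scalar d \<rho>) X Y) = (\<Prod>e\<leftarrow>es. [:-e, 1:])"
    using simple_module_pair(2,3)[OF simple] cp by simp
  have "e \<noteq> 0" if "e \<in> set es" for e
    by (rule T.eigenvalue_nonzero) (use that in \<open>simp only: cpB poly_linear_factors\<close>)
  then have "prod_list es \<noteq> 0" by (auto simp: prod_list_zero_iff)
  moreover have "det a = prod_list es" by (rule det_linear_factors[OF gen_carrier cp])
  ultimately have "assoc_root4 \<rho> * prod_list es = - central_scalar 4 \<rho>" "assoc_root5 \<rho> * prod_list es = central_scalar 5 \<rho>"
    by (simp_all add: assoc_root4_def assoc_root5_def)
  then show "root_condition d g (prod_list es) (central_scalar d \<rho>)"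
    using g unfolding root_condition_def by metis
qed

lemma simple_module_normal_form:
  fixes \<rho> :: "braid_word set \<Rightarrow> 'k::alg_closed_field mat"
  assumes simple: "simple_B3_module d \<rho>" and d: "2 \<le> d" "d \<le> 5"
    and ev: "eigenvalue_mset (\<rho> (gen \<sigma>1)) = mset (\<alpha> # es)"
    and g: "d = 4 \<longrightarrow> assoc_root4 \<rho> = g" "d = 5 \<longrightarrow> assoc_root5 \<rho> = g"
  shows "normal_form d \<alpha> es g" "central_scalar d \<rho> = nf_delta d \<alpha> es g"
    "\<exists>P Q. base_change d P Q \<and> braid_module.X \<rho> * P = P * nf_X d \<alpha> es g \<and>
      braid_module.Y \<rho> * P = P * nf_Y d \<alpha> es g"
proof -
  note irr = simple_module_pair(1)[OF simple]
  interpret braid_module d \<rho> by unfold_locales (use simple in \<open>simp add: simple_B3_module_def\<close>)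
  interpret T: irreducible_twist_pair d X Y "central_scalar d \<rho>" by (rule irr)
  note spec = simple_module_spectrum[OF simple ev g]
  have "poly (char_poly (braid_mat (central_scalar d \<rho>) X Y)) \<alpha> = 0" unfolding spec(1) poly_linear_factors by simp
  then have "eigenvalue (braid_mat (central_scalar d \<rho>) X Y) \<alpha>" using eigenvalue_root_char_poly[OF T.B] by blast
  then obtain y where y: "y \<in> carrier_vec d" "y \<noteq> 0\<^sub>v d" "braid_mat (central_scalar d \<rho>) X Y *\<^sub>v y = \<alpha> \<cdot>\<^sub>v y"
    using T.B unfolding eigenvalue_def eigenvector_def by auto
  obtain v where v: "v \<in> carrier_vec d" "Y *\<^sub>v v = y" "X *\<^sub>v v = \<alpha> \<cdot>\<^sub>v (Y *\<^sub>v v)"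
    using T.pull_back_eigenvector[OF y(1,3)] by blast
  have "Y *\<^sub>v 0\<^sub>v d = 0\<^sub>v d" by (rule mult_zero_vec_right[OF T.Y])
  then have v0: "v \<noteq> 0\<^sub>v d" using v(2) y(2) by auto
  have rc: "root_condition d g (\<alpha> * prod_list es) (central_scalar d \<rho>)" using spec(2) by simp
  note nf = normal_form_exists[OF irr d spec(1) rc v(1) v0 v(3)]
  show "normal_form d \<alpha> es g" "central_scalar d \<rho> = nf_delta d \<alpha> es g" by (rule nf)+
  show "\<exists>P Q. base_change d P Q \<and> X * P = P * nf_X d \<alpha> es g \<and> Y * P = P * nf_Y d \<alpha> es g"
    using nf(3) by blast
qed

text \<open>Both modules have the same normal form, so composing the two changes of basis intertwines \<open>X\<close> and \<open>Y\<close>,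
  hence also the generators.\<close>

lemma simple_modules_isomorphic:
  fixes \<rho> \<rho>' :: "braid_word set \<Rightarrow> 'k::alg_closed_field mat"
  assumes simple: "simple_B3_module d \<rho>" "simple_B3_module d \<rho>'" and d: "2 \<le> d" "d \<le> 5"
    and ev: "eigenvalue_mset (\<rho> (gen \<sigma>1)) = eigenvalue_mset (\<rho>' (gen \<sigma>1))"
    and roots: "d = 4 \<longrightarrow> assoc_root4 \<rho> = assoc_root4 \<rho>'" "d = 5 \<longrightarrow> assoc_root5 \<rho> = assoc_root5 \<rho>'"
  shows "B3_module_iso d \<rho> \<rho>'"
proof -
  interpret r: braid_module d \<rho> by unfold_locales (use simple in \<open>simp add: simple_B3_module_def\<close>)
  interpret s: braid_module d \<rho>' by unfold_locales (use simple in \<open>simp add: simple_B3_module_def\<close>)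
  let ?g = "if d = 4 then assoc_root4 \<rho> else assoc_root5 \<rho>"
  obtain fs where fs: "eigenvalue_mset (\<rho> (gen \<sigma>1)) = mset fs" by (metis ex_mset)
  have "length fs = d"
    using degree_monic_char_poly[OF r.gen_carrier[of \<sigma>1]] degree_linear_factors[of uminus fs]
      char_poly_eigenvalue_mset[OF r.gen_carrier fs] by simp
  then obtain \<alpha> es where "fs = \<alpha> # es" using d by (cases fs) auto
  then have evs: "eigenvalue_mset (\<rho> (gen \<sigma>1)) = mset (\<alpha> # es)" "eigenvalue_mset (\<rho>' (gen \<sigma>1)) = mset (\<alpha> # es)"
    using fs ev by simp_all
  have g: "d = 4 \<longrightarrow> assoc_root4 \<rho> = ?g" "d = 5 \<longrightarrow> assoc_root5 \<rho> = ?g"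
    "d = 4 \<longrightarrow> assoc_root4 \<rho>' = ?g" "d = 5 \<longrightarrow> assoc_root5 \<rho>' = ?g" using roots by auto
  let ?NX = "nf_X d \<alpha> es ?g" and ?NY = "nf_Y d \<alpha> es ?g"
  note nf = simple_module_normal_form[OF simple(1) d evs(1) g(1,2)]
  note nf' = simple_module_normal_form[OF simple(2) d evs(2) g(3,4)]
  have \<delta>: "central_scalar d \<rho>' = central_scalar d \<rho>" using nf(2) nf'(2) by simp
  obtain P Q where PQ: "base_change d P Q" "r.X * P = P * ?NX" "r.Y * P = P * ?NY" using nf(3) by blast
  obtain P' Q' where PQ': "base_change d P' Q'" "s.X * P' = P' * ?NX" "s.Y * P' = P' * ?NY" using nf'(3) by blast
  interpret N: normal_form d \<alpha> es ?g by (rule nf(1))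
  interpret p: base_change d P Q by fact
  interpret p': base_change d P' Q' by fact
  define R where "R = P' * Q"
  have R: "R \<in> carrier_mat d d" unfolding R_def by (rule mult_carrier_mat[OF p'.P p.Q])
  have inverse: "base_change d R (P * Q')"
  proof
    show "P * Q' \<in> carrier_mat d d" by (rule mult_carrier_mat[OF p.P p'.Q])
    show "R * (P * Q') = 1\<^sub>m d"
      unfolding R_def using assoc_mult_mat[OF p'.P p.Q mult_carrier_mat[OF p.P p'.Q]] assoc_mult_mat[OF p.Q p.P p'.Q]
        left_mult_one_mat[OF p'.Q] by (simp add: p.QP p'.PQ)
    show "P * Q' * R = 1\<^sub>m d"
      unfolding R_def using assoc_mult_mat[OF p.P p'.Q mult_carrier_mat[OF p'.P p.Q]] assoc_mult_mat[OF p'.Q p'.P p.Q]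
        left_mult_one_mat[OF p.Q] by (simp add: p.PQ p'.QP)
  qed (rule R)
  have intertwine: "M' * R = R * M"
    if M: "M \<in> carrier_mat d d" and M': "M' \<in> carrier_mat d d" and NN: "N \<in> carrier_mat d d"
      and N: "M * P = P * N" "M' * P' = P' * N" for M M' N
  proof -
    have Nc: "Q * M * P = N" by (rule p.intertwined_eq[OF M NN N(1)])
    have "M' * R = P' * N * Q" unfolding R_def using assoc_mult_mat[OF M' p'.P p.Q] N(2) by simp
    also have "\<dots> = P' * (N * Q)" by (rule assoc_mult_mat[OF p'.P NN p.Q])
    also have "N * Q = Q * M"
      unfolding Nc[symmetric]
      using assoc_mult_mat[OF mult_carrier_mat[OF p.Q M] p.P p.Q] right_mult_one_mat[OF mult_carrier_mat[OF p.Q M]]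
      by (simp add: p.PQ)
    also have "P' * (Q * M) = R * M" unfolding R_def by (rule assoc_mult_mat[OF p'.P p.Q M, symmetric])
    finally show ?thesis .
  qed
  have XR: "s.X * R = R * r.X" by (rule intertwine[OF r.X_carrier s.X_carrier N.X PQ(2) PQ'(2)])
  have YR: "s.Y * R = R * r.Y" by (rule intertwine[OF r.Y_carrier s.Y_carrier N.Y PQ(3) PQ'(3)])
  interpret T: irreducible_twist_pair d r.X r.Y "central_scalar d \<rho>" by (rule simple_module_pair(1)[OF simple(1)])
  interpret T': irreducible_twist_pair d s.X s.Y "central_scalar d \<rho>"
    using simple_module_pair(1)[OF simple(2)] by (simp only: \<delta>)
  have b: "s.b * R = R * r.b"
    using intertwined_braid_mat[OF T'.twist_pair_axioms T.twist_pair_axioms R XR YR]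
      simple_module_pair(2)[OF simple(1)] simple_module_pair(2)[OF simple(2)] \<delta> by simp
  have a: "s.a * R = R * r.a"
  proof (rule T'.Y_cancel)
    have "s.Y * (s.a * R) = s.X * R"
      unfolding s.X_eq(1) by (rule assoc_mult_mat[OF s.Y_carrier s.gen_carrier R, symmetric])
    also have "\<dots> = R * r.Y * r.a"
      unfolding XR r.X_eq(1) by (rule assoc_mult_mat[OF R r.Y_carrier r.gen_carrier, symmetric])
    also have "\<dots> = s.Y * (R * r.a)"
      unfolding YR[symmetric] by (rule assoc_mult_mat[OF s.Y_carrier R r.gen_carrier])
    finally show "s.Y * (s.a * R) = s.Y * (R * r.a)" .
  qed (rule mult_carrier_mat[OF s.gen_carrier R] mult_carrier_mat[OF R r.gen_carrier])+
  show ?thesis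
  proof (rule braid_module_isoI[OF r.module s.module inverse])
    show "R * \<rho> (gen t) = \<rho>' (gen t) * R" for t using a b by (cases t) simp_all
  qed
qed

lemma braid_Q_Q_value:
  assumes d: "2 \<le> d" "d \<le> 5" and rs: "distinct (r # s # rs)" "set (r # s # rs) = {1..d}"
  shows "braid_Q d lam g r s = Q_value d g (lam r) (lam s) (map lam rs)"
proof -
  have "length (r # s # rs) = d" using distinct_card[OF rs(1)] rs(2) by simp
  then have len: "length rs = d - 2" by simp
  have diff: "{1..d} - {r, s} = set rs" using rs by auto
  have dd: "d = 2 \<or> d = 3 \<or> d = 4 \<or> d = 5" using d by auto
  have diff3: "{1..d} - {r, s, k} = set rs - {k}" for k using diff by auto
  consider "d = 2" | "d = 3" | "d = 4" | "d = 5" using dd by blast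
  then show ?thesis
  proof cases
    case 1
    then show ?thesis by (simp add: braid_Q_def Q_value_def Q2_def)
  next
    case 2
    then obtain k where "rs = [k]" using len by (auto simp: numeral_eq_Suc length_Suc_conv)
    then show ?thesis using 2 diff by (simp add: braid_Q_def Q_value_def Q3_def)
  next
    case 3
    then obtain k l where kl: "rs = [k, l]" using len by (auto simp: numeral_eq_Suc length_Suc_conv)
    have "set rs - {k} = {l}" "set rs - {l} = {k}" "k \<noteq> l" using kl rs(1) by auto
    then show ?thesis using 3 diff diff3 kl by (simp add: braid_Q_def Q_value_def Q4_def mult.assoc)
  next
    case 4
    have "(\<Prod>k\<in>{1..d} - {r, s}. (g^2 + lam r * lam k) * (g^2 + lam s * lam k)) =
      (\<Prod>k\<leftarrow>rs. (g^2 + lam r * lam k) * (g^2 + lam s * lam k))"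
      unfolding diff using rs(1) by (intro prod.distinct_set_conv_list) simp
    then show ?thesis using 4 by (simp add: braid_Q_def Q_value_def Q5_def o_def)
  qed
qed

lemma mset_eq_map:
  assumes "mset ys = mset (map f xs)"
  obtains zs where "mset zs = mset xs" "ys = map f zs"
proof -
  obtain p where p: "p permutes {..<length xs}" "permute_list p (map f xs) = ys"
    using mset_eq_permutation[OF assms] by auto
  show ?thesis
  proof (rule that)
    show "mset (permute_list p xs) = mset xs" by (rule mset_permute_list[OF p(1)])
    show "ys = map f (permute_list p xs)" using p by (simp add: permute_list_map)
  qed
qed

lemma simple_module_Q:
  fixes \<rho> :: "braid_word set \<Rightarrow> 'k::alg_closed_field mat"
  assumes simple: "simple_B3_module d \<rho>" and d: "2 \<le> d" "d \<le> 5"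
    and ev: "eigenvalue_mset (\<rho> (gen \<sigma>1)) = image_mset lam (mset_set {1..d})"
    and g: "d = 4 \<longrightarrow> assoc_root4 \<rho> = g" "d = 5 \<longrightarrow> assoc_root5 \<rho> = g"
    and r: "r \<in> {1..d}" and s: "s \<in> {1..d}" and rs: "r \<noteq> s"
  shows "braid_Q d lam g r s \<noteq> 0"
proof -
  \<comment> \<open>Any enumeration of the remaining indices would do.\<close>
  define ks where "ks = sorted_list_of_set ({1..d} - {r, s})"
  have ks: "distinct (r # s # ks)" "set (r # s # ks) = {1..d}" using r s rs by (auto simp: ks_def)
  have "mset_set {1..d} = mset (r # s # ks)" unfolding ks(2)[symmetric] by (rule mset_set_set[OF ks(1)])
  then have ev': "eigenvalue_mset (\<rho> (gen \<sigma>1)) = mset (lam r # lam s # map lam ks)" using ev by simp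
  note spec = simple_module_spectrum[OF simple ev' g]
  have "root_condition d g (lam r * prod_list (lam s # map lam ks)) (central_scalar d \<rho>)" using spec(2) by simp
  from Q_value_nonzero[OF simple_module_pair(1)[OF simple] d spec(1) this] show ?thesis
    unfolding braid_Q_Q_value[OF d ks] .
qed

lemma simple_module_exists:
  fixes lam :: "nat \<Rightarrow> 'k::alg_closed_field"
  assumes d: "2 \<le> d" "d \<le> 5" and nz: "\<forall>i\<in>{1..d}. lam i \<noteq> 0"
    and g: "d = 4 \<longrightarrow> g^2 = (\<Prod>i\<in>{1..4}. lam i)" "d = 5 \<longrightarrow> g^5 = (\<Prod>i\<in>{1..5}. lam i)"
    and Q: "\<forall>r\<in>{1..d}. \<forall>s\<in>{1..d}. r \<noteq> s \<longrightarrow> braid_Q d lam g r s \<noteq> 0"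
  shows "\<exists>\<rho> :: braid_word set \<Rightarrow> 'k mat. simple_B3_module d \<rho> \<and>
    eigenvalue_mset (\<rho> (gen \<sigma>1)) = image_mset lam (mset_set {1..d}) \<and>
    (d = 4 \<longrightarrow> assoc_root4 \<rho> = g) \<and> (d = 5 \<longrightarrow> assoc_root5 \<rho> = g)"
proof -
  define es where "es = map lam [2..<Suc d]"
  have idx: "set (1 # [2..<Suc d]) = {1..d}" "distinct (1 # [2..<Suc d])" using d by auto
  have all: "mset (lam 1 # es) = image_mset lam (mset_set {1..d})"
    using mset_set_set[OF idx(2)] unfolding idx(1) es_def by simp
  have prod: "lam 1 * prod_list es = (\<Prod>i\<in>{1..d}. lam i)"
    using prod.distinct_set_conv_list[OF idx(2), of lam] unfolding idx(1) es_def by simp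
  interpret T: normal_form d "lam 1" es g
  proof
    show "0 \<notin> set es" using nz by (auto simp: es_def)
  qed (use d nz g prod in \<open>auto simp: es_def\<close>)
  have "irreducible_pair d T.NX T.NY"
  proof (rule T.irreducible_if)
    fix \<mu> ks assume "mset es = mset (\<mu> # ks)"
    then obtain zs where zs: "mset zs = mset [2..<Suc d]" "\<mu> # ks = map lam zs"
      using mset_eq_map[of "\<mu> # ks" lam "[2..<Suc d]"] unfolding es_def by metis
    obtain s rs where s: "zs = s # rs" "\<mu> = lam s" "ks = map lam rs" using zs(2) by (cases zs) auto
    have "mset (1 # s # rs) = mset (1 # [2..<Suc d])" using zs(1) s(1) by simp
    then have rs: "distinct (1 # s # rs)" "set (1 # s # rs) = {1..d}"
      using mset_eq_imp_distinct_iff idx mset_eq_setD by metis+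
    have "1 \<in> {1..d}" "s \<in> {1..d}" "1 \<noteq> s" using rs d by auto
    then have "braid_Q d lam g 1 s \<noteq> 0" using Q by blast
    then show "Q_value d g (lam 1) \<mu> ks \<noteq> 0" unfolding braid_Q_Q_value[OF d rs] s .
  qed
  then have simple: "simple_B3_module d T.rep" using d by (intro T.rep_simple) auto
  have cp: "char_poly (T.rep (gen \<sigma>1)) = (\<Prod>e\<leftarrow>lam 1 # es. [:-e, 1:])"
    unfolding T.rep_char_poly by (rule T.char_poly_NB)
  have ev: "eigenvalue_mset (T.rep (gen \<sigma>1)) = image_mset lam (mset_set {1..d})"
    using eigenvalue_mset_linear_factors[OF cp] all by simp
  have det: "det (T.rep (gen \<sigma>1)) = lam 1 * prod_list es"
  proof -
    have "T.rep (gen \<sigma>1) \<in> carrier_mat d d" unfolding gen_def T.rep_class by (rule T.word_mat_carrier)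
    from det_linear_factors[OF this cp] show ?thesis by (simp only: prod_list.Cons)
  qed
  have \<delta>: "central_scalar d T.rep = T.N\<delta>" using d by (intro T.rep_central_scalar) simp
  have nz': "lam 1 * prod_list es \<noteq> 0" using T.\<alpha> T.es by (simp add: prod_list_zero_iff)
  have "assoc_root4 T.rep = g" if "d = 4"
  proof -
    have D: "lam 1 * prod_list es = g^2" and "g \<noteq> 0" using T.g4[OF that] nz' by auto
    then show ?thesis using det \<delta> that unfolding assoc_root4_def D
      by (simp add: nf_delta_def power2_eq_square power3_eq_cube)
  qed
  moreover have "assoc_root5 T.rep = g" if "d = 5"
  proof -
    have D: "lam 1 * prod_list es = g^5" and "g \<noteq> 0" using T.g5[OF that] nz' by auto
    then show ?thesis using det \<delta> that unfolding assoc_root5_def D by (simp add: nf_delta_def eval_nat_numeral)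
  qed
  ultimately show ?thesis using simple ev by blast
qed

subsection \<open>Dimension one\<close>

lemma eigenvalue_mset_1: "A \<in> carrier_mat 1 1 \<Longrightarrow> eigenvalue_mset A = {# A $$ (0, 0) #}" for A :: "'k::field mat"
  using eigenvalue_mset_linear_factors[of A "[A $$ (0, 0)]"] char_poly_upper_triangular[of A 1]
  by (auto simp: diag_mat_def upper_triangular_def)

lemma eigenvalue_mset_1_eq:
  fixes A A' :: "'k::field mat"
  assumes "A \<in> carrier_mat 1 1" "A' \<in> carrier_mat 1 1" "eigenvalue_mset A = eigenvalue_mset A'"
  shows "A = A'"
  using assms eigenvalue_mset_1[OF assms(1)] eigenvalue_mset_1[OF assms(2)] by (auto intro!: eq_matI)

lemma one_dimensional_isomorphic:
  fixes \<rho> \<rho>' :: "braid_word set \<Rightarrow> 'k::alg_closed_field mat"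
  assumes simple: "simple_B3_module 1 \<rho>" "simple_B3_module 1 \<rho>'"
    and ev: "eigenvalue_mset (\<rho> (gen \<sigma>1)) = eigenvalue_mset (\<rho>' (gen \<sigma>1))"
  shows "B3_module_iso 1 \<rho> \<rho>'"
proof -
  interpret r: braid_module 1 \<rho> by unfold_locales (use simple in \<open>simp add: simple_B3_module_def\<close>)
  interpret s: braid_module 1 \<rho>' by unfold_locales (use simple in \<open>simp add: simple_B3_module_def\<close>)
  have "\<rho> (gen t) = \<rho>' (gen t)" for t
  proof (rule eigenvalue_mset_1_eq[OF r.gen_carrier s.gen_carrier])
    show "eigenvalue_mset (\<rho> (gen t)) = eigenvalue_mset (\<rho>' (gen t))"
      using simple_module_pair(3)[OF simple(1)] simple_module_pair(3)[OF simple(2)] ev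
      by (cases t) (simp_all add: eigenvalue_mset_def)
  qed
  then have gen: "1\<^sub>m 1 * \<rho> (gen t) = \<rho>' (gen t) * 1\<^sub>m 1" for t
    using left_mult_one_mat[OF s.gen_carrier] right_mult_one_mat[OF s.gen_carrier] by simp
  have "base_change 1 (1\<^sub>m 1) (1\<^sub>m 1 :: 'k mat)" by unfold_locales auto
  from braid_module_isoI[OF r.module s.module this gen] show ?thesis .
qed

lemma one_dimensional_exists:
  fixes c :: "'k::alg_closed_field"
  assumes c: "c \<noteq> 0"
  shows "\<exists>\<rho> :: braid_word set \<Rightarrow> 'k mat. simple_B3_module 1 \<rho> \<and> eigenvalue_mset (\<rho> (gen \<sigma>1)) = {# c #}"
proof -
  have mult: "(s \<cdot>\<^sub>m 1\<^sub>m 1) * (t \<cdot>\<^sub>m 1\<^sub>m 1) = (s * t) \<cdot>\<^sub>m (1\<^sub>m 1 :: 'k mat)" for s t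
    by (rule eq_matI) (auto simp: scalar_prod_def)
  \<comment> \<open>The values of \<open>\<sigma>\<^sub>1\<sigma>\<^sub>2\<sigma>\<^sub>1\<close> and \<open>\<sigma>\<^sub>1\<sigma>\<^sub>2\<close> when both generators act by \<open>c\<close>.\<close>
  let ?X = "c^3 \<cdot>\<^sub>m 1\<^sub>m 1" and ?Y = "c^2 \<cdot>\<^sub>m (1\<^sub>m 1 :: 'k mat)"
  interpret T: twist_pair 1 ?X ?Y "c^6"
    by unfold_locales (use c in \<open>simp_all add: mult[unfolded One_nat_def] flip: power_add\<close>)
  have "irreducible_pair 1 ?X ?Y"
    unfolding irreducible_pair_def
  proof (intro allI impI)
    fix W assume "subspace class_ring W (module_vec TYPE('k) 1)"
    note W = this[unfolded subspace_module_vec_iff]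
    show "W = {0\<^sub>v 1} \<or> W = carrier_vec 1"
    proof (cases "W \<subseteq> {0\<^sub>v 1}")
      case True
      then show ?thesis using W by auto
    next
      case False
      then obtain w where w: "w \<in> W" "w \<noteq> 0\<^sub>v 1" by blast
      then have wc: "w \<in> carrier_vec 1" using W by blast
      have w0: "w $ 0 \<noteq> 0"
      proof
        assume "w $ 0 = 0"
        then have "w = 0\<^sub>v 1" using wc by (intro eq_vecI) auto
        then show False using w by blast
      qed
      have "u \<in> W" if u: "u \<in> carrier_vec 1" for u
      proof -
        have "u = (u $ 0 / w $ 0) \<cdot>\<^sub>v w" using u wc w0 by (intro eq_vecI) auto
        moreover have "(u $ 0 / w $ 0) \<cdot>\<^sub>v w \<in> W" using W w(1) by blast
        ultimately show ?thesis by (rule back_subst[OF _ HOL.sym, rotated])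
      qed
      then show ?thesis using W by blast
    qed
  qed
  then have "simple_B3_module 1 T.rep" by (intro T.rep_simple) auto
  moreover have "eigenvalue_mset (T.rep (gen \<sigma>1)) = {# c #}"
  proof -
    have "c^3 * (c^2 * c^2) = c^6 * c" by (simp add: eval_nat_numeral)
    then have "inverse (c^6) * (c^3 * (c^2 * c^2)) = c" using c by simp
    then have "braid_mat (c^6) ?X ?Y = c \<cdot>\<^sub>m 1\<^sub>m 1" unfolding braid_mat_def mult by (auto intro!: eq_matI)
    moreover have "eigenvalue_mset (T.rep (gen \<sigma>1)) = eigenvalue_mset (braid_mat (c^6) ?X ?Y)"
      unfolding eigenvalue_mset_def T.rep_char_poly by (rule HOL.refl)
    ultimately show ?thesis using eigenvalue_mset_1[of "c \<cdot>\<^sub>m 1\<^sub>m 1"] by simp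
  qed
  ultimately show ?thesis by blast
qed

subsection \<open>All dimensions\<close>

theorem mainTheorem1:
  fixes d :: nat
  assumes "1 \<le> d" and "d \<le> 5"
  shows
    "(\<forall>(\<rho> :: braid_word set \<Rightarrow> 'k::alg_closed_field mat) \<rho>'.
        simple_B3_module d \<rho> \<and> simple_B3_module d \<rho>' \<and>
        eigenvalue_mset (\<rho> (gen \<sigma>1)) = eigenvalue_mset (\<rho>' (gen \<sigma>1)) \<and>
        (d = 4 \<longrightarrow> assoc_root4 \<rho> = assoc_root4 \<rho>') \<and>
        (d = 5 \<longrightarrow> assoc_root5 \<rho> = assoc_root5 \<rho>')
        \<longrightarrow> B3_module_iso d \<rho> \<rho>')
     \<and>
     (\<forall>(lam :: nat \<Rightarrow> 'k) (g :: 'k).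
        (\<forall>i\<in>{1..d}. lam i \<noteq> 0) \<and>
        (d = 4 \<longrightarrow> g^2 = (\<Prod>i\<in>{1..4}. lam i)) \<and>
        (d = 5 \<longrightarrow> g^5 = (\<Prod>i\<in>{1..5}. lam i))
        \<longrightarrow>
        ((\<exists>\<rho> :: braid_word set \<Rightarrow> 'k mat.
            simple_B3_module d \<rho> \<and>
            eigenvalue_mset (\<rho> (gen \<sigma>1)) = image_mset lam (mset_set {1..d}) \<and>
            (d = 4 \<longrightarrow> assoc_root4 \<rho> = g) \<and>
            (d = 5 \<longrightarrow> assoc_root5 \<rho> = g))
         \<longleftrightarrow> (\<forall>r\<in>{1..d}. \<forall>s\<in>{1..d}. r \<noteq> s \<longrightarrow> braid_Q d lam g r s \<noteq> 0)))"
proof (cases "d = 1")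
  case True
  have "\<exists>\<rho> :: braid_word set \<Rightarrow> 'k mat. simple_B3_module 1 \<rho> \<and>
      eigenvalue_mset (\<rho> (gen \<sigma>1)) = image_mset lam (mset_set {1..1})" if "lam 1 \<noteq> 0" for lam :: "nat \<Rightarrow> 'k"
    using one_dimensional_exists[OF that] by simp
  then show ?thesis using one_dimensional_isomorphic unfolding True by auto
next
  case False
  then have d: "2 \<le> d" using assms(1) by simp
  show ?thesis
  proof (intro conjI allI impI iffI ballI; elim exE conjE)
    fix \<rho> \<rho>' :: "braid_word set \<Rightarrow> 'k mat"
    assume "simple_B3_module d \<rho>" "simple_B3_module d \<rho>'"
      "eigenvalue_mset (\<rho> (gen \<sigma>1)) = eigenvalue_mset (\<rho>' (gen \<sigma>1))"
      "d = 4 \<longrightarrow> assoc_root4 \<rho> = assoc_root4 \<rho>'" "d = 5 \<longrightarrow> assoc_root5 \<rho> = assoc_root5 \<rho>'"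
    then show "B3_module_iso d \<rho> \<rho>'" using d assms(2) by (intro simple_modules_isomorphic)
  next
    fix lam :: "nat \<Rightarrow> 'k" and g r s and \<rho> :: "braid_word set \<Rightarrow> 'k mat"
    assume "simple_B3_module d \<rho>" "eigenvalue_mset (\<rho> (gen \<sigma>1)) = image_mset lam (mset_set {1..d})"
      "d = 4 \<longrightarrow> assoc_root4 \<rho> = g" "d = 5 \<longrightarrow> assoc_root5 \<rho> = g" "r \<in> {1..d}" "s \<in> {1..d}" "r \<noteq> s"
    then show "braid_Q d lam g r s \<noteq> 0" using d assms(2) by (intro simple_module_Q)
  next
    fix lam :: "nat \<Rightarrow> 'k" and g
    assume "\<forall>r\<in>{1..d}. \<forall>s\<in>{1..d}. r \<noteq> s \<longrightarrow> braid_Q d lam g r s \<noteq> 0" "\<forall>i\<in>{1..d}. lam i \<noteq> 0"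
      "d = 4 \<longrightarrow> g^2 = (\<Prod>i\<in>{1..4}. lam i)" "d = 5 \<longrightarrow> g^5 = (\<Prod>i\<in>{1..5}. lam i)"
    then show "\<exists>\<rho> :: braid_word set \<Rightarrow> 'k mat. simple_B3_module d \<rho> \<and>
        eigenvalue_mset (\<rho> (gen \<sigma>1)) = image_mset lam (mset_set {1..d}) \<and>
        (d = 4 \<longrightarrow> assoc_root4 \<rho> = g) \<and> (d = 5 \<longrightarrow> assoc_root5 \<rho> = g)"
      using d assms(2) by (intro simple_module_exists)
  qed
qed

end
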